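(* Let $p\in(1,\infty)$, let $\mathcal D$ be a dyadic system on $\mathbb R^d$, and let $\mu$ be a locally finite Borel measure on $\mathbb R^d$. If $b\in\mathrm{VMO}^p(\mathbb R^d,\mathcal D,\mu)$, then the dyadic paraproduct $P_{b,\mathcal D}:L^p(\mathbb R^d,\mu)\to L^p(\mathbb R^d,\mu)$ is compact.
   Context: Dyadic system: $\mathcal D=\bigcup_{k\in\mathbb Z}\mathcal D_k$, where each $\mathcal D_k$ is a partition of $\mathbb R^d$ into half-open cubes of side-length $2^{-k}$ and $\mathcal D_{k+1}$ refines $\mathcal D_k$. Averages: $\langle f\rangle_Q:=\frac1{\mu(Q)}\int_Q f\,d\mu$, with the convention $\langle f\rangle_Q:=0$ if $\mu(Q)=0$. Mean oscillation: $\operatorname{osc}_p(b,Q):=\big(\frac1{\mu(Q)}\int_Q|b-\langle b\rangle_Q|^p\,d\mu\big)^{1/p}$, with $\operatorname{osc}_p(b,Q):=0$ if $\mu(Q)=0$. Dyadic paraproduct: the dyadic children $\operatorname{ch}_{\mathcal D}(Q)$ of $Q\in\mathcal D$ are the maximal (with respect to inclusion) cubes $P\in\mathcal D$ with $P\subsetneq Q$; $$D_Qb:=\sum_{P\in\operatorname{ch}_{\mathcal D}(Q)}(\langle b\rangle_P-\langle b\rangle_Q)1_P,\qquad P_{b,\mathcal D}f:=\sum_{Q\in\mathcal D}D_Qb\,\langle f\rangle_Q1_Q,$$ where the series is understood as converging unconditionally in $L^p(\mathbb R^d,\mu)$; saying that $P_{b,\mathcal D}$ is compact on $L^p(\mathbb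 R^d,\mu)$ means that the series converges for every $f\in L^p(\mathbb R^d,\mu)$ and defines a compact linear operator. $\mathrm{BMO}^p(\mathbb R^d,\mathcal D,\mu)$ is the set of $b\in L^1_{\mathrm{loc}}(\mathbb R^d,\mu)$ with $\sup_{Q\in\mathcal D}\operatorname{osc}_p(b,Q)<\infty$. $\mathrm{VMO}^p(\mathbb R^d,\mathcal D,\mu)$ is the set of $b\in\mathrm{BMO}^p(\mathbb R^d,\mathcal D,\mu)$ such that $$\lim_{M\to\infty}\sup_{Q\in\mathcal D:\,\mu(Q)\ge M}\operatorname{osc}_p(b,Q)=0,\quad \lim_{M\to\infty}\sup_{Q\in\mathcal D:\,\mu(Q)\le1/M}\operatorname{osc}_p(b,Q)=0,\quad \lim_{M\to\infty}\sup_{Q\in\mathcal D:\,\operatorname{dist}(0,Q)\ge M}\operatorname{osc}_p(b,Q)=0$$ (heavy, light and distant cubes), with supremum over an empty collection equal to $0$. *)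

theory Defs
  imports "HOL-Analysis.Analysis"
begin

text \<open>
  Scalar-valued functions take values in a type of class
  \<open>{real_normed_field, euclidean_space}\<close>.  Both \<open>real\<close> and \<open>complex\<close> belong to it, so real and
  complex \<open>L\<^sup>p\<close> spaces are treated at once.
\<close>

definition half_open_cube :: "real ^ 'd \<Rightarrow> real \<Rightarrow> (real ^ 'd) set" where
  "half_open_cube a l = {x. \<forall>i. a $ i \<le> x $ i \<and> x $ i < a $ i + l}"

definition dyadic_system :: "(int \<Rightarrow> (real ^ 'd) set set) \<Rightarrow> bool" where
  "dyadic_system D \<longleftrightarrow>
     (\<forall>k. partition_on UNIV (D k)) \<and>
     (\<forall>k. \<forall>Q\<in>D k. \<exists>a. Q = half_open_cube a (2 powi (- k))) \<and>
     (\<forall>k. refines UNIV (D (k + 1)) (D k))"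

definition locally_finite_measure :: "'a::topological_space measure \<Rightarrow> bool" where
  "locally_finite_measure \<mu> \<longleftrightarrow> (\<forall>x. \<exists>U. open U \<and> x \<in> U \<and> emeasure \<mu> U < \<infinity>)"

definition ennreal_rpow :: "ennreal \<Rightarrow> real \<Rightarrow> ennreal" where
  "ennreal_rpow x a = (if x = \<infinity> then \<infinity> else ennreal (enn2real x powr a))"

subsection \<open>Lebesgue spaces\<close>

text \<open>
  Elements of \<open>L\<^sup>p\<close> are represented by functions; equality in \<open>L\<^sup>p\<close> is equality almost everywhere.
  The seminorm is extended-valued, hence \<open>\<infinity>\<close> (and not 0) if the integral diverges.
\<close>

definition Lp_norm :: "'a measure \<Rightarrow> real \<Rightarrow> ('a \<Rightarrow> 'c::real_normed_vector) \<Rightarrow> ennreal" where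
  "Lp_norm \<mu> p f = ennreal_rpow (\<integral>\<^sup>+x. ennreal (norm (f x) powr p) \<partial>\<mu>) (1 / p)"

definition Lp_space :: "'a measure \<Rightarrow> real \<Rightarrow> ('a \<Rightarrow> 'c::real_normed_vector) set" where
  "Lp_space \<mu> p = {f \<in> borel_measurable \<mu>. Lp_norm \<mu> p f < \<infinity>}"

definition L1_loc ::
    "'a::topological_space measure \<Rightarrow> ('a \<Rightarrow> 'c::{banach, second_countable_topology}) set" where
  "L1_loc \<mu> = {f \<in> borel_measurable \<mu>. \<forall>K. compact K \<longrightarrow> set_integrable \<mu> K f}"

text \<open>
  The conditions of preservation of a.e. equality and of linearity up to a.e. equality
  say that \<open>T\<close> induces a well-defined linear operator on the space of a.e. classes; the last
  one says that every bounded sequence has a subsequence whose image converges.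
\<close>

definition compact_operator_on_Lp ::
    "'a measure \<Rightarrow> real \<Rightarrow> (('a \<Rightarrow> 'c::real_normed_field) \<Rightarrow> ('a \<Rightarrow> 'c)) \<Rightarrow> bool" where
  "compact_operator_on_Lp \<mu> p T \<longleftrightarrow>
     (\<forall>f\<in>Lp_space \<mu> p. T f \<in> Lp_space \<mu> p) \<and>
     (\<forall>f\<in>Lp_space \<mu> p. \<forall>g\<in>Lp_space \<mu> p.
        (AE x in \<mu>. f x = g x) \<longrightarrow> (AE x in \<mu>. T f x = T g x)) \<and>
     (\<forall>f\<in>Lp_space \<mu> p. \<forall>g\<in>Lp_space \<mu> p. AE x in \<mu>. T (\<lambda>y. f y + g y) x = T f x + T g x) \<and>
     (\<forall>f\<in>Lp_space \<mu> p. \<forall>c. AE x in \<mu>. T (\<lambda>y. c * f y) x = c * T f x) \<and>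
     (\<forall>F :: nat \<Rightarrow> 'a \<Rightarrow> 'c.
        (\<forall>n. F n \<in> Lp_space \<mu> p) \<and> (SUP n. Lp_norm \<mu> p (F n)) < \<infinity> \<longrightarrow>
        (\<exists>g\<in>Lp_space \<mu> p. \<exists>r. strict_mono r \<and>
           (\<lambda>n. Lp_norm \<mu> p (\<lambda>x. T (F (r n)) x - g x)) \<longlonglongrightarrow> 0))"

subsection \<open>Averages, oscillations, BMO and VMO\<close>

definition average ::
    "'a measure \<Rightarrow> ('a \<Rightarrow> 'c::{banach, second_countable_topology}) \<Rightarrow> 'a set \<Rightarrow> 'c" where
  "average \<mu> f Q =
     (if emeasure \<mu> Q = 0 then 0 else (1 / measure \<mu> Q) *\<^sub>R (LINT x:Q|\<mu>. f x))"

text \<open>Extended-valued, since a locally integrable function need not be locally in \<open>L\<^sup>p\<close>.\<close>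

definition osc ::
    "'a measure \<Rightarrow> real \<Rightarrow> ('a \<Rightarrow> 'c::{banach, second_countable_topology}) \<Rightarrow> 'a set \<Rightarrow> ennreal" where
  "osc \<mu> p b Q =
     (if emeasure \<mu> Q = 0 then 0
      else ennreal_rpow
             ((\<integral>\<^sup>+x\<in>Q. ennreal (norm (b x - average \<mu> b Q) powr p) \<partial>\<mu>) / emeasure \<mu> Q) (1 / p))"

text \<open>
  In the remaining definitions \<open>\<Q>\<close> is the collection of all dyadic cubes, of all generations.
  Suprema are taken in \<open>ennreal\<close>, so the empty supremum is 0.
\<close>

definition BMO ::
    "'a::topological_space measure \<Rightarrow> real \<Rightarrow> 'a set set \<Rightarrow>
     ('a \<Rightarrow> 'c::{banach, second_countable_topology}) set" where
  "BMO \<mu> p \<Q> = {b \<in> L1_loc \<mu>. (SUP Q\<in>\<Q>. osc \<mu> p b Q) < \<infinity>}"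

definition VMO ::
    "'a::real_normed_vector measure \<Rightarrow> real \<Rightarrow> 'a set set \<Rightarrow>
     ('a \<Rightarrow> 'c::{banach, second_countable_topology}) set" where
  "VMO \<mu> p \<Q> = {b \<in> BMO \<mu> p \<Q>.
     ((\<lambda>M::real. SUP Q\<in>{Q\<in>\<Q>. emeasure \<mu> Q \<ge> ennreal M}. osc \<mu> p b Q) \<longlongrightarrow> 0) at_top \<and>
     ((\<lambda>M::real. SUP Q\<in>{Q\<in>\<Q>. emeasure \<mu> Q \<le> ennreal (1 / M)}. osc \<mu> p b Q) \<longlongrightarrow> 0) at_top \<and>
     ((\<lambda>M::real. SUP Q\<in>{Q\<in>\<Q>. infdist 0 Q \<ge> M}. osc \<mu> p b Q) \<longlongrightarrow> 0) at_top}"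

subsection \<open>The dyadic paraproduct\<close>

definition dyadic_children :: "'a set set \<Rightarrow> 'a set \<Rightarrow> 'a set set" where
  "dyadic_children \<Q> Q = {P\<in>\<Q>. P \<subset> Q \<and> (\<forall>R\<in>\<Q>. P \<subseteq> R \<and> R \<subset> Q \<longrightarrow> R = P)}"

text \<open>
  In a dyadic system on \<open>\<real>\<^sup>d\<close> each cube has exactly \<open>2\<^sup>d\<close> children (those of the next
  generation), so the following sum is finite.
\<close>

definition mart_diff ::
    "'a measure \<Rightarrow> 'a set set \<Rightarrow> ('a \<Rightarrow> 'c::{real_normed_field, euclidean_space}) \<Rightarrow>
     'a set \<Rightarrow> 'a \<Rightarrow> 'c" where
  "mart_diff \<mu> \<Q> b Q x =
     (\<Sum>P\<in>dyadic_children \<Q> Q. (average \<mu> b P - average \<mu> b Q) * indicator P x)"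

text \<open>
  Unconditional convergence in \<open>L\<^sup>p\<close> is convergence of the net of finite partial sums, as in
  \<open>has_sum\<close>.
\<close>

definition paraproduct_has_sum ::
    "'a measure \<Rightarrow> real \<Rightarrow> 'a set set \<Rightarrow> ('a \<Rightarrow> 'c::{real_normed_field, euclidean_space}) \<Rightarrow>
     ('a \<Rightarrow> 'c) \<Rightarrow> ('a \<Rightarrow> 'c) \<Rightarrow> bool" where
  "paraproduct_has_sum \<mu> p \<Q> b f g \<longleftrightarrow>
     g \<in> Lp_space \<mu> p \<and>
     ((\<lambda>F. Lp_norm \<mu> p
         (\<lambda>x. (\<Sum>Q\<in>F. mart_diff \<mu> \<Q> b Q x * average \<mu> f Q * indicator Q x) - g x)) \<longlongrightarrow> 0)
       (finite_subsets_at_top \<Q>)"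

text \<open>The sum is determined up to a.e. equality; an arbitrary representative is chosen.\<close>

definition paraproduct ::
    "'a measure \<Rightarrow> real \<Rightarrow> 'a set set \<Rightarrow> ('a \<Rightarrow> 'c::{real_normed_field, euclidean_space}) \<Rightarrow>
     ('a \<Rightarrow> 'c) \<Rightarrow> ('a \<Rightarrow> 'c)" where
  "paraproduct \<mu> p \<Q> b f = (SOME g. paraproduct_has_sum \<mu> p \<Q> b f g)"

definition paraproduct_compact ::
    "'a measure \<Rightarrow> real \<Rightarrow> 'a set set \<Rightarrow> ('a \<Rightarrow> 'c::{real_normed_field, euclidean_space}) \<Rightarrow>
     bool" where
  "paraproduct_compact \<mu> p \<Q> b \<longleftrightarrow>
     (\<forall>f\<in>Lp_space \<mu> p. \<exists>g. paraproduct_has_sum \<mu> p \<Q> b f g) \<and>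
     compact_operator_on_Lp \<mu> p (paraproduct \<mu> p \<Q> b)"

end

theory Submission
  imports Defs "HOL-Complex_Analysis.Great_Picard"
begin

text \<open>
  On a fixed dyadic cube the finite partial sums of the paraproduct are martingales with increments
  \<open>\<langle>f\<rangle>\<^bsub>Q\<^esub> D\<^bsub>Q\<^esub>b\<close>.  Instead of Burkholder's inequality only one-step inequalities are used: explicit
  functions of the martingale and of its running square function or maximum are supermartingales.
  For \<open>p \<le> 2\<close> this bounds the \<open>L\<^sup>p\<close> norm of a martingale by that of its square function and
  conversely; for \<open>p > 2\<close> the increments are summed directly and the excess is absorbed by the
  Doob maximal inequality.  Together with a Carleson embedding, the partial sums over a family \<open>G\<close>
  of cubes are bounded by a Carleson constant of the energies of \<open>D\<^bsub>Q\<^esub>b\<close>, \<open>Q \<in> G\<close>, which itself is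
  bounded by the mean oscillation of \<open>b\<close>.

  Carleson constants become arbitrarily small after discarding finitely many cubes.  A cube with large
  oscillation is neither heavy, nor light, nor distant, hence it is related by inclusion to one of
  finitely many cubes of side-length 1.  Cubes contained in an ancestor of bounded measure of such
  a unit cube have finite total energy, so that its tails vanish.  (The set of cubes of large oscillation itself need not be
  finite: a quadrant may have finite measure.)  Consequently the series converges
  unconditionally and its sum is a norm limit of operators of finite rank.
\<close>

subsection \<open>Pointwise inequalities\<close>

text \<open>A child may carry a tiny fraction of the mass of its parent, so D_Q b is not bounded by
  the oscillation of b on Q. A Carleson condition on squares therefore does not control p-th powers
  of the jumps, and for p > 2 two conditions are carried along, for |D_Q b|^2 and |D_Q b|^p. For p
  \<le> 2 the square function is raised to the power p/2 \<le> 1. Subadditivity of this power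
  permits Abel summation, but the increments of the weight, raised to p/2, no longer telescope. The
  maximal function of f is therefore rounded up to powers of two, so that every jump at least
  doubles it. Each martingale inequality rests on a function \<Phi> with \<Phi>_{k+1} \<le> \<Phi>_k
  + <V_k, d_k>, where V_k is constant on the cubes of generation k and d_k is the increment: the
  linear term integrates to zero. V_k comes from the gradient, or a subgradient, of powers of norms,
  so only the real inner product enters and real and complex scalars are treated alike.\<close>

lemma powr_above_tangent:
  fixes s t p :: real
  assumes "1 \<le> p" "0 < s" "0 \<le> t"
  shows "s powr p + p * s powr (p - 1) * (t - s) \<le> t powr p"
\<comment> \<open>The point t = 0 lies outside the open half-line on which the power is
  differentiable; there the claim reduces to s^p \<le> p s^p.\<close>
proof (cases "t = 0")
  case True
  have "s powr (p - 1) * s = s powr p" using assms by (simp add: powr_diff)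
  then have "p * s powr (p - 1) * (t - s) = - (p * s powr p)" using True by simp
  moreover have "1 * s powr p \<le> p * s powr p" using assms by (intro mult_right_mono) auto
  moreover have "0 \<le> t powr p" by simp
  ultimately show ?thesis by linarith
next
  case False
  have "p * s powr (p - 1) * (t - s) \<le> t powr p - s powr p"
  proof (rule convex_on_imp_above_tangent[where A="{0<..}"])
    show "((\<lambda>x. x powr p) has_field_derivative p * s powr (p - 1)) (at s within {0<..})"
      by (rule has_field_derivative_at_within[OF has_real_derivative_powr]) (use assms in simp)
    show "convex_on {0<..} (\<lambda>x. x powr p)" by (rule powr_convex) (use assms in simp)
  qed (use assms False in \<open>auto simp: interior_open\<close>)
  then show ?thesis by simp
qed

text \<open>Concave counterpart: the convex tangent inequality for the exponent 1/a at the points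
  s^a and t^a, multiplied by s^(a-1).\<close>

lemma powr_below_tangent:
  fixes s t a :: real
  assumes "0 < a" "a \<le> 1" "0 < s" "0 \<le> t"
  shows "t powr a \<le> s powr a + a * s powr (a - 1) * (t - s)"
proof -
  have "(s powr a) powr (1/a) + (1/a) * (s powr a) powr (1/a - 1) * (t powr a - s powr a) \<le> (t powr a) powr (1/a)"
    by (rule powr_above_tangent) (use assms in auto)
  then have "s + (1/a) * s powr (1 - a) * (t powr a - s powr a) \<le> t"
    using assms by (simp add: powr_powr right_diff_distrib)
  then have "s powr (1 - a) * (t powr a - s powr a) \<le> a * (t - s)"
    using assms by (simp add: field_simps)
  then have "s powr (a - 1) * (s powr (1 - a) * (t powr a - s powr a)) \<le> s powr (a - 1) * (a * (t - s))"
    by (rule mult_left_mono) auto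
  moreover have "s powr (a - 1) * (s powr (1 - a) * x) = x" for x using assms by (simp flip: powr_add mult.assoc)
  ultimately have "t powr a - s powr a \<le> s powr (a - 1) * (a * (t - s))" by metis
  moreover have "P * (a * (t - s)) = a * P * (t - s)" for P :: real by simp
  ultimately show ?thesis by (metis diff_le_eq add.commute)
qed

lemma powr_superadd:
  fixes s t a :: real
  assumes "1 \<le> a" "0 \<le> s" "0 \<le> t"
  shows "s powr a + t powr a \<le> (s + t) powr a"
proof (cases "s = 0 \<or> t = 0")
  case False
  have e: "u powr a = u powr (a - 1) * u" if "u > 0" for u using that by (simp add: powr_diff)
  have "s powr (a-1) * s + t powr (a-1) * t \<le> (s+t) powr (a-1) * s + (s+t) powr (a-1) * t"
    using assms by (intro add_mono mult_right_mono powr_mono2) auto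
  then show ?thesis using False assms e[of s] e[of t] e[of "s + t"] by (simp add: distrib_left)
qed (use assms in auto)

text \<open>Superadditivity for the exponent 1/a applied to s^a and t^a.\<close>

lemma powr_subadd:
  fixes s t a :: real
  assumes "0 < a" "a \<le> 1" "0 \<le> s" "0 \<le> t"
  shows "(s + t) powr a \<le> s powr a + t powr a"
proof -
  have "(s powr a) powr (1/a) + (t powr a) powr (1/a) \<le> (s powr a + t powr a) powr (1/a)"
    by (rule powr_superadd) (use assms in auto)
  then have "s + t \<le> (s powr a + t powr a) powr (1/a)" using assms by (simp add: powr_powr)
  then have "(s + t) powr a \<le> ((s powr a + t powr a) powr (1/a)) powr a"
    by (rule powr_mono2[rotated 2]) (use assms in auto)
  then show ?thesis using assms by (simp add: powr_powr)
qed

text \<open>Plays the role of the triangle inequality for p-th power integrals later on; the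
  constant comes from s + t \<le> 2 max s t.\<close>

lemma powr_add_le:
  fixes s t p :: real
  assumes "0 < p" "0 \<le> s" "0 \<le> t"
  shows "(s + t) powr p \<le> 2 powr p * (s powr p + t powr p)"
proof -
  have "(s + t) powr p \<le> (2 * max s t) powr p" by (rule powr_mono2) (use assms in auto)
  also have "\<dots> = 2 powr p * max s t powr p" using assms by (simp add: powr_mult)
  also have "max s t powr p \<le> s powr p + t powr p" by (auto simp: max_def)
  finally show ?thesis by simp
qed

lemma powr_minus_2_mult: "0 \<le> y \<Longrightarrow> p \<noteq> 0 \<Longrightarrow> y powr (p - 2) * y^2 = y powr p" for y :: real
  by (cases "y = 0") (auto simp: powr_diff powr_numeral)

lemma powr_minus_1_mult: "0 \<le> y \<Longrightarrow> p \<noteq> 0 \<Longrightarrow> y powr (p - 1) * y = y powr p" for y :: real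
  by (cases "y = 0") (auto simp: powr_diff)

lemma powr_norm_eq: "norm x powr p = (norm x ^ 2) powr (p/2)"
  by (simp add: powr_powr flip: powr_numeral)

section \<open>Powers of norms in inner product spaces\<close>

text \<open>The vector p |a|^(p-2) a is the gradient of |.|^p at a. Cauchy-Schwarz gives |a| +
  <a,h>/|a| \<le> |a+h|, and the scalar tangent inequality does the rest; for a = 0 the left side is
  0.\<close>

lemma norm_powr_above_tangent:
  fixes a h :: "'a::real_inner"
  assumes "1 < p"
  shows "norm a powr p + p * norm a powr (p - 2) * inner a h \<le> norm (a + h) powr p"
proof (cases "a = 0")
  case False
  have e: "norm a powr (p - 1) / norm a = norm a powr (p - 2)"
    using False by (simp add: powr_diff powr_numeral power2_eq_square)
  have "norm a + inner a h / norm a \<le> norm (a + h)"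
    using norm_cauchy_schwarz[of a "a + h"] False
    by (simp add: field_simps inner_add_right power2_norm_eq_inner[symmetric] power2_eq_square[of "norm a"])
  then have "p * norm a powr (p - 1) * (inner a h / norm a) \<le> p * norm a powr (p - 1) * (norm (a + h) - norm a)"
    by (intro mult_left_mono) (use assms in auto)
  moreover have "norm a powr p + p * norm a powr (p - 1) * (norm (a + h) - norm a) \<le> norm (a + h) powr p"
    by (rule powr_above_tangent) (use assms False in auto)
  moreover have "p * norm a powr (p - 1) * (inner a h / norm a) = p * norm a powr (p - 2) * inner a h"
    unfolding e[symmetric] by simp
  ultimately show ?thesis by linarith
qed (use assms in auto)

text \<open>Clarkson's inequality: the parallelogram law combined with midpoint convexity of t^(p/2)
  at |2u|^2 and |2v|^2 and its superadditivity at |u+v|^2 and |u-v|^2.\<close>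

lemma norm_powr_clarkson:
  fixes u v :: "'a::real_inner"
  assumes "2 \<le> p"
  shows "2 * norm (u + v) powr p + 2 * norm (u - v) powr p \<le> norm (2 *\<^sub>R u) powr p + norm (2 *\<^sub>R v) powr p"
proof -
  let ?a = "p/2" let ?X = "(norm (u+v))^2" let ?Z = "(norm (u-v))^2"
  have eq: "(norm (2 *\<^sub>R u))\<^sup>2 + (norm (2 *\<^sub>R v))\<^sup>2 = 2 * (?X + ?Z)"
    by (simp add: power2_norm_eq_inner inner_simps inner_commute)
  have half: "2 * (?X + ?Z) / 2 = ?X + ?Z" by simp
  have mid: "2 * ((s + t)/2) powr ?a \<le> s powr ?a + t powr ?a" if "s \<ge> 0" "t \<ge> 0" for s t
  proof (cases "s + t = 0")
    case False
    then have pos: "(s+t)/2 > 0" using that by auto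
    have "((s + t)/2) powr ?a + ?a * ((s + t)/2) powr (?a - 1) * (s - (s+t)/2) \<le> s powr ?a"
         "((s + t)/2) powr ?a + ?a * ((s + t)/2) powr (?a - 1) * (t - (s+t)/2) \<le> t powr ?a"
      by (rule powr_above_tangent; use assms that pos in auto)+
    moreover have "?a * ((s + t)/2) powr (?a - 1) * (s - (s+t)/2) + ?a * ((s + t)/2) powr (?a - 1) * (t - (s+t)/2) = 0"
      by (simp flip: distrib_left) (simp add: field_simps)
    ultimately show ?thesis by linarith
  qed (use that in \<open>auto simp: add_nonneg_eq_0_iff\<close>)
  have "?X powr ?a + ?Z powr ?a \<le> (?X + ?Z) powr ?a"
    by (rule powr_superadd) (use assms in auto)
  moreover have "2 * (?X + ?Z) powr ?a \<le> ((norm (2 *\<^sub>R u))\<^sup>2) powr ?a + ((norm (2 *\<^sub>R v))\<^sup>2) powr ?a"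
    using mid[of "(norm (2 *\<^sub>R u))\<^sup>2" "(norm (2 *\<^sub>R v))\<^sup>2"] unfolding eq half by simp
  moreover have "A + B \<le> C \<Longrightarrow> 2 * C \<le> E \<Longrightarrow> 2 * A + 2 * B \<le> E" for A B C E :: real
    by linarith
  ultimately have "2 * (?X powr ?a) + 2 * (?Z powr ?a) \<le> ((norm (2 *\<^sub>R u))\<^sup>2) powr ?a + ((norm (2 *\<^sub>R v))\<^sup>2) powr ?a"
    by blast
  then show ?thesis by (simp only: powr_norm_eq[symmetric])
qed

text \<open>Uniform convexity: Clarkson with u = (a+h)/2 and v = a/2 compares |a+h|^p with the
  midpoint a + h/2, where the tangent inequality applies. The factor 2^(1-p) is 2 (1/2)^p.\<close>

lemma norm_powr_above_tangent_ge_2: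
  fixes a h :: "'a::real_inner"
  assumes "2 \<le> p"
  shows "norm a powr p + p * norm a powr (p - 2) * inner a h + 2 powr (1-p) * norm h powr p \<le> norm (a + h) powr p"
proof -
  let ?h = "(1/2) *\<^sub>R h"
  have "(1/2) *\<^sub>R (a + h) + (1/2) *\<^sub>R a = a + ?h" "(1/2) *\<^sub>R (a + h) - (1/2) *\<^sub>R a = ?h"
    by (simp_all add: scaleR_add_right) (metis add.commute add.left_commute scaleR_half_double scaleR_add_right)
  then have "2 * norm (a + ?h) powr p + 2 * norm (?h) powr p \<le> norm (a + h) powr p + norm a powr p"
    using norm_powr_clarkson[OF assms, of "(1/2) *\<^sub>R (a + h)" "(1/2) *\<^sub>R a"] by simp
  moreover have "norm a powr p + p * norm a powr (p - 2) * inner a ?h \<le> norm (a + ?h) powr p"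
    by (rule norm_powr_above_tangent) (use assms in auto)
  moreover have "2 * norm ?h powr p = 2 powr (1-p) * norm h powr p"
    by (simp add: powr_divide powr_diff)
  ultimately show ?thesis by simp
qed
text \<open>On (0, s+t] the second derivative p(p-1) x^(p-2) is at least (p-1) (s+t)^(p-2), because
  p - 2 \<le> 0. Hence x^p - c x^2, with 2c equal to this lower bound, is convex there, and its
  tangent inequality carries the quadratic gain.\<close>

lemma powr_strongly_above_tangent:
  fixes s t p :: real
  assumes p: "1 < p" "p \<le> 2" and "0 < s" "0 \<le> t"
  shows "s powr p + p * s powr (p - 1) * (t - s) + (p - 1)/2 * (s + t) powr (p - 2) * (t - s)^2 \<le> t powr p"
proof -
  define M where "M = s + t"
  have M: "0 < M" "s \<le> M" "t \<le> M" using assms by (auto simp: M_def)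
  define c where "c = (p - 1)/2 * M powr (p - 2)"
  have c: "0 \<le> c" using p by (auto simp: c_def)
  show ?thesis
  proof (cases "t = 0")
    case True
    have "(p - 1)/2 * s powr p \<le> (p - 1) * s powr p" using p by (intro mult_right_mono) auto
    moreover have "s powr (p - 1) * s = s powr p" "s powr (p - 2) * s^2 = s powr p"
      using assms by (auto simp: powr_diff powr_numeral)
    ultimately show ?thesis using True by (simp add: algebra_simps)
  next
    case False
    define f f' f'' where "f = (\<lambda>x. x powr p - c * x^2)"
      and "f' = (\<lambda>x. p * x powr (p - 1) - 2 * c * x)"
      and "f'' = (\<lambda>x. p * ((p - 1) * x powr (p - 2)) - 2 * c)"
    have d1: "(f has_field_derivative f' x) (at x)" if "x > 0" for x
      unfolding f_def f'_def using that by (auto intro!: derivative_eq_intros)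
    have "convex_on {0<..M} f"
    proof (rule f''_ge0_imp_convex[where f'=f' and f''=f''])
      fix x assume x: "x \<in> {0<..M}"
      show "(f has_field_derivative f' x) (at x)" using d1 x by simp
      show "(f' has_field_derivative f'' x) (at x)"
        unfolding f'_def f''_def using x by (auto intro!: derivative_eq_intros)
      have "M powr (p - 2) \<le> x powr (p - 2)" using x p by (intro powr_mono2') auto
      then have "(p - 1) * M powr (p - 2) \<le> (p - 1) * x powr (p - 2)" using p by (intro mult_left_mono) auto
      moreover have "1 * ((p - 1) * x powr (p - 2)) \<le> p * ((p - 1) * x powr (p - 2))"
        using p by (intro mult_right_mono) auto
      ultimately show "0 \<le> f'' x" by (simp add: f''_def c_def)
    qed auto
    then have "convex_on {0<..<M} f" by (rule convex_on_subset) auto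
    moreover have "s < M" "t < M" "0 < t" using assms False by (auto simp: M_def)
    ultimately have "f' s * (t - s) \<le> f t - f s"
      by (intro convex_on_imp_above_tangent[where A="{0<..<M}"])
         (use assms d1 in \<open>auto simp: interior_open intro: has_field_derivative_at_within\<close>)
    then have "s powr p + p * s powr (p - 1) * (t - s) + c * (t - s)^2 \<le> t powr p"
      by (simp add: f_def f'_def algebra_simps power2_eq_square)
    then show ?thesis by (simp add: c_def M_def)
  qed
qed

text \<open>The gain has a radial and an angular part: with s = |a|, t = |a+h| and the
  Cauchy-Schwarz defect e = s t - <a, a+h>, one has |h|^2 = (t-s)^2 + 2e. The radial part comes from
  the scalar inequality, the angular part from s(t-s) = <a,h> + e.\<close>

lemma norm_powr_above_tangent_le_2:
  fixes a h :: "'a::real_inner"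
  assumes p: "1 < p" "p \<le> 2"
  shows "norm a powr p + p * norm a powr (p - 2) * inner a h
      + (p - 1)/8 * (norm a ^2 + norm h ^2) powr (p/2 - 1) * norm h ^2 \<le> norm (a + h) powr p"
proof (cases "a = 0")
  case True
  show ?thesis
  proof (cases "h = 0")
    case False
    have "(norm h ^2) powr (p/2 - 1) * norm h ^2 = norm h powr p"
      using False by (simp add: powr_diff powr_norm_eq)
    moreover have "(p - 1)/8 * norm h powr p \<le> 1 * norm h powr p" using p by (intro mult_right_mono) auto
    ultimately show ?thesis using True by (simp add: mult.assoc)
  qed (use True in auto)
next
  case False
  define s t where "s = norm a" and "t = norm (a + h)"
  have st: "0 < s" "0 \<le> t" using False by (auto simp: s_def t_def)
  define w where "w = (s^2 + norm h ^2) powr (p/2 - 1)"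
  define e where "e = s * t - inner a (a + h)"
  have e: "0 \<le> e" using norm_cauchy_schwarz[of a "a + h"] by (simp add: e_def s_def t_def)
  have h: "norm h ^2 = (t - s)^2 + 2 * e"
    by (simp add: e_def t_def s_def power2_diff power2_norm_eq_inner inner_simps inner_commute)
  have s2: "s powr (p - 2) = (s^2) powr (p/2 - 1)"
    using st powr_norm_eq[of s "p - 2"] by (simp add: diff_divide_distrib)
  have "w \<le> (s^2) powr (p/2 - 1)"
    unfolding w_def using p st by (intro powr_mono2') auto
  then have w1: "w \<le> s powr (p - 2)" by (simp add: s2)
  have "t \<le> s + norm h" by (simp add: s_def t_def norm_triangle_ineq)
  then have "(s + t)^2 \<le> (2 * s + norm h)^2" by (intro power_mono) (use st in auto)
  also have "\<dots> \<le> 8 * (s^2 + norm h ^2)"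
    using zero_le_power2[of "2 * s - norm h"] zero_le_power2[of "norm h"]
    unfolding power2_diff power2_sum power_mult_distrib distrib_left
    by simp (use zero_le_power2[of "norm h"] in linarith)
  finally have *: "(s+t)^2 \<le> 8 * (s^2 + norm h ^2)" .
  \<comment> \<open>The bound (s+t)^2 \<le> 8 (s^2 + |h|^2) turns the weight (s+t)^(p-2) into w at
    the cost of 8^(p/2-1) \<ge> 8^(-1/2) \<ge> 1/4; this is how (p-1)/2 becomes (p-1)/8.\<close>
  have "(1/4) * w \<le> 8 powr (p/2 - 1) * w"
  proof (rule mult_right_mono)
    have "(8::real) powr (-(1/2)) \<le> 8 powr (p/2 - 1)" using p by (intro powr_mono) auto
    moreover have "sqrt 8 \<le> (4::real)" by (rule real_le_lsqrt) auto
    then have "1/4 \<le> (8::real) powr (-(1/2))" by (simp add: powr_minus powr_half_sqrt field_simps)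
    ultimately show "1/4 \<le> (8::real) powr (p/2 - 1)" by linarith
  qed (simp add: w_def)
  also have "\<dots> = (8 * (s^2 + norm h ^2)) powr (p/2 - 1)" unfolding w_def by (rule powr_mult[symmetric])
  also have "\<dots> \<le> ((s+t)^2) powr (p/2 - 1)" using * p st by (intro powr_mono2') auto
  also have "\<dots> = (s + t) powr (p - 2)" using powr_norm_eq[of "s+t" "p - 2"] st by (simp add: diff_divide_distrib)
  finally have w2: "w / 4 \<le> (s + t) powr (p - 2)" by simp
  have A: "s powr p + p * s powr (p - 1) * (t - s) + (p - 1)/2 * (s + t) powr (p - 2) * (t - s)^2 \<le> t powr p"
    by (rule powr_strongly_above_tangent) (use p st in auto)
  have B: "(p - 1)/8 * w * (t-s)^2 \<le> (p - 1)/2 * (s + t) powr (p - 2) * (t - s)^2"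
  proof (rule mult_right_mono)
    have "(p - 1)/2 * (w/4) \<le> (p - 1)/2 * (s + t) powr (p - 2)" using w2 p by (intro mult_left_mono) auto
    then show "(p - 1)/8 * w \<le> (p - 1)/2 * (s + t) powr (p - 2)" by simp
  qed simp
  have "s powr (p - 1) = s powr (p - 2) * s" using st by (simp add: powr_diff powr_numeral power2_eq_square)
  then have C: "p * s powr (p - 1) * (t - s) = p * s powr (p - 2) * inner a h + p * s powr (p - 2) * e"
    by (simp add: e_def inner_add_right s_def algebra_simps power2_norm_eq_inner[symmetric] power2_eq_square)
  have "(p - 1)/8 * w * (2 * e) \<le> p * s powr (p - 2) * e"
  proof -
    have "(p - 1)/4 * w \<le> p * s powr (p - 2)" using w1 p by (intro mult_mono) (auto simp: w_def)
    then have "(p - 1)/4 * w * e \<le> p * s powr (p - 2) * e" using e by (rule mult_right_mono)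
    moreover have "(p - 1)/8 * w * (2 * e) = (p - 1)/4 * w * e" by simp
    ultimately show ?thesis by (simp only:)
  qed
  then have "s powr p + p * s powr (p - 2) * inner a h + (p - 1)/8 * w * ((t - s)^2 + 2 * e) \<le> t powr p"
    using A B C unfolding distrib_left by linarith
  then show ?thesis unfolding h[symmetric] unfolding w_def s_def t_def .
qed

text \<open>Controls the growth of (s + |x|^2)^a in a martingale step: with R = s + |x|^2 the new
  value under the power is R + 2<x,h> + 2|h|^2. If |h|^2 \<le> R, concavity gives the first-order
  term and R is comparable to R + |h|^2; otherwise every term is dominated by |h|^(2a). The constant
  20 covers both cases.\<close>

lemma square_sum_powr_le:
  fixes x h :: "'a::real_inner"
  assumes a: "1/2 < a" "a \<le> 1" and R: "norm x ^2 \<le> R"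
  shows "(R + 2 * inner x h + 2 * norm h ^2) powr a
       \<le> R powr a + 2 * a * R powr (a - 1) * inner x h + 20 * (norm h ^2 * (R + norm h ^2) powr (a - 1))"
proof -
  let ?H = "norm h ^2"
  have R0: "0 \<le> R" using R by (meson order_trans zero_le_power2)
  have cs: "\<bar>inner x h\<bar> \<le> sqrt R * norm h"
  proof -
    have "norm x \<le> sqrt R" using R by (simp add: real_le_rsqrt)
    then have "norm x * norm h \<le> sqrt R * norm h" by (intro mult_right_mono) auto
    with Cauchy_Schwarz_ineq2[of x h] show ?thesis by linarith
  qed
  have pos: "0 \<le> R + 2 * inner x h + 2 * ?H"
  proof -
    have "0 \<le> (norm (x + h))^2 + ?H" by simp
    also have "\<dots> = norm x ^2 + 2 * inner x h + 2 * ?H"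
      by (simp add: power2_norm_eq_inner inner_simps inner_commute)
    finally show ?thesis using R by simp
  qed
  have half: "1/2 \<le> (2::real) powr (a - 1)"
    using powr_mono[of "-1" "a - 1" "2::real"] a by (simp add: powr_minus)
  show ?thesis
  proof (cases "?H \<le> R")
    case True
    show ?thesis
    proof (cases "R = 0")
      case False
      then have Rp: "0 < R" using R0 by simp
      have "(R + 2 * inner x h + 2 * ?H) powr a \<le> R powr a + a * R powr (a - 1) * ((R + 2 * inner x h + 2 * ?H) - R)"
        by (rule powr_below_tangent) (use a Rp pos in auto)
      moreover have lin: "a * P * ((R + 2 * inner x h + 2 * ?H) - R) = 2 * a * P * inner x h + 2 * a * P * ?H" for P
        by (simp add: distrib_left)
      moreover have "(1/2) * R powr (a - 1) \<le> 2 powr (a - 1) * R powr (a - 1)"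
        using half by (intro mult_right_mono) auto
      then have "(1/2) * R powr (a - 1) \<le> (2 * R) powr (a - 1)" using Rp by (simp add: powr_mult)
      moreover have "(2 * R) powr (a - 1) \<le> (R + ?H) powr (a - 1)"
        using True Rp a by (intro powr_mono2') (auto simp: add_pos_nonneg)
      ultimately have 1: "(R + 2 * inner x h + 2 * ?H) powr a \<le> R powr a + 2 * a * R powr (a - 1) * inner x h + 2 * a * R powr (a-1) * ?H"
        and 2: "R powr (a - 1) \<le> 2 * (R + ?H) powr (a - 1)"
        using lin[of "R powr (a - 1)"] by linarith+
      have "2 * a * R powr (a-1) * ?H \<le> 2 * 1 * (2 * (R + ?H) powr (a - 1)) * ?H"
        using a 2 by (intro mult_right_mono mult_mono) auto
      also have "\<dots> \<le> 20 * (?H * (R + ?H) powr (a - 1))" by (simp add: mult.commute)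
      finally show ?thesis using 1 by linarith
    qed (use True in \<open>auto\<close>)
  next
    case False
    then have h0: "0 < ?H" using R0 by linarith
    have Rh: "sqrt R \<le> norm h" using False by (simp add: real_le_lsqrt)
    have "(1/2) * ?H powr a \<le> 2 powr (a - 1) * ?H powr a" using half by (intro mult_right_mono) auto
    also have "\<dots> = ?H * (2 * ?H) powr (a - 1)" using h0 by (simp add: powr_mult powr_diff)
    also have "\<dots> \<le> ?H * (R + ?H) powr (a - 1)"
      using False h0 R0 a by (intro mult_left_mono powr_mono2') auto
    finally have low: "?H powr a \<le> 2 * (?H * (R + ?H) powr (a - 1))" by simp
    have "inner x h \<le> ?H"
      using cs mult_right_mono[OF Rh norm_ge_zero[of h]] by (simp add: power2_eq_square)
    then have "(R + 2 * inner x h + 2 * ?H) powr a \<le> (5 * ?H) powr a"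
      using False pos a by (intro powr_mono2) auto
    also have "\<dots> = 5 powr a * ?H powr a" by (simp add: powr_mult)
    also have "\<dots> \<le> 5 powr 1 * ?H powr a" using a by (intro mult_right_mono powr_mono) auto
    finally have up: "(R + 2 * inner x h + 2 * ?H) powr a \<le> 5 * ?H powr a" by simp
    have "- (2 * a * R powr (a - 1) * inner x h) \<le> 2 * ?H powr a"
    proof (cases "R = 0")
      case False
      then have Rp: "0 < R" using R0 by simp
      have "R powr (a - 1) * \<bar>inner x h\<bar> \<le> R powr (a - 1) * (sqrt R * norm h)"
        using cs by (intro mult_left_mono) auto
      also have "\<dots> = R powr (a - 1/2) * norm h"
        using Rp by (simp add: powr_half_sqrt[symmetric] powr_add[symmetric] mult.assoc[symmetric])
      also have "\<dots> \<le> ?H powr (a - 1/2) * norm h"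
        using \<open>\<not> ?H \<le> R\<close> a R0 by (intro mult_right_mono powr_mono2) auto
      also have "\<dots> = ?H powr (a - 1/2) * ?H powr (1/2)" by (simp add: powr_half_sqrt)
      also have "\<dots> = ?H powr a" by (simp only: powr_add[symmetric]) simp
      finally have "R powr (a - 1) * \<bar>inner x h\<bar> \<le> ?H powr a" .
      then have "(2 * a) * (R powr (a - 1) * \<bar>inner x h\<bar>) \<le> 2 * ?H powr a"
        using a by (intro mult_mono) (auto intro: mult_nonneg_nonneg)
      moreover have "- (2 * a * R powr (a - 1) * inner x h) \<le> (2 * a) * (R powr (a - 1) * \<bar>inner x h\<bar>)"
      proof -
        have "0 \<le> 2 * a * R powr (a - 1)" using a by (intro mult_nonneg_nonneg) simp_all
        from mult_left_mono[OF abs_ge_minus_self[of "inner x h"] this]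
        have "- (2 * a * R powr (a - 1) * inner x h) \<le> 2 * a * R powr (a - 1) * \<bar>inner x h\<bar>"
          by (simp only: mult_minus_right)
        then show ?thesis by (simp only: mult.assoc)
      qed
      ultimately show ?thesis by linarith
    qed auto
    moreover have "0 \<le> R powr a" "0 \<le> ?H powr a" by simp_all
    ultimately show ?thesis using up low by linarith
  qed
qed

text \<open>The tangent at 1 + v, evaluated at 1, gives (1+v)^p \<le> 1 + p v (1+v)^(p-1), and
  t^(p-1) is Lipschitz on [1/4, 9/4]. This interval contains |a+h|^2/|a|^2 whenever 2|h| <
  |a|.\<close>

lemma powr_second_order_bound:
  fixes p :: real
  assumes "1 < p"
  obtains C where "0 < C" "\<And>v. -(3/4) \<le> v \<Longrightarrow> v \<le> 5/4 \<Longrightarrow> (1 + v) powr p \<le> 1 + p * v + C * v^2"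
proof
  define K where "K = (p - 1) * (4 powr \<bar>p - 2\<bar>)"
  have K: "0 < K" using assms by (simp add: K_def)
  show "0 < p * K" using K assms by simp
  fix v :: real assume v: "-(3/4) \<le> v" "v \<le> 5/4"
  have quarter: "u powr (p - 2) \<le> 4 powr \<bar>p - 2\<bar>" if "1/4 \<le> u" "u \<le> 9/4" for u :: real
  proof (cases "0 \<le> p - 2")
    case True
    have "u powr (p - 2) \<le> 4 powr (p - 2)" using that True by (intro powr_mono2) auto
    then show ?thesis using True by simp
  next
    case False
    have "u powr (p - 2) \<le> (1/4) powr (p - 2)" using that False by (intro powr_mono2') auto
    also have "(1/4::real) powr (p - 2) = 4 powr (- (p - 2))" by (simp add: powr_divide powr_minus_divide del: minus_diff_eq)
    also have "- (p - 2) = \<bar>p - 2\<bar>" using False by linarith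
    finally show ?thesis .
  qed
  have d: "((\<lambda>u. u powr (p - 1)) has_real_derivative (p - 1) * u powr (p - 1 - 1)) (at u)" if "0 < u" for u
    by (rule has_real_derivative_powr[OF that])
  have "\<bar>(1 + v) powr (p - 1) - 1 powr (p - 1)\<bar> \<le> K * \<bar>v\<bar>"
  proof -
    have "norm ((1 + v) powr (p - 1) - 1 powr (p - 1)) \<le> K * norm ((1 + v) - 1)"
    proof (rule field_differentiable_bound[of "{1/4..9/4}"])
      fix u :: real assume u: "u \<in> {1/4..9/4}"
      show "((\<lambda>u. u powr (p - 1)) has_field_derivative (p - 1) * u powr (p - 2)) (at u within {1/4..9/4})"
        using d[of u] u by (auto intro: has_field_derivative_at_within)
      show "norm ((p - 1) * u powr (p - 2)) \<le> K"
        using quarter[of u] u assms by (auto simp: K_def abs_mult intro!: mult_left_mono)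
    qed (use v in auto)
    then show ?thesis by simp
  qed
  then have K1: "\<bar>(1 + v) powr (p - 1) - 1\<bar> \<le> K * \<bar>v\<bar>" by simp
  have "(1 + v) powr p + p * (1 + v) powr (p - 1) * (1 - (1 + v)) \<le> 1 powr p"
    by (rule powr_above_tangent) (use v assms in auto)
  moreover have eq: "p * X * (1 - (1 + v)) = - (p * v + p * (v * (X - 1)))" for X :: real by (simp add: algebra_simps)
  ultimately have "(1 + v) powr p + - (p * v + p * (v * ((1 + v) powr (p - 1) - 1))) \<le> 1"
    by (simp only: eq powr_one_eq_one)
  then have "(1 + v) powr p \<le> 1 + p * v + p * (v * ((1 + v) powr (p - 1) - 1))" by linarith
  moreover have "v * ((1 + v) powr (p - 1) - 1) \<le> K * v^2"
  proof -
    have "v * ((1 + v) powr (p - 1) - 1) \<le> \<bar>v\<bar> * \<bar>(1 + v) powr (p - 1) - 1\<bar>"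
      by (metis abs_ge_self abs_mult)
    also have "\<dots> \<le> \<bar>v\<bar> * (K * \<bar>v\<bar>)" using K1 by (intro mult_left_mono) auto
    also have "\<dots> = K * v^2" by (simp add: power2_eq_square mult.left_commute)
    finally show ?thesis .
  qed
  then have "p * (v * ((1 + v) powr (p - 1) - 1)) \<le> p * (K * v^2)"
    using assms by (intro mult_left_mono) auto
  ultimately show "(1 + v) powr p \<le> 1 + p * v + p * K * v^2" by (simp only: mult.assoc)
qed

text \<open>For 2|h| < |a| this is the second-order expansion of |a+h|^2 = |a|^2 (1+v) to the power
  p/2; for larger h every term is bounded by a multiple of |h|^p. Hence the two remainders.\<close>

lemma norm_powr_upper_bound:
  fixes p :: real
  assumes p: "2 < p"
  obtains C where "0 < C"
    "\<And>a h :: 'a::real_inner. norm (a + h) powr p \<le> norm a powr p + p * norm a powr (p - 2) * inner a h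
        + C * (norm a powr (p - 2) * norm h ^2 + norm h powr p)"
proof -
  obtain C where C: "0 < C" "\<And>v. -(3/4) \<le> v \<Longrightarrow> v \<le> 5/4 \<Longrightarrow> (1 + v) powr (p/2) \<le> 1 + p/2 * v + C * v^2"
    using powr_second_order_bound[of "p/2"] p by auto
  define K where "K = p + 9 * C + 3 powr p + p * 2 powr (p - 1)"
  have K0: "0 < K" using C p by (auto simp: K_def add_nonneg_pos intro!: add_pos_nonneg)
  have main: "norm (a + h) powr p \<le> norm a powr p + p * norm a powr (p - 2) * inner a h
        + K * (norm a powr (p - 2) * norm h ^2 + norm h powr p)" for a h :: 'a
  proof (cases "2 * norm h < norm a")
    case True
    define s t where "s = norm a" and "t = norm h / norm a"
    have s: "0 < s" using True by (auto simp: s_def)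
    have t: "0 \<le> t" "t < 1/2" using True s by (auto simp: t_def s_def divide_simps)
    define v where "v = (2 * inner a h + norm h ^2) / s^2"
    have h: "norm h = s * t" using s by (simp add: t_def s_def)
    have "\<bar>inner a h\<bar> \<le> s * (s * t)" using Cauchy_Schwarz_ineq2[of a h] by (simp add: s_def[symmetric] h)
    then have iv: "\<bar>inner a h / s^2\<bar> \<le> t" using s by (simp add: power2_eq_square field_simps abs_mult)
    have v_eq: "v = 2 * (inner a h / s^2) + t^2" using s by (simp add: v_def h add_divide_distrib power_mult_distrib)
    have t2: "t^2 \<le> t / 2" using t mult_left_mono[of t "1/2" t] by (simp add: power2_eq_square)
    have v: "\<bar>v\<bar> \<le> 5/2 * t" using iv t2 zero_le_power2[of t] unfolding v_eq by linarith
    have "(1/2)^2 \<le> (1 - t)^2" using t by (intro power_mono) auto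
    then have "1/4 \<le> 1 - 2 * t + t^2" by (simp add: power2_diff power_divide)
    then have v1: "-(3/4) \<le> v" using iv unfolding v_eq by linarith
    have v2: "v \<le> 5/4" using v t by linarith
    have "v^2 \<le> (5/2 * t)^2" using v by (metis abs_ge_zero power2_abs power_mono)
    also have "\<dots> \<le> 9 * t^2" by (simp add: power_mult_distrib power2_eq_square)
    finally have vv: "v^2 \<le> 9 * t^2" .
    have "s^2 * (1 + v) = s^2 + 2 * inner a h + norm h ^2" using s unfolding v_def distrib_left[of "s^2" 1] by simp
    also have "\<dots> = (norm (a + h))^2" by (simp add: s_def power2_norm_eq_inner inner_simps inner_commute)
    finally have sv: "s^2 * (1 + v) = (norm (a + h))^2" .
    have "norm (a + h) powr p = (s^2 * (1 + v)) powr (p/2)" unfolding sv by (rule powr_norm_eq)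
    also have "\<dots> = (s^2) powr (p/2) * (1 + v) powr (p/2)" by (rule powr_mult)
    also have "(s^2) powr (p/2) = s powr p" unfolding s_def by (rule powr_norm_eq[symmetric])
    finally have "norm (a + h) powr p = s powr p * (1 + v) powr (p/2)" .
    also have "s powr p * (1 + v) powr (p/2) \<le> s powr p * (1 + p/2 * v + C * v^2)"
      using C(2)[OF v1 v2] by (intro mult_left_mono) auto
    also have "\<dots> \<le> s powr p * (1 + p/2 * v + C * (9 * t^2))"
      using C(1) vv by (intro mult_left_mono add_left_mono) auto
    also have "\<dots> = s powr p * (1 + p * (inner a h / s^2) + (p/2 + 9 * C) * t^2)"
      unfolding v_eq by (simp add: algebra_simps)
    also have "\<dots> = (s powr (p - 2) * s^2) * (1 + p * (inner a h / s^2) + (p/2 + 9 * C) * t^2)"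
      using powr_minus_2_mult[of s p] s p by simp
    also have "\<dots> = s powr (p - 2) * s^2 + p * s powr (p - 2) * inner a h + (p/2 + 9 * C) * (s powr (p - 2) * (s * t)^2)"
    proof -
      have "(P * s^2) * (1 + p * (i / s^2) + k * t^2) = P * s^2 + p * P * i + k * (P * (s * t)^2)" for P i k :: real
        using s by (simp add: field_simps)
      then show ?thesis .
    qed
    also have "s powr (p - 2) * s^2 = s powr p" using s p by (intro powr_minus_2_mult) auto
    finally have "norm (a + h) powr p \<le> s powr p + p * s powr (p - 2) * inner a h + (p/2 + 9 * C) * (s powr (p - 2) * norm h ^2)"
      by (simp add: h)
    moreover have "(p/2 + 9 * C) * (s powr (p - 2) * norm h ^2) \<le> K * (s powr (p - 2) * norm h ^2 + norm h powr p)"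
      using C p by (intro mult_mono) (auto simp: K_def)
    ultimately show ?thesis by (simp add: s_def)
  next
    case False
    have "norm (a + h) \<le> 3 * norm h" using False norm_triangle_ineq[of a h] by linarith
    then have "norm (a + h) powr p \<le> (3 * norm h) powr p" using p by (intro powr_mono2) auto
    then have 1: "norm (a + h) powr p \<le> 3 powr p * norm h powr p" by (simp add: powr_mult)
    have 2: "- (p * norm a powr (p - 2) * inner a h) \<le> p * 2 powr (p - 1) * norm h powr p"
    proof (cases "a = 0")
      case False
      have "norm a powr (p - 2) * (- inner a h) \<le> norm a powr (p - 2) * (norm a * norm h)"
        using Cauchy_Schwarz_ineq2[of a h] by (intro mult_left_mono) auto
      also have "\<dots> = norm a powr (p - 1) * norm h"
      proof -
        have "norm a powr (p - 2) * norm a = norm a powr (p - 1)"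
          using False p powr_minus_1_mult[of "norm a" "p - 1"] by simp
        then show ?thesis by (simp flip: mult.assoc)
      qed
      also have "\<dots> \<le> (2 * norm h) powr (p - 1) * norm h"
        using \<open>\<not> 2 * norm h < norm a\<close> p by (intro mult_right_mono powr_mono2) auto
      also have "\<dots> = 2 powr (p - 1) * norm h powr p"
        using p powr_minus_1_mult[of "norm h" p] by (simp add: powr_mult)
      finally have "p * (norm a powr (p - 2) * (- inner a h)) \<le> p * (2 powr (p - 1) * norm h powr p)"
        using p by (intro mult_left_mono) auto
      then show ?thesis by simp
    qed (use p in auto)
    have "(3 powr p + p * 2 powr (p - 1)) * norm h powr p \<le> K * (norm a powr (p - 2) * norm h ^2 + norm h powr p)"
      using C p by (intro mult_mono) (auto simp: K_def)
    then have 3: "3 powr p * norm h powr p + p * 2 powr (p - 1) * norm h powr p \<le> K * (norm a powr (p - 2) * norm h ^2 + norm h powr p)"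
      by (simp add: distrib_right)
    have "0 \<le> norm a powr p" by simp
    with 1 2 3 show ?thesis by linarith
  qed
  show ?thesis by (rule that[OF K0 main])
qed

section \<open>Functions of a norm and its running maximum; Young-type inequalities\<close>

text \<open>As a function of m the expression has derivative p(p-1) m^(p-2) (m - t), so raising m to
  t cannot increase it. For fixed m it is linear in t with nonpositive slope, which yields a
  supermartingale when t is the norm of a martingale.\<close>

lemma doob_step:
  fixes p t m :: real
  assumes "1 < p" "0 \<le> t" "0 \<le> m"
  shows "(p - 1) * max m t powr p - p * t * max m t powr (p - 1) \<le> (p - 1) * m powr p - p * t * m powr (p - 1)"
proof (cases "t \<le> m")
  case False
  then have tt: "t * t powr (p - 1) = t powr p" using assms by (simp add: powr_diff)
  show ?thesis
  proof (cases "m = 0")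
    case False
    then have mm: "m powr (p - 1) * m = m powr p" using assms by (simp add: powr_diff)
    have "m powr p + p * m powr (p - 1) * (t - m) \<le> t powr p"
      by (rule powr_above_tangent) (use assms False in auto)
    moreover have "p * M * (t - m) = p * t * M - p * (M * m)" for M :: real by (simp add: algebra_simps)
    ultimately have "m powr p + p * t * m powr (p - 1) - p * m powr p \<le> t powr p" by (simp add: mm)
    moreover have "p * t * t powr (p - 1) = p * t powr p" by (simp only: mult.assoc tt)
    moreover have "(p - 1) * t powr p = p * t powr p - t powr p" "(p - 1) * m powr p = p * m powr p - m powr p"
      by (simp_all add: left_diff_distrib)
    moreover have "max m t = t" using \<open>\<not> t \<le> m\<close> by simp
    ultimately show ?thesis unfolding \<open>max m t = t\<close> by linarith
  next
    case True
    moreover have "p * t * t powr (p - 1) = p * t powr p" by (simp only: mult.assoc tt)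
    moreover have "(p - 1) * t powr p - p * t powr p \<le> 0" by (simp add: left_diff_distrib)
    moreover have "max m t = t" using \<open>\<not> t \<le> m\<close> by simp
    ultimately show ?thesis using assms by (simp only: powr_0 mult_zero_right)
  qed
next
  case True
  then show ?thesis by (simp only: max_absorb1)
qed

text \<open>The product t m^(p-1) is absorbed by the tangent inequality at m evaluated at 2t; the
  factor 2 leaves half of (p-1) m^p.\<close>

lemma doob_young:
  fixes p t m :: real
  assumes "1 < p" "0 \<le> t" "0 \<le> m"
  shows "(p - 1)/2 * m powr p - 2 powr (p - 1) * t powr p \<le> (p - 1) * m powr p - p * t * m powr (p - 1)"
proof (cases "m = 0")
  case False
  then have mm: "m powr (p - 1) * m = m powr p" using assms by (simp add: powr_diff)
  have "m powr p + p * m powr (p - 1) * (2 * t - m) \<le> (2 * t) powr p"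
    by (rule powr_above_tangent) (use assms False in auto)
  moreover have "p * M * (2 * t - m) = 2 * (p * t * M) - p * (M * m)" for M :: real by (simp add: algebra_simps)
  moreover have "(2 * t) powr p = 2 * (2 powr (p - 1) * t powr p)" using assms by (simp add: powr_mult powr_diff)
  ultimately have "m powr p + 2 * (p * t * m powr (p - 1)) - p * m powr p \<le> 2 * (2 powr (p - 1) * t powr p)" by (simp add: mm)
  moreover have "(p - 1)/2 * m powr p = (p * m powr p - m powr p)/2" "(p - 1) * m powr p = p * m powr p - m powr p"
    by (auto simp: left_diff_distrib)
  ultimately show ?thesis by linarith
qed (use assms in auto)

text \<open>Young's inequality prepared for absorption of y; the threshold m^2 = e y^2 decides which
  term dominates.\<close>

lemma powr_mult_square_le:
  fixes p e y m :: real
  assumes "2 < p" "0 < e" "0 \<le> y" "0 \<le> m"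
  shows "y powr (p - 2) * m^2 \<le> e * y powr p + (1/e) powr ((p - 2)/2) * m powr p"
proof (cases "m^2 \<le> e * y^2")
  case True
  have "y powr (p - 2) * m^2 \<le> y powr (p - 2) * (e * y^2)" using True by (intro mult_left_mono) auto
  also have "\<dots> = e * y powr p" using powr_minus_2_mult[of y p] assms by (simp only: mult.left_commute)
  finally show ?thesis by (simp add: add_increasing2)
next
  case False
  then have m: "0 < m" using assms by (cases "m = 0") (auto simp: mult_nonneg_nonneg)
  have "y^2 \<le> m^2 * (1/e)" using False assms by (simp add: field_simps)
  then have "(y^2) powr ((p - 2)/2) \<le> (m^2 * (1/e)) powr ((p - 2)/2)" using assms by (intro powr_mono2) auto
  then have "y powr (p - 2) \<le> m powr (p - 2) * (1/e) powr ((p - 2)/2)"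
    using powr_norm_eq[of y "p - 2"] powr_norm_eq[of m "p - 2"] assms m by (simp add: powr_mult powr_divide)
  then have "y powr (p - 2) * m^2 \<le> m powr (p - 2) * (1/e) powr ((p - 2)/2) * m^2" by (intro mult_right_mono) auto
  also have "\<dots> = (1/e) powr ((p - 2)/2) * (m powr (p - 2) * m^2)" by simp
  also have "m powr (p - 2) * m^2 = m powr p" using m assms by (intro powr_minus_2_mult) auto
  finally show ?thesis using assms by (simp add: add_increasing)
qed

subsection \<open>Dyadic cubes and the dyadic filtration\<close>

text \<open>Two points whose coordinates differ by l' cannot both lie in a half-open cube of side
  l'; the shift \<open>max 0 l'\<close> also covers negative l'. Index types are nonempty, so
  \<open>undefined\<close> is a coordinate.\<close>

lemma half_open_cube_side_le:
  fixes a a' :: "real ^ 'd"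
  assumes "half_open_cube a l \<subseteq> half_open_cube a' l'" "0 < l"
  shows "l \<le> l'"
proof (rule ccontr)
  assume "\<not> l \<le> l'"
  define y where "y = a + (\<chi> i. max 0 l')"
  have "a \<in> half_open_cube a l" "y \<in> half_open_cube a l"
    using assms \<open>\<not> l \<le> l'\<close> by (auto simp: half_open_cube_def y_def)
  then have "a \<in> half_open_cube a' l'" "y \<in> half_open_cube a' l'" using assms by auto
  then have *: "a' $ i \<le> a $ i" "a $ i + max 0 l' < a' $ i + l'" for i
    by (simp_all add: half_open_cube_def y_def)
  show False using *[of undefined] max.cobounded2[of l' 0] by linarith
qed

locale dyadic =
  fixes D :: "int \<Rightarrow> (real ^ 'd) set set" and \<mu> :: "(real ^ 'd) measure"
  assumes dyadic: "dyadic_system D"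
    and sets_mu: "sets \<mu> = sets borel"
    and locally_finite: "locally_finite_measure \<mu>"
begin

lemma space_mu [simp]: "space \<mu> = UNIV"
  using sets_eq_imp_space_eq[OF sets_mu] by simp

abbreviation "cubes \<equiv> \<Union>k. D k"

definition cube :: "int \<Rightarrow> real ^ 'd \<Rightarrow> (real ^ 'd) set" where
  "cube k x = (THE Q. Q \<in> D k \<and> x \<in> Q)"

lemma partition_D: "partition_on UNIV (D k)"
  using dyadic by (auto simp: dyadic_system_def)

lemma cube_eqI: "Q \<in> D k \<Longrightarrow> x \<in> Q \<Longrightarrow> cube k x = Q"
  unfolding cube_def using partition_onD2[OF partition_D[of k]]
  by (intro the_equality) (auto simp: disjoint_def)

lemma cube_in [simp, intro]: "cube k x \<in> D k" and mem_cube [simp, intro]: "x \<in> cube k x"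
proof -
  obtain Q where "Q \<in> D k" "x \<in> Q" using partition_onD1[OF partition_D[of k]] by blast
  then show "cube k x \<in> D k" "x \<in> cube k x" using cube_eqI[of Q k x] by auto
qed

lemma cube_eq_iff: "y \<in> cube k x \<longleftrightarrow> cube k y = cube k x"
  using cube_eqI by (metis cube_in mem_cube)

lemma D_nonempty: "Q \<in> D k \<Longrightarrow> Q \<noteq> {}"
  using partition_onD3[OF partition_D[of k]] by auto

lemma cube_antimono: "k \<le> l \<Longrightarrow> cube l x \<subseteq> cube k x"
proof (induction l rule: int_ge_induct)
  case (step l)
  have "refines UNIV (D (l + 1)) (D l)" using dyadic by (auto simp: dyadic_system_def)
  then obtain Y where Y: "Y \<in> D l" "cube (l + 1) x \<subseteq> Y" unfolding refines_def by blast
  then have "Y = cube l x" by (metis cube_eqI mem_cube subsetD)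
  then show ?case using Y step by auto
qed simp

lemma D_nested: "Q \<in> D k \<Longrightarrow> P \<in> D l \<Longrightarrow> k \<le> l \<Longrightarrow> x \<in> P \<Longrightarrow> x \<in> Q \<Longrightarrow> P \<subseteq> Q"
  using cube_antimono cube_eqI by metis

lemma half_open_cubeE:
  assumes "Q \<in> D k" obtains a where "Q = half_open_cube a (2 powi (- k))"
  using assms dyadic unfolding dyadic_system_def by blast

text \<open>Side-lengths decrease strictly with the generation. Inclusion therefore orders
  generations, and a cube belongs to exactly one of them, so the union \<open>cubes\<close> still
  determines the generation of its members.\<close>

lemma D_subset_le:
  assumes "P \<in> D l" "Q \<in> D k" "P \<subseteq> Q"
  shows "k \<le> l"
proof -
  obtain a a' where "P = half_open_cube a (2 powi (- l))" "Q = half_open_cube a' (2 powi (- k))"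
    using half_open_cubeE[OF assms(1)] half_open_cubeE[OF assms(2)] by metis
  then have "(2::real) powi (- l) \<le> 2 powi (- k)"
    using half_open_cube_side_le[of a "2 powi (-l)"] assms(3) by simp
  then show "k \<le> l" using power_int_strict_increasing[of "-k" "-l" "2::real"] by linarith
qed

lemma D_inj: "Q \<in> D k \<Longrightarrow> Q \<in> D l \<Longrightarrow> k = l"
  using D_subset_le[of Q] by (meson antisym order_refl)

text \<open>A cube P strictly inside Q has generation above k. The cube of generation k+1 through a
  point of P lies between P and Q and differs from Q by its side-length, so maximality identifies it
  with P.\<close>

lemma dyadic_children_eq:
  assumes Q: "Q \<in> D k"
  shows "dyadic_children cubes Q = {P \<in> D (k + 1). P \<subseteq> Q}"
proof (intro set_eqI iffI)
  fix P assume "P \<in> dyadic_children cubes Q"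
  then have P: "P \<in> cubes" "P \<subset> Q" and max: "\<And>R. R \<in> cubes \<Longrightarrow> P \<subseteq> R \<Longrightarrow> R \<subset> Q \<Longrightarrow> R = P"
    by (auto simp: dyadic_children_def)
  obtain j where j: "P \<in> D j" using P by auto
  obtain x where x: "x \<in> P" using D_nonempty[OF j] by auto
  have "\<not> j \<le> k" using D_nested[OF j Q, of x] P x by auto
  then have "P \<subseteq> cube (k + 1) x" using D_nested[OF cube_in j, of "k+1" x x] x by auto
  moreover have "cube (k + 1) x \<subseteq> Q" using D_nested[OF Q cube_in, of "k+1" x x] x P by auto
  moreover have "cube (k + 1) x \<noteq> Q" using D_inj[OF Q, of "k+1"] by (metis cube_in add_cancel_right_right one_neq_zero)
  ultimately have "cube (k + 1) x = P" by (intro max) auto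
  then show "P \<in> {P \<in> D (k + 1). P \<subseteq> Q}" using P by (metis (mono_tags) cube_in mem_Collect_eq psubset_imp_subset)
next
  fix P assume P: "P \<in> {P \<in> D (k + 1). P \<subseteq> Q}"
  then have "P \<noteq> Q" using D_inj[OF Q, of "k+1"] by auto
  moreover have "R = P" if R: "R \<in> D j" "P \<subseteq> R" "R \<subset> Q" for R j
  proof -
    obtain x where x: "x \<in> P" using D_nonempty P by blast
    have "\<not> j \<le> k" using D_nested[OF R(1) Q, of x] R x by auto
    then have "R \<subseteq> P" using D_nested[of P "k+1" R j x] P R x by auto
    then show ?thesis using R by auto
  qed
  ultimately show "P \<in> dyadic_children cubes Q" using P by (auto simp: dyadic_children_def)
qed

lemma D_sets [measurable, intro]: "Q \<in> D k \<Longrightarrow> Q \<in> sets \<mu>"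
proof -
  assume "Q \<in> D k"
  then obtain a where Q: "Q = half_open_cube a (2 powi (- k))" by (rule half_open_cubeE)
  have [measurable]: "(\<lambda>x::real^'d. x $ i) \<in> borel_measurable borel" for i
    by (intro borel_measurable_continuous_onI continuous_intros)
  have "{x \<in> space borel. \<forall>i\<in>UNIV. a $ i \<le> x $ i \<and> x $ i < a $ i + 2 powi (- k)} \<in> sets borel"
    by measurable
  then show ?thesis by (simp add: Q sets_mu half_open_cube_def)
qed

lemma bounded_D: "Q \<in> D k \<Longrightarrow> bounded Q"
proof -
  assume "Q \<in> D k"
  then obtain a where Q: "Q = half_open_cube a (2 powi (- k))" by (rule half_open_cubeE)
  have "Q \<subseteq> cbox a (a + (\<chi> i. 2 powi (- k)))"
    by (simp add: Q half_open_cube_def mem_box_cart subset_iff less_imp_le)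
  then show ?thesis by (rule bounded_subset[OF bounded_cbox])
qed

lemma compact_finite:
  assumes "compact K" shows "emeasure \<mu> K < \<infinity>"
proof -
  obtain U where U: "\<And>x. open (U x)" "\<And>x. x \<in> U x" "\<And>x. emeasure \<mu> (U x) < \<infinity>"
    using locally_finite unfolding locally_finite_measure_def by metis
  obtain C where C: "C \<subseteq> K" "finite C" "K \<subseteq> (\<Union>c\<in>C. U c)"
    by (rule compactE_image[OF assms, of K U]) (use U in auto)
  have meas: "U x \<in> sets \<mu>" for x using U(1)[of x] by (simp add: sets_mu)
  have "emeasure \<mu> K \<le> emeasure \<mu> (\<Union>c\<in>C. U c)"
    using C meas by (intro emeasure_mono) auto
  also have "\<dots> \<le> (\<Sum>c\<in>C. emeasure \<mu> (U c))"
    using C meas by (intro emeasure_subadditive_finite) auto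
  also have "\<dots> < \<infinity>" using U(3) unfolding infinity_ennreal_def ennreal_sum_less_top[OF C(2)] by blast
  finally show ?thesis .
qed

lemma emeasure_D_finite [simp]: "Q \<in> D k \<Longrightarrow> emeasure \<mu> Q < \<infinity>"
proof -
  assume Q: "Q \<in> D k"
  have "emeasure \<mu> Q \<le> emeasure \<mu> (closure Q)"
    using closure_subset by (intro emeasure_mono) (auto simp: sets_mu)
  also have "\<dots> < \<infinity>" using bounded_D[OF Q] by (intro compact_finite) simp
  finally show ?thesis .
qed

lemma emeasure_D: "Q \<in> D k \<Longrightarrow> emeasure \<mu> Q = ennreal (measure \<mu> Q)"
  using emeasure_D_finite[of Q k] by (intro emeasure_eq_ennreal_measure) auto

text \<open>Cubes of one generation are coded by the integer parts of their rescaled corners.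
  Corners with equal codes differ by less than L in every coordinate, so the coordinatewise maximum
  lies in both cubes and they coincide.\<close>

lemma finite_D_meeting:
  assumes "bounded B" shows "finite {Q \<in> D k. Q \<inter> B \<noteq> {}}"
proof -
  define L :: real where "L = 2 powi (- k)"
  have L: "0 < L" by (simp add: L_def)
  obtain M where M: "\<And>x. x \<in> B \<Longrightarrow> norm x \<le> M" using assms by (auto simp: bounded_iff)
  have "\<forall>Q\<in>D k. \<exists>a. Q = half_open_cube a L"
    using dyadic unfolding dyadic_system_def L_def by blast
  from bchoice[OF this] obtain a where a: "\<And>Q. Q \<in> D k \<Longrightarrow> Q = half_open_cube (a Q) L" by blast
  define g where "g Q = (\<lambda>i. \<lfloor>a Q $ i / L\<rfloor>)" for Q
  have inj: "inj_on g (D k)"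
  proof (rule inj_onI)
    fix Q P assume QP: "Q \<in> D k" "P \<in> D k" "g Q = g P"
    have d: "\<bar>a Q $ i - a P $ i\<bar> < L" for i
    proof -
      have "\<lfloor>a Q $ i / L\<rfloor> = \<lfloor>a P $ i / L\<rfloor>" using QP(3) by (auto simp: g_def fun_eq_iff)
      then have "\<bar>a Q $ i / L - a P $ i / L\<bar> < 1" by linarith
      then have "\<bar>(a Q $ i - a P $ i) / L\<bar> < 1" by (simp add: diff_divide_distrib)
      then show ?thesis using L by (simp add: abs_divide divide_less_eq)
    qed
    define c where "c = (\<chi> i. max (a Q $ i) (a P $ i))"
    have c: "a Q $ i \<le> c $ i \<and> c $ i < a Q $ i + L" "a P $ i \<le> c $ i \<and> c $ i < a P $ i + L" for i
      using L d[of i] by (simp_all add: c_def)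
    then have "c \<in> half_open_cube (a Q) L" "c \<in> half_open_cube (a P) L"
      by (simp_all add: half_open_cube_def)
    then have "c \<in> Q" "c \<in> P" using a[OF QP(1)] a[OF QP(2)] by blast+
    then show "Q = P" using cube_eqI[OF QP(1)] cube_eqI[OF QP(2)] by blast
  qed
  have "g Q i \<in> {\<lfloor>(- M - L) / L\<rfloor>..\<lfloor>M / L\<rfloor>}" if "Q \<in> D k" "Q \<inter> B \<noteq> {}" for Q i
  proof -
    from that obtain x where x: "x \<in> half_open_cube (a Q) L" "x \<in> B" using a by blast
    have "\<bar>x $ i\<bar> \<le> M" using M[OF x(2)] component_le_norm_cart[of x i] by linarith
    moreover have "a Q $ i \<le> x $ i" "x $ i < a Q $ i + L" using x(1) by (simp_all add: half_open_cube_def)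
    ultimately have "- M - L \<le> a Q $ i" "a Q $ i \<le> M" by linarith+
    then have "(- M - L) / L \<le> a Q $ i / L" "a Q $ i / L \<le> M / L" using L by (auto intro!: divide_right_mono)
    then show ?thesis unfolding g_def using floor_mono by (simp only: atLeastAtMost_iff) blast
  qed
  then have "g ` {Q \<in> D k. Q \<inter> B \<noteq> {}} \<subseteq> (UNIV \<rightarrow>\<^sub>E {\<lfloor>(- M - L) / L\<rfloor>..\<lfloor>M / L\<rfloor>})" by blast
  then have "finite (g ` {Q \<in> D k. Q \<inter> B \<noteq> {}})" by (rule finite_subset) (intro finite_PiE; simp)
  moreover have "inj_on g {Q \<in> D k. Q \<inter> B \<noteq> {}}" using inj by (rule inj_on_subset) blast
  ultimately show ?thesis by (rule finite_imageD)
qed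

lemma countable_D: "countable (D k)"
proof -
  have "D k = (\<Union>n. {Q \<in> D k. Q \<inter> ball 0 (real n) \<noteq> {}})"
  proof (intro set_eqI iffI)
    fix Q assume Q: "Q \<in> D k"
    then obtain x where "x \<in> Q" using D_nonempty by blast
    moreover obtain n where "norm x < real n" using reals_Archimedean2 by blast
    ultimately have "x \<in> Q \<inter> ball 0 (real n)" by simp
    then show "Q \<in> (\<Union>n. {Q \<in> D k. Q \<inter> ball 0 (real n) \<noteq> {}})" using Q by blast
  qed auto
  moreover have "countable (\<Union>n. {Q \<in> D k. Q \<inter> ball 0 (real n) \<noteq> {}})"
  proof (rule countable_UN)
    show "countable {Q \<in> D k. Q \<inter> ball 0 (real n) \<noteq> {}}" for n
      by (intro countable_finite finite_D_meeting bounded_ball)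
  qed simp
  ultimately show ?thesis by (rule ssubst)
qed

definition subcubes :: "int \<Rightarrow> (real ^ 'd) set \<Rightarrow> (real ^ 'd) set set" where
  "subcubes k Q = {P \<in> D k. P \<subseteq> Q}"

lemma finite_subcubes: "Q \<in> D j \<Longrightarrow> finite (subcubes k Q)"
  by (rule finite_subset[OF _ finite_D_meeting[OF bounded_D, of Q j k]])
     (auto simp: subcubes_def dest: D_nonempty)

lemma Union_subcubes: "Q \<in> D j \<Longrightarrow> j \<le> k \<Longrightarrow> \<Union>(subcubes k Q) = Q"
proof (intro equalityI subsetI)
  fix x assume "Q \<in> D j" "j \<le> k" "x \<in> Q"
  then have "cube k x \<in> subcubes k Q" using D_nested[of Q j "cube k x" k x] by (auto simp: subcubes_def)
  then show "x \<in> \<Union>(subcubes k Q)" by (meson UnionI mem_cube)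
qed (auto simp: subcubes_def)

end

section \<open>Functions constant on cubes, martingale increments, conditional expectations\<close>

context dyadic begin

text \<open>Measurability with respect to the \<sigma>-algebra generated by \<open>D k\<close>: its
  atoms are the countably many cubes, so it amounts to constancy on each of them.\<close>

definition adapted :: "int \<Rightarrow> (real ^ 'd \<Rightarrow> 'b) \<Rightarrow> bool" where
  "adapted k \<phi> \<longleftrightarrow> (\<forall>x y. cube k x = cube k y \<longrightarrow> \<phi> x = \<phi> y)"

lemma adaptedD: "adapted k \<phi> \<Longrightarrow> Q \<in> D k \<Longrightarrow> x \<in> Q \<Longrightarrow> y \<in> Q \<Longrightarrow> \<phi> x = \<phi> y"
  unfolding adapted_def by (simp add: cube_eqI)

lemma cube_eq_mono: "k \<le> l \<Longrightarrow> cube l x = cube l y \<Longrightarrow> cube k x = cube k y"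
  using cube_antimono[of k l y] mem_cube[of x l] cube_eq_iff[of x k y] by (simp only: subset_iff)

lemma adaptedI: "(\<And>x y. cube k x = cube k y \<Longrightarrow> \<phi> x = \<phi> y) \<Longrightarrow> adapted k \<phi>"
  unfolding adapted_def by (intro allI impI)

lemma adapted_eq: "adapted k \<phi> \<Longrightarrow> cube k x = cube k y \<Longrightarrow> \<phi> x = \<phi> y"
  by (rule adapted_def[THEN iffD1, rule_format])

lemma adapted_mono: "adapted k \<phi> \<Longrightarrow> k \<le> l \<Longrightarrow> adapted l \<phi>"
  by (rule adaptedI, rule adapted_eq, assumption, rule cube_eq_mono)

lemma adapted_const [simp]: "adapted k (\<lambda>x. c)"
  by (rule adaptedI) (rule refl)

lemma adapted_cube: "j \<le> k \<Longrightarrow> adapted k (\<lambda>x. F (cube j x))"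
  by (rule adaptedI, rule arg_cong[of _ _ F], rule cube_eq_mono)

lemma adapted_compose: "adapted k \<phi> \<Longrightarrow> adapted k (\<lambda>x. F (\<phi> x))"
  by (rule adaptedI, rule arg_cong[of _ _ F], rule adapted_eq)

lemma adapted_compose2: "adapted k \<phi> \<Longrightarrow> adapted k \<psi> \<Longrightarrow> adapted k (\<lambda>x. F (\<phi> x) (\<psi> x))"
  by (rule adaptedI, rule arg_cong2[of _ _ _ _ F]; rule adapted_eq)

lemma adapted_sum: "(\<And>i. i \<in> I \<Longrightarrow> adapted k (\<phi> i)) \<Longrightarrow> adapted k (\<lambda>x. \<Sum>i\<in>I. \<phi> i x)"
  by (rule adaptedI, rule sum.cong[OF refl], rule adapted_eq)

lemma adapted_measurable: "adapted k \<phi> \<Longrightarrow> \<phi> \<in> borel_measurable \<mu>"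
proof (rule measurable_piecewise_restrict[of "D k"])
  fix Q assume "adapted k \<phi>" and Q: "Q \<in> D k"
  obtain x where x: "x \<in> Q" using D_nonempty[OF Q] by auto
  have "(\<lambda>_. \<phi> x) \<in> measurable (restrict_space \<mu> Q) borel" by simp
  then show "\<phi> \<in> measurable (restrict_space \<mu> Q) borel"
  proof (rule measurable_cong[THEN iffD1, rotated])
    fix y assume "y \<in> space (restrict_space \<mu> Q)"
    then have "y \<in> Q" by (simp add: space_restrict_space)
    then show "\<phi> x = \<phi> y" by (rule adaptedD[OF \<open>adapted k \<phi>\<close> Q x])
  qed
qed (use countable_D partition_onD1[OF partition_D[of k]] in auto)

text \<open>A cube is bounded and meets finitely many cubes of generation k. Consequently adapted
  functions, with all their powers and norms, are integrable on every dyadic cube.\<close>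

lemma adapted_finite_image:
  assumes "adapted k \<phi>" "Q \<in> D j" shows "finite (\<phi> ` Q)"
proof -
  let ?S = "{P \<in> D k. P \<inter> Q \<noteq> {}}"
  have "\<phi> ` Q \<subseteq> (\<lambda>P. \<phi> (SOME x. x \<in> P)) ` ?S"
  proof
    fix y assume "y \<in> \<phi> ` Q"
    then obtain x where x: "x \<in> Q" "y = \<phi> x" by auto
    have "\<phi> (SOME z. z \<in> cube k x) = \<phi> x"
      by (rule adaptedD[OF assms(1) cube_in[of k x] someI[of "\<lambda>z. z \<in> cube k x" x]]) simp_all
    moreover have "cube k x \<in> ?S" using x by blast
    ultimately show "y \<in> (\<lambda>P. \<phi> (SOME x. x \<in> P)) ` ?S" using x by force
  qed
  then show ?thesis by (rule finite_subset) (use finite_D_meeting[OF bounded_D[OF assms(2)]] in auto)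
qed

lemma adapted_set_integrable:
  fixes \<phi> :: "real ^ 'd \<Rightarrow> 'b :: {banach, second_countable_topology}"
  assumes "adapted k \<phi>" "Q \<in> D j" shows "set_integrable \<mu> Q \<phi>"
proof -
  obtain B where "\<And>x. x \<in> Q \<Longrightarrow> norm (\<phi> x) \<le> B"
    using finite_imp_bounded[OF adapted_finite_image[OF assms]] by (auto simp: bounded_iff)
  then show ?thesis unfolding set_integrable_def
    by (intro integrableI_bounded_set_indicator[where B=B] adapted_measurable[OF assms(1)])
       (use assms emeasure_D_finite[OF assms(2)] in auto)
qed

lemma set_integral_subcubes:
  fixes \<phi> :: "real ^ 'd \<Rightarrow> 'b :: {banach, second_countable_topology}"
  assumes "Q \<in> D j" "j \<le> k" "set_integrable \<mu> Q \<phi>"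
  shows "(LINT x:Q|\<mu>. \<phi> x) = (\<Sum>P\<in>subcubes k Q. LINT x:P|\<mu>. \<phi> x)"
proof -
  have "(LINT x:(\<Union>P\<in>subcubes k Q. P)|\<mu>. \<phi> x) = (\<Sum>P\<in>subcubes k Q. LINT x:P|\<mu>. \<phi> x)"
  proof (rule set_integral_finite_Union[OF finite_subcubes[OF assms(1)]])
    show "disjoint_family_on (\<lambda>P. P) (subcubes k Q)"
      using partition_onD2[OF partition_D[of k]] by (auto simp: disjoint_family_on_def subcubes_def disjoint_def)
    show "set_integrable \<mu> P \<phi>" if "P \<in> subcubes k Q" for P
      using assms(3) by (rule set_integrable_subset) (use that in \<open>auto simp: subcubes_def\<close>)
  qed (auto simp: subcubes_def)
  then show ?thesis using Union_subcubes[OF assms(1,2)] by simp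
qed

text \<open>On null cubes both sides vanish, so the convention for \<open>average\<close> is
  harmless as long as integrals are compared.\<close>

lemma measure_scaleR_average:
  assumes "Q \<in> D k" shows "measure \<mu> Q *\<^sub>R average \<mu> f Q = (LINT x:Q|\<mu>. f x)"
proof (cases "emeasure \<mu> Q = 0")
  case True
  then have "Q \<in> null_sets \<mu>" using assms by auto
  then have "AE x in \<mu>. x \<notin> Q" by (rule AE_not_in)
  then have "(LINT x:Q|\<mu>. f x) = 0" unfolding set_lebesgue_integral_def
    by (intro integral_eq_zero_AE) (auto elim!: eventually_mono)
  then show ?thesis by (simp add: average_def True)
next
  case False
  then show ?thesis using emeasure_D[OF assms] by (simp add: average_def)
qed

text \<open>Vanishing of the conditional expectation is expressed by integrals over cubes, which
  makes it automatic on null cubes.\<close>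

definition martingale_increment :: "int \<Rightarrow> (real ^ 'd \<Rightarrow> 'b::{banach, second_countable_topology}) \<Rightarrow> bool" where
  "martingale_increment k d \<longleftrightarrow> adapted (k + 1) d \<and> (\<forall>Q\<in>D k. (LINT x:Q|\<mu>. d x) = 0)"

lemma martingale_increment_adapted: "martingale_increment k d \<Longrightarrow> adapted (k + 1) d"
  by (simp add: martingale_increment_def)

lemma set_integral_cong_D:
  assumes "Q \<in> D k" "\<And>x. x \<in> Q \<Longrightarrow> f x = g x"
  shows "(LINT x:Q|\<mu>. f x) = (LINT x:Q|\<mu>. g x)"
  using assms by (intro set_lebesgue_integral_cong) auto

lemma martingale_increment_mult:
  fixes d :: "real ^ 'd \<Rightarrow> 'b::{real_normed_field, banach, second_countable_topology}"
  assumes "martingale_increment k d" "adapted k c"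
  shows "martingale_increment k (\<lambda>x. c x * d x)"
  unfolding martingale_increment_def
proof (intro conjI ballI)
  show "adapted (k + 1) (\<lambda>x. c x * d x)"
    using assms martingale_increment_adapted by (intro adapted_compose2[where F="(*)"] adapted_mono[OF assms(2)]) auto
  fix Q assume Q: "Q \<in> D k"
  then obtain z where z: "z \<in> Q" using D_nonempty by blast
  have "(LINT x:Q|\<mu>. c x * d x) = (LINT x:Q|\<mu>. c z * d x)"
    by (rule set_integral_cong_D[OF Q], rule arg_cong[of _ _ "\<lambda>u. u * _"], rule adaptedD[OF assms(2) Q _ z])
  also have "\<dots> = 0" using assms(1) Q by (simp add: martingale_increment_def)
  finally show "(LINT x:Q|\<mu>. c x * d x) = 0" .
qed

lemma set_integral_inner_incr:
  fixes d V :: "real ^ 'd \<Rightarrow> 'b::euclidean_space"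
  assumes "martingale_increment k d" "adapted k V" "Q \<in> D j" "j \<le> k"
  shows "(LINT x:Q|\<mu>. inner (V x) (d x)) = 0"
proof -
  have ad: "adapted (k + 1) (\<lambda>x. inner (V x) (d x))"
    using assms martingale_increment_adapted by (intro adapted_compose2[where F=inner] adapted_mono[OF assms(2)]) auto
  have "(LINT x:P|\<mu>. inner (V x) (d x)) = 0" if P: "P \<in> D k" for P
  proof -
    obtain z where z: "z \<in> P" using D_nonempty[OF P] by blast
    have "(LINT x:P|\<mu>. inner (V x) (d x)) = (LINT x:P|\<mu>. inner (V z) (d x))"
      by (rule set_integral_cong_D[OF P], rule arg_cong[of _ _ "\<lambda>u. inner u _"], rule adaptedD[OF assms(2) P _ z])
    also have "\<dots> = inner (V z) (LINT x:P|\<mu>. d x)"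
    proof -
      have "integrable \<mu> (\<lambda>x. indicator P x *\<^sub>R d x)"
        using adapted_set_integrable[OF martingale_increment_adapted[OF assms(1)] P] by (simp add: set_integrable_def)
      then show ?thesis unfolding set_lebesgue_integral_def
        by (subst integral_inner_right[symmetric]) (auto intro!: Bochner_Integration.integral_cong)
    qed
    also have "\<dots> = 0" using assms(1) P by (simp add: martingale_increment_def)
    finally show ?thesis .
  qed
  then show ?thesis
    using set_integral_subcubes[OF assms(3,4) adapted_set_integrable[OF ad assms(3)]]
    by (simp add: subcubes_def)
qed

lemma set_integral_le_by_cubes:
  fixes \<phi> \<psi> :: "real ^ 'd \<Rightarrow> real"
  assumes "Q \<in> D j" "j \<le> k" "set_integrable \<mu> Q \<phi>" "set_integrable \<mu> Q \<psi>"
    and "\<And>P. P \<in> D k \<Longrightarrow> P \<subseteq> Q \<Longrightarrow> (LINT x:P|\<mu>. \<phi> x) \<le> (LINT x:P|\<mu>. \<psi> x)"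
  shows "(LINT x:Q|\<mu>. \<phi> x) \<le> (LINT x:Q|\<mu>. \<psi> x)"
  unfolding set_integral_subcubes[OF assms(1-3)] set_integral_subcubes[OF assms(1,2,4)]
  by (rule sum_mono) (use assms(5) in \<open>simp add: subcubes_def\<close>)

text \<open>Reduces an inequality of integrals to a pointwise one: the linear term may be added
  freely, as it integrates to zero on Q.\<close>

lemma supermartingale_step:
  fixes d V :: "real ^ 'd \<Rightarrow> 'b::euclidean_space"
  assumes "martingale_increment k d" "adapted k V" "Q \<in> D j" "j \<le> k"
    and "set_integrable \<mu> Q \<phi>" "set_integrable \<mu> Q \<psi>"
    and le: "\<And>x. \<psi> x \<le> \<phi> x + inner (V x) (d x)"
  shows "(LINT x:Q|\<mu>. \<psi> x) \<le> (LINT x:Q|\<mu>. \<phi> x)"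
proof -
  have ad: "adapted (k + 1) (\<lambda>x. inner (V x) (d x))"
    using assms(1,2) martingale_increment_adapted by (intro adapted_compose2[where F=inner] adapted_mono[OF assms(2)]) auto
  have i: "set_integrable \<mu> Q (\<lambda>x. inner (V x) (d x))" by (rule adapted_set_integrable[OF ad assms(3)])
  have "(LINT x:Q|\<mu>. \<psi> x) \<le> (LINT x:Q|\<mu>. \<phi> x + inner (V x) (d x))"
    by (rule set_integral_mono[OF assms(6) set_integral_add(1)[OF assms(5) i] le])
  also have "\<dots> = (LINT x:Q|\<mu>. \<phi> x)"
    by (simp add: set_integral_add(2)[OF assms(5) i] set_integral_inner_incr[OF assms(1-4)])
  finally show ?thesis .
qed

definition cond_exp :: "int \<Rightarrow> (real ^ 'd \<Rightarrow> 'b::{banach, second_countable_topology}) \<Rightarrow> real ^ 'd \<Rightarrow> 'b" where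
  "cond_exp k f x = average \<mu> f (cube k x)"

lemma adapted_cond_exp: "k \<le> l \<Longrightarrow> adapted l (cond_exp k f)"
  unfolding cond_exp_def by (rule adapted_cube)

lemma cond_exp_eq: "Q \<in> D k \<Longrightarrow> x \<in> Q \<Longrightarrow> cond_exp k f x = average \<mu> f Q"
  by (simp add: cond_exp_def cube_eqI)

lemma set_integral_const_D:
  fixes c :: "'b::{banach, second_countable_topology}"
  assumes "Q \<in> D k"
  shows "(LINT x:Q|\<mu>. c) = measure \<mu> Q *\<^sub>R c"
  using assms emeasure_D_finite[OF assms] by (intro set_integral_const) auto

lemma set_integral_cond_exp_same: "Q \<in> D k \<Longrightarrow> (LINT x:Q|\<mu>. cond_exp k f x) = (LINT x:Q|\<mu>. f x)"
proof -
  assume Q: "Q \<in> D k"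
  have "(LINT x:Q|\<mu>. cond_exp k f x) = (LINT x:Q|\<mu>. average \<mu> f Q)"
    by (rule set_integral_cong_D[OF Q]) (rule cond_exp_eq[OF Q])
  then show ?thesis using set_integral_const_D[OF Q, of "average \<mu> f Q"] measure_scaleR_average[OF Q, of f] by simp
qed

lemma set_integral_cond_exp:
  assumes "Q \<in> D j" "j \<le> k" "set_integrable \<mu> Q f"
  shows "(LINT x:Q|\<mu>. cond_exp k f x) = (LINT x:Q|\<mu>. f x)"
  unfolding set_integral_subcubes[OF assms] set_integral_subcubes[OF assms(1,2) adapted_set_integrable[OF adapted_cond_exp[OF order_refl] assms(1)]]
  by (rule sum.cong[OF refl]) (auto simp: subcubes_def set_integral_cond_exp_same)

lemma martingale_increment_cond_exp:
  assumes "\<And>Q. Q \<in> D k \<Longrightarrow> set_integrable \<mu> Q f"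
  shows "martingale_increment k (\<lambda>x. cond_exp (k + 1) f x - cond_exp k f x)"
  unfolding martingale_increment_def
proof (intro conjI ballI)
  show "adapted (k + 1) (\<lambda>x. cond_exp (k + 1) f x - cond_exp k f x)"
    by (intro adapted_compose2[where F="(-)"] adapted_cond_exp) auto
  fix Q assume Q: "Q \<in> D k"
  have "(LINT x:Q|\<mu>. cond_exp (k + 1) f x - cond_exp k f x)
      = (LINT x:Q|\<mu>. cond_exp (k + 1) f x) - (LINT x:Q|\<mu>. cond_exp k f x)"
    by (intro set_integral_diff(2) adapted_set_integrable[OF adapted_cond_exp[OF order_refl] Q])
  then show "(LINT x:Q|\<mu>. cond_exp (k + 1) f x - cond_exp k f x) = 0"
    using set_integral_cond_exp[OF Q _ assms[OF Q], of "k+1"] set_integral_cond_exp[OF Q _ assms[OF Q], of k] by simp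
qed

text \<open>Jensen's inequality on each cube P of generation k, from the tangent plane of |.|^p at m
  - a with m the average over P: its linear part is a fixed functional of f - m, which has mean zero
  on P.\<close>

lemma jensen_cond_exp:
  fixes f :: "real ^ 'd \<Rightarrow> 'b::euclidean_space"
  assumes p: "1 < p" and Q: "Q \<in> D j" and "j \<le> k" and f: "set_integrable \<mu> Q f"
    and fp: "set_integrable \<mu> Q (\<lambda>x. norm (f x - a) powr p)"
  shows "(LINT x:Q|\<mu>. norm (cond_exp k f x - a) powr p) \<le> (LINT x:Q|\<mu>. norm (f x - a) powr p)"
proof (rule set_integral_le_by_cubes[OF Q \<open>j \<le> k\<close> _ fp])
  show "set_integrable \<mu> Q (\<lambda>x. norm (cond_exp k f x - a) powr p)"
    by (rule adapted_set_integrable[OF adapted_compose[OF adapted_cond_exp[OF order_refl]] Q])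
  fix P assume P: "P \<in> D k" "P \<subseteq> Q"
  define m where "m = average \<mu> f P"
  define V where "V = (p * norm (m - a) powr (p - 2)) *\<^sub>R (m - a)"
  have iP: "set_integrable \<mu> P g" if "set_integrable \<mu> Q g" for g :: "real ^ 'd \<Rightarrow> 'c::{banach, second_countable_topology}"
    by (rule set_integrable_subset[OF that]) (use P in auto)
  have const: "set_integrable \<mu> P (\<lambda>x. c)" for c :: "'c::{banach, second_countable_topology}"
    by (rule adapted_set_integrable[OF adapted_const P(1)])
  have fm: "set_integrable \<mu> P (\<lambda>x. f x - m)" by (intro set_integral_diff(1) iP f const)
  have "(LINT x:P|\<mu>. f x - m) = 0"
    using set_integral_cond_exp_same[OF P(1), of f] set_integral_const_D[OF P(1), of m] measure_scaleR_average[OF P(1), of f]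
    by (simp add: set_integral_diff(2)[OF iP[OF f] const] m_def)
  then have 0: "(LINT x:P|\<mu>. inner V (f x - m)) = 0" and iV: "set_integrable \<mu> P (\<lambda>x. inner V (f x - m))"
  proof -
    have i: "integrable \<mu> (\<lambda>x. indicator P x *\<^sub>R (f x - m))" using fm by (simp add: set_integrable_def)
    have "inner V (LINT x:P|\<mu>. f x - m) = (LINT x:P|\<mu>. inner V (f x - m))" unfolding set_lebesgue_integral_def
      by (subst integral_inner_right[symmetric]) (use i in \<open>auto intro!: Bochner_Integration.integral_cong\<close>)
    then show "(LINT x:P|\<mu>. inner V (f x - m)) = 0" using \<open>(LINT x:P|\<mu>. f x - m) = 0\<close> by simp
    show "set_integrable \<mu> P (\<lambda>x. inner V (f x - m))"
      using integrable_inner_right[OF i, of V] by (simp add: set_integrable_def)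
  qed
  have "(LINT x:P|\<mu>. norm (cond_exp k f x - a) powr p) = (LINT x:P|\<mu>. norm (m - a) powr p)"
    by (rule set_integral_cong_D[OF P(1)]) (simp add: cond_exp_eq[OF P(1)] m_def)
  also have "\<dots> = (LINT x:P|\<mu>. norm (m - a) powr p + inner V (f x - m))"
    by (simp add: set_integral_add(2)[OF const iV] 0)
  also have "\<dots> \<le> (LINT x:P|\<mu>. norm (f x - a) powr p)"
  proof (rule set_integral_mono[OF set_integral_add(1)[OF const iV] iP[OF fp]])
    fix x
    show "norm (m - a) powr p + inner V (f x - m) \<le> norm (f x - a) powr p"
      using norm_powr_above_tangent[OF p, of "m - a" "f x - m"] by (simp add: V_def)
  qed
  finally show "(LINT x:P|\<mu>. norm (cond_exp k f x - a) powr p) \<le> (LINT x:P|\<mu>. norm (f x - a) powr p)" .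
qed

end

subsection \<open>Martingale inequalities\<close>

lemma sum_int_Suc: "k0 \<le> k \<Longrightarrow> (\<Sum>j\<in>{k0..<k+1}. f j) = (\<Sum>j\<in>{k0..<k}. f j) + f k" for k :: int
proof -
  assume "k0 \<le> k"
  then have "{k0..<k+1} = insert k {k0..<k}" by auto
  then show ?thesis by (simp add: add.commute)
qed

lemma sum_int_head: "k < K \<Longrightarrow> (\<Sum>j\<in>{k..<K}. f j) = f k + (\<Sum>j\<in>{k+1..<K}. f j)" for k :: int
proof -
  assume "k < K"
  then have "{k..<K} = insert k {k+1..<K}" by auto
  then show ?thesis by simp
qed

text \<open>\<open>sgn a\<close> is a subgradient of the norm at a, also at a = 0, where it is
  0.\<close>

lemma norm_ge_inner_sgn: "norm a + inner (sgn a) d \<le> norm (a + d)" for a d :: "'a::real_inner"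
proof (cases "a = 0")
  case False
  have "inner (sgn a) (a + d) \<le> norm (sgn a) * norm (a + d)" by (rule norm_cauchy_schwarz)
  moreover have "inner (sgn a) a = norm a"
    using False by (simp add: sgn_div_norm power2_norm_eq_inner[symmetric] power2_eq_square)
  ultimately show ?thesis using False by (simp add: inner_add_right norm_sgn)
qed simp

context dyadic begin

lemma adapted_add: "adapted k \<phi> \<Longrightarrow> adapted k \<psi> \<Longrightarrow> adapted k (\<lambda>x. \<phi> x + \<psi> x)"
  by (rule adapted_compose2)
lemma adapted_diff: "adapted k \<phi> \<Longrightarrow> adapted k \<psi> \<Longrightarrow> adapted k (\<lambda>x. \<phi> x - \<psi> x)"
  by (rule adapted_compose2)
lemma adapted_mult: "adapted k \<phi> \<Longrightarrow> adapted k \<psi> \<Longrightarrow> adapted k (\<lambda>x. \<phi> x * \<psi> x)"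
  by (rule adapted_compose2)
lemma adapted_scaleR: "adapted k \<phi> \<Longrightarrow> adapted k \<psi> \<Longrightarrow> adapted k (\<lambda>x. \<phi> x *\<^sub>R \<psi> x)"
  by (rule adapted_compose2)
lemma adapted_powr: "adapted k \<phi> \<Longrightarrow> adapted k (\<lambda>x. \<phi> x powr r)"
  by (rule adapted_compose)
lemma adapted_power: "adapted k \<phi> \<Longrightarrow> adapted k (\<lambda>x. \<phi> x ^ n)"
  by (rule adapted_compose)
lemma adapted_norm: "adapted k \<phi> \<Longrightarrow> adapted k (\<lambda>x. norm (\<phi> x))"
  by (rule adapted_compose)
lemma adapted_sgn: "adapted k \<phi> \<Longrightarrow> adapted k (\<lambda>x. sgn (\<phi> x))"
  by (rule adapted_compose)

lemmas adapted_intros = adapted_const adapted_add adapted_diff adapted_mult adapted_scaleR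
  adapted_powr adapted_power adapted_norm adapted_sgn adapted_sum

lemma adapted_Max:
  assumes "\<And>j. j \<in> I \<Longrightarrow> adapted k (\<phi> j)" shows "adapted k (\<lambda>x. Max ((\<lambda>j. \<phi> j x) ` I))"
  by (rule adaptedI, rule arg_cong[of _ _ Max], rule image_cong[OF refl], rule adapted_eq[OF assms])

text \<open>The common frame of the martingale inequalities below: \<Phi> is a difference of the
  quantities to be compared, V is its (sub)gradient in the current value, and the pointwise step
  inequality is the analytic content.\<close>

lemma supermartingale_nonpos:
  fixes d V :: "int \<Rightarrow> real ^ 'd \<Rightarrow> 'b::euclidean_space"
  assumes Q: "Q \<in> D k0" and "k0 \<le> K"
    and "\<And>k. k0 \<le> k \<Longrightarrow> martingale_increment k (d k)"
    and "\<And>k. k0 \<le> k \<Longrightarrow> adapted k (\<Phi> k)"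
    and "\<And>k. k0 \<le> k \<Longrightarrow> adapted k (V k)"
    and "\<And>k x. k0 \<le> k \<Longrightarrow> \<Phi> (k + 1) x \<le> \<Phi> k x + inner (V k x) (d k x)"
    and base: "\<And>x. \<Phi> k0 x \<le> 0"
  shows "(LINT x:Q|\<mu>. \<Phi> K x) \<le> 0"
  using \<open>k0 \<le> K\<close>
proof (induction K rule: int_ge_induct)
  case base
  have "(LINT x:Q|\<mu>. \<Phi> k0 x) \<le> (LINT x:Q|\<mu>. 0)"
    by (rule set_integral_mono[OF adapted_set_integrable[OF assms(4)[OF order_refl] Q] adapted_set_integrable[OF adapted_const Q] assms(7)])
  then show ?case by simp
next
  case (step k)
  have "(LINT x:Q|\<mu>. \<Phi> (k + 1) x) \<le> (LINT x:Q|\<mu>. \<Phi> k x)"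
  proof (rule supermartingale_step[OF assms(3)[OF step.hyps] assms(5)[OF step.hyps] Q step.hyps _ _ assms(6)[OF step.hyps]])
    show "set_integrable \<mu> Q (\<Phi> k)" by (rule adapted_set_integrable[OF assms(4)[OF step.hyps] Q])
    show "set_integrable \<mu> Q (\<Phi> (k + 1))" using step.hyps by (intro adapted_set_integrable[OF assms(4) Q]) simp
  qed
  then show ?case using step.IH by simp
qed

definition martingale_from :: "int \<Rightarrow> (int \<Rightarrow> real ^ 'd \<Rightarrow> 'b::euclidean_space) \<Rightarrow> bool" where
  "martingale_from k0 z \<longleftrightarrow> (\<forall>k\<ge>k0. adapted k (z k) \<and> martingale_increment k (\<lambda>x. z (k + 1) x - z k x))"

lemma martingale_fromD: "martingale_from k0 z \<Longrightarrow> k0 \<le> k \<Longrightarrow> adapted k (z k)"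
  "martingale_from k0 z \<Longrightarrow> k0 \<le> k \<Longrightarrow> martingale_increment k (\<lambda>x. z (k + 1) x - z k x)"
  by (auto simp: martingale_from_def)

lemma mart_adapted: "martingale_from k0 z \<Longrightarrow> k0 \<le> k \<Longrightarrow> k \<le> l \<Longrightarrow> adapted l (z k)"
  by (rule adapted_mono[OF martingale_fromD(1)])

definition max_fun :: "int \<Rightarrow> (int \<Rightarrow> real ^ 'd \<Rightarrow> 'b::real_normed_vector) \<Rightarrow> int \<Rightarrow> real ^ 'd \<Rightarrow> real" where
  "max_fun k0 z k x = Max ((\<lambda>j. norm (z j x)) ` {k0..k})"

lemma max_fun_base: "max_fun k0 z k0 x = norm (z k0 x)"
  by (simp add: max_fun_def)

lemma max_fun_Suc: "k0 \<le> k \<Longrightarrow> max_fun k0 z (k + 1) x = max (max_fun k0 z k x) (norm (z (k + 1) x))"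
proof -
  assume "k0 \<le> k"
  then have "{k0..k+1} = insert (k+1) {k0..k}" by auto
  then show ?thesis using \<open>k0 \<le> k\<close> by (simp add: max_fun_def max.commute)
qed

lemma norm_le_max_fun: "k0 \<le> j \<Longrightarrow> j \<le> k \<Longrightarrow> norm (z j x) \<le> max_fun k0 z k x"
  unfolding max_fun_def by (rule Max_ge) auto

lemma max_fun_nonneg: "k0 \<le> k \<Longrightarrow> 0 \<le> max_fun k0 z k x"
  using norm_le_max_fun[of k0 k k z x] norm_ge_zero order_trans by blast

lemma max_fun_mono: "k0 \<le> k \<Longrightarrow> k \<le> l \<Longrightarrow> max_fun k0 z k x \<le> max_fun k0 z l x"
  unfolding max_fun_def by (rule Max_mono) auto

lemma adapted_max_fun: "martingale_from k0 z \<Longrightarrow> k0 \<le> k \<Longrightarrow> k \<le> l \<Longrightarrow> adapted l (max_fun k0 z k)"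
  unfolding max_fun_def by (rule adapted_Max, rule adapted_norm, rule mart_adapted) auto

text \<open>The supermartingale is (p-1) m^p - p |z| m^(p-1) with m the running maximum. It equals
  -|z|^p at the start, \<open>doob_step\<close> handles the update of m, and
  \<open>doob_young\<close> converts the result into the maximal inequality.\<close>

lemma doob:
  fixes z :: "int \<Rightarrow> real ^ 'd \<Rightarrow> 'b::euclidean_space"
  assumes p: "1 < p" and z: "martingale_from k0 z" and Q: "Q \<in> D k0" and K: "k0 \<le> K"
  shows "(LINT x:Q|\<mu>. max_fun k0 z K x powr p) \<le> 2 powr p / (p - 1) * (LINT x:Q|\<mu>. norm (z K x) powr p)"
proof -
  define m where "m = max_fun k0 z"
  define \<Phi> where "\<Phi> k x = (p - 1) * m k x powr p - p * norm (z k x) * m k x powr (p - 1)" for k x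
  define V where "V k x = (- (p * m k x powr (p - 1))) *\<^sub>R sgn (z k x)" for k x
  have adapted_max_cond_exp: "adapted k (m k)" if "k0 \<le> k" for k
    unfolding m_def using adapted_max_fun[OF z that order_refl] .
  have a\<Phi>: "adapted k (\<Phi> k)" if "k0 \<le> k" for k
    unfolding \<Phi>_def[abs_def] using that by (intro adapted_intros adapted_max_cond_exp martingale_fromD(1)[OF z])
  have max_cond_exp_nonneg: "0 \<le> m k x" if "k0 \<le> k" for k x using max_fun_nonneg[OF that] by (simp add: m_def)
  have "(LINT x:Q|\<mu>. \<Phi> K x) \<le> 0"
  proof (rule supermartingale_nonpos[OF Q K martingale_fromD(2)[OF z] a\<Phi>, where V = V])
    show "adapted k (V k)" if "k0 \<le> k" for k
    proof -
      have "adapted k (\<lambda>x. (0 - p * m k x powr (p - 1)) *\<^sub>R sgn (z k x))"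
        using that by (intro adapted_intros adapted_max_cond_exp martingale_fromD(1)[OF z])
      then show ?thesis by (simp add: V_def[abs_def])
    qed
    show "\<Phi> (k + 1) x \<le> \<Phi> k x + inner (V k x) (z (k + 1) x - z k x)" if k: "k0 \<le> k" for k x
    proof -
      have "\<Phi> (k + 1) x \<le> (p - 1) * m k x powr p - p * norm (z (k + 1) x) * m k x powr (p - 1)"
        using doob_step[OF p norm_ge_zero[of "z (k+1) x"] max_cond_exp_nonneg[OF k, of x]] max_fun_Suc[OF k, of z x] by (simp add: \<Phi>_def m_def)
      moreover have "p * m k x powr (p - 1) * (norm (z k x) + inner (sgn (z k x)) (z (k + 1) x - z k x))
          \<le> p * m k x powr (p - 1) * norm (z (k + 1) x)"
        using norm_ge_inner_sgn[of "z k x" "z (k+1) x - z k x"] p by (intro mult_left_mono) auto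
      ultimately show ?thesis by (simp add: \<Phi>_def V_def distrib_left mult.commute mult.left_commute)
    qed
    show "\<Phi> k0 x \<le> 0" for x
    proof -
      have "p * norm (z k0 x) * norm (z k0 x) powr (p - 1) = p * norm (z k0 x) powr p"
        using powr_minus_1_mult[of "norm (z k0 x)" p] p by (simp only: mult.assoc mult.commute[of "norm (z k0 x)"]) simp
      then show ?thesis unfolding \<Phi>_def m_def max_fun_base by (simp only: left_diff_distrib) simp
    qed
  qed auto
  moreover have "(LINT x:Q|\<mu>. (p - 1)/2 * m K x powr p - 2 powr (p - 1) * norm (z K x) powr p) \<le> (LINT x:Q|\<mu>. \<Phi> K x)"
  proof (rule set_integral_mono)
    show "set_integrable \<mu> Q (\<lambda>x. (p - 1)/2 * m K x powr p - 2 powr (p - 1) * norm (z K x) powr p)"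
      by (rule adapted_set_integrable[OF _ Q, of K]) (intro adapted_intros adapted_max_cond_exp martingale_fromD(1)[OF z] K)
    show "set_integrable \<mu> Q (\<Phi> K)" by (rule adapted_set_integrable[OF a\<Phi>[OF K] Q])
    show "(p - 1)/2 * m K x powr p - 2 powr (p - 1) * norm (z K x) powr p \<le> \<Phi> K x" for x
      unfolding \<Phi>_def by (rule doob_young[OF p norm_ge_zero max_cond_exp_nonneg[OF K]])
  qed
  moreover have "(LINT x:Q|\<mu>. (p - 1)/2 * m K x powr p - 2 powr (p - 1) * norm (z K x) powr p)
     = (p - 1)/2 * (LINT x:Q|\<mu>. m K x powr p) - 2 powr (p - 1) * (LINT x:Q|\<mu>. norm (z K x) powr p)"
    by (subst set_integral_diff(2))
       (auto intro!: adapted_set_integrable[OF _ Q, of K] adapted_intros adapted_max_cond_exp martingale_fromD(1)[OF z] K)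
  ultimately have "(p - 1)/2 * (LINT x:Q|\<mu>. m K x powr p) \<le> 2 powr (p - 1) * (LINT x:Q|\<mu>. norm (z K x) powr p)"
    by linarith
  then show ?thesis using p by (simp add: m_def powr_diff field_simps)
qed

section \<open>Square functions for exponents at most two\<close>

definition sq_fun :: "int \<Rightarrow> (int \<Rightarrow> real ^ 'd \<Rightarrow> 'b::real_normed_vector) \<Rightarrow> int \<Rightarrow> real ^ 'd \<Rightarrow> real" where
  "sq_fun k0 z k x = (\<Sum>j\<in>{k0..<k}. norm (z (j + 1) x - z j x) ^ 2)"

lemma sq_fun_nonneg: "0 \<le> sq_fun k0 z k x"
  by (simp add: sq_fun_def sum_nonneg)

lemma sq_fun_Suc: "k0 \<le> k \<Longrightarrow> sq_fun k0 z (k + 1) x = sq_fun k0 z k x + norm (z (k + 1) x - z k x) ^ 2"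
  unfolding sq_fun_def by (rule sum_int_Suc)

lemma adapted_sq_fun: "martingale_from k0 z \<Longrightarrow> k0 \<le> k \<Longrightarrow> adapted k (sq_fun k0 z k)"
  unfolding sq_fun_def[abs_def] by (intro adapted_intros mart_adapted) auto

lemma square_fun_step:
  fixes x h :: "'b::real_inner"
  assumes p: "1 < p" "p \<le> 2" and s: "0 \<le> s"
  defines "R \<equiv> s + norm x ^ 2"
  shows "(s + norm h ^ 2 + norm (x + h) ^ 2) powr (p/2)
    \<le> R powr (p/2) + inner ((p * R powr (p/2 - 1)) *\<^sub>R x) h + 20 * (norm h ^ 2 * (R + norm h ^ 2) powr (p/2 - 1))"
proof -
  have "s + norm h ^ 2 + norm (x + h) ^ 2 = R + 2 * inner x h + 2 * norm h ^ 2"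
    by (simp add: R_def power2_norm_eq_inner inner_simps inner_commute)
  then show ?thesis using square_sum_powr_le[of "p/2" x R h] p s by (simp only:) (simp add: R_def)
qed

lemma norm_powr_le_sq:
  "0 < p \<Longrightarrow> 0 \<le> s \<Longrightarrow> norm x powr p \<le> (s + norm x ^ 2) powr (p/2)"
  "0 < p \<Longrightarrow> 0 \<le> s \<Longrightarrow> s powr (p/2) \<le> (s + norm x ^ 2) powr (p/2)"
  unfolding powr_norm_eq[of x p] by (intro powr_mono2; simp)+

text \<open>A step h raises (s+|z|^2)^(p/2) by at most 20 |h|^2 (R+|h|^2)^(p/2-1) beyond the linear
  term, while concavity makes s^(p/2) grow by at least (p/2) |h|^2 (s+|h|^2)^(p/2-1). As p/2 \<ge>
  1/2 and R \<ge> s, 40 copies of s^(p/2) compensate.\<close>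

lemma mart_le_sq_fun:
  fixes z :: "int \<Rightarrow> real ^ 'd \<Rightarrow> 'b::euclidean_space"
  assumes p: "1 < p" "p \<le> 2" and z: "martingale_from k0 z" and z0: "\<And>x. z k0 x = 0" and Q: "Q \<in> D k0" and K: "k0 \<le> K"
  shows "(LINT x:Q|\<mu>. norm (z K x) powr p) \<le> 40 * (LINT x:Q|\<mu>. sq_fun k0 z K x powr (p/2))"
proof -
  define s where "s = sq_fun k0 z"
  define \<Phi> where "\<Phi> k x = (s k x + norm (z k x) ^ 2) powr (p/2) - 40 * s k x powr (p/2)" for k x
  define V where "V k x = (p * (s k x + norm (z k x) ^ 2) powr (p/2 - 1)) *\<^sub>R z k x" for k x
  have as: "adapted k (s k)" if "k0 \<le> k" for k
    unfolding s_def using adapted_sq_fun[OF z that] .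
  have s0: "0 \<le> s k x" for k x by (simp add: s_def sq_fun_nonneg)
  have a\<Phi>: "adapted k (\<Phi> k)" if "k0 \<le> k" for k
    unfolding \<Phi>_def[abs_def] using that by (intro adapted_intros as martingale_fromD(1)[OF z])
  have "(LINT x:Q|\<mu>. \<Phi> K x) \<le> 0"
  proof (rule supermartingale_nonpos[OF Q K martingale_fromD(2)[OF z] a\<Phi>, where V = V])
    show "adapted k (V k)" if "k0 \<le> k" for k
      unfolding V_def[abs_def] using that by (intro adapted_intros as martingale_fromD(1)[OF z])
    show "\<Phi> (k + 1) x \<le> \<Phi> k x + inner (V k x) (z (k + 1) x - z k x)" if k: "k0 \<le> k" for k x
    proof -
      define h where "h = z (k + 1) x - z k x"
      define R where "R = s k x + norm (z k x) ^ 2"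
      have zk: "z (k + 1) x = z k x + h" by (simp add: h_def)
      have sk: "s (k + 1) x = s k x + norm h ^ 2" using sq_fun_Suc[OF k, of z x] by (simp add: s_def h_def)
      have "20 * (norm h ^ 2 * (R + norm h ^ 2) powr (p/2 - 1)) \<le> 40 * ((s k x + norm h ^ 2) powr (p/2) - s k x powr (p/2))"
      proof (cases "h = 0")
        case False
        then have pos: "0 < s k x + norm h ^ 2" using s0[of k x] by (simp add: add_nonneg_pos)
        have "s k x powr (p/2) \<le> (s k x + norm h ^ 2) powr (p/2) + p/2 * (s k x + norm h ^ 2) powr (p/2 - 1) * (s k x - (s k x + norm h ^ 2))"
          by (rule powr_below_tangent) (use p pos s0 in auto)
        then have "p/2 * ((s k x + norm h ^ 2) powr (p/2 - 1) * norm h ^ 2) \<le> (s k x + norm h ^ 2) powr (p/2) - s k x powr (p/2)"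
          by simp
        moreover have "1/2 * ((R + norm h ^ 2) powr (p/2 - 1) * norm h ^ 2) \<le> p/2 * ((s k x + norm h ^ 2) powr (p/2 - 1) * norm h ^ 2)"
          using p pos by (intro mult_mono powr_mono2') (auto simp: R_def)
        ultimately show ?thesis by (simp add: mult.commute)
      qed simp
      moreover have "(s k x + norm h ^ 2 + norm (z k x + h) ^ 2) powr (p/2)
          \<le> R powr (p/2) + inner (V k x) h + 20 * (norm h ^ 2 * (R + norm h ^ 2) powr (p/2 - 1))"
        unfolding V_def R_def by (rule square_fun_step[OF p s0])
      ultimately show ?thesis unfolding \<Phi>_def zk sk by (simp add: R_def right_diff_distrib)
    qed
    show "\<Phi> k0 x \<le> 0" for x by (simp add: \<Phi>_def z0 s_def sq_fun_def)
  qed auto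
  moreover have "(LINT x:Q|\<mu>. norm (z K x) powr p - 40 * s K x powr (p/2)) \<le> (LINT x:Q|\<mu>. \<Phi> K x)"
  proof (rule set_integral_mono)
    show "set_integrable \<mu> Q (\<lambda>x. norm (z K x) powr p - 40 * s K x powr (p/2))"
      by (rule adapted_set_integrable[OF _ Q, of K]) (intro adapted_intros as martingale_fromD(1)[OF z] K)
    show "set_integrable \<mu> Q (\<Phi> K)" by (rule adapted_set_integrable[OF a\<Phi>[OF K] Q])
    show "norm (z K x) powr p - 40 * s K x powr (p/2) \<le> \<Phi> K x" for x
      using norm_powr_le_sq(1)[of p "s K x" "z K x"] p s0 by (simp add: \<Phi>_def)
  qed
  moreover have "(LINT x:Q|\<mu>. norm (z K x) powr p - 40 * s K x powr (p/2))
     = (LINT x:Q|\<mu>. norm (z K x) powr p) - 40 * (LINT x:Q|\<mu>. s K x powr (p/2))"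
    by (subst set_integral_diff(2))
       (auto intro!: adapted_set_integrable[OF _ Q, of K] adapted_intros as martingale_fromD(1)[OF z] K)
  ultimately show ?thesis by (simp add: s_def)
qed

text \<open>Here the growth of (s+|z|^2)^(p/2) is compensated by that of |z|^p, which is at least
  (p-1)/8 times the same second-order quantity by \<open>norm_powr_above_tangent_le_2\<close>;
  160/(p-1) is 20 divided by this factor.\<close>

lemma sq_fun_le_mart:
  fixes z :: "int \<Rightarrow> real ^ 'd \<Rightarrow> 'b::euclidean_space"
  assumes p: "1 < p" "p \<le> 2" and z: "martingale_from k0 z" and z0: "\<And>x. z k0 x = 0" and Q: "Q \<in> D k0" and K: "k0 \<le> K"
  shows "(LINT x:Q|\<mu>. sq_fun k0 z K x powr (p/2)) \<le> 160/(p - 1) * (LINT x:Q|\<mu>. norm (z K x) powr p)"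
proof -
  define s where "s = sq_fun k0 z"
  define c where "c = 160/(p - 1)"
  define \<Phi> where "\<Phi> k x = (s k x + norm (z k x) ^ 2) powr (p/2) - c * norm (z k x) powr p" for k x
  define V where "V k x = (p * (s k x + norm (z k x) ^ 2) powr (p/2 - 1) - c * (p * norm (z k x) powr (p - 2))) *\<^sub>R z k x" for k x
  have c: "0 < c" using p by (simp add: c_def)
  have as: "adapted k (s k)" if "k0 \<le> k" for k
    unfolding s_def using adapted_sq_fun[OF z that] .
  have s0: "0 \<le> s k x" for k x by (simp add: s_def sq_fun_nonneg)
  have a\<Phi>: "adapted k (\<Phi> k)" if "k0 \<le> k" for k
    unfolding \<Phi>_def[abs_def] using that by (intro adapted_intros as martingale_fromD(1)[OF z])
  have "(LINT x:Q|\<mu>. \<Phi> K x) \<le> 0"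
  proof (rule supermartingale_nonpos[OF Q K martingale_fromD(2)[OF z] a\<Phi>, where V = V])
    show "adapted k (V k)" if "k0 \<le> k" for k
      unfolding V_def[abs_def] using that by (intro adapted_intros as martingale_fromD(1)[OF z])
    show "\<Phi> (k + 1) x \<le> \<Phi> k x + inner (V k x) (z (k + 1) x - z k x)" if k: "k0 \<le> k" for k x
    proof -
      define h where "h = z (k + 1) x - z k x"
      define R where "R = s k x + norm (z k x) ^ 2"
      define W where "W = norm h ^ 2 * (R + norm h ^ 2) powr (p/2 - 1)"
      have zk: "z (k + 1) x = z k x + h" by (simp add: h_def)
      have sk: "s (k + 1) x = s k x + norm h ^ 2" using sq_fun_Suc[OF k, of z x] by (simp add: s_def h_def)
      have W: "W \<le> (norm (z k x) ^ 2 + norm h ^ 2) powr (p/2 - 1) * norm h ^ 2"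
      proof (cases "h = 0")
        case False
        then have pos: "0 < norm (z k x) ^ 2 + norm h ^ 2" by (simp add: add_nonneg_pos)
        have "(R + norm h ^ 2) powr (p/2 - 1) \<le> (norm (z k x) ^ 2 + norm h ^ 2) powr (p/2 - 1)"
          using p pos s0 by (intro powr_mono2') (auto simp: R_def)
        then show ?thesis unfolding W_def by (subst mult.commute) (intro mult_right_mono; simp)
      qed (simp add: W_def)
      have "(p - 1)/8 * W \<le> (p - 1)/8 * ((norm (z k x) ^ 2 + norm h ^ 2) powr (p/2 - 1) * norm h ^ 2)"
        using W p by (intro mult_left_mono) auto
      then have "norm (z k x) powr p + p * norm (z k x) powr (p - 2) * inner (z k x) h + (p - 1)/8 * W \<le> norm (z k x + h) powr p"
        using norm_powr_above_tangent_le_2[OF p, of "z k x" h] by simp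
      then have "c * (norm (z k x) powr p + p * norm (z k x) powr (p - 2) * inner (z k x) h + (p - 1)/8 * W) \<le> c * norm (z k x + h) powr p"
        using c by (intro mult_left_mono) auto
      moreover have "c * ((p - 1)/8 * W) = 20 * W" using p by (simp add: c_def)
      ultimately have "c * norm (z k x) powr p + c * (p * norm (z k x) powr (p - 2)) * inner (z k x) h + 20 * W \<le> c * norm (z k x + h) powr p"
        by (simp only: distrib_left mult.assoc)
      moreover have "(s k x + norm h ^ 2 + norm (z k x + h) ^ 2) powr (p/2)
          \<le> R powr (p/2) + inner ((p * R powr (p/2 - 1)) *\<^sub>R z k x) h + 20 * W"
        unfolding W_def R_def by (rule square_fun_step[OF p s0])
      ultimately show ?thesis unfolding \<Phi>_def zk sk V_def by (simp add: R_def left_diff_distrib)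
    qed
    show "\<Phi> k0 x \<le> 0" for x by (simp add: \<Phi>_def z0 s_def sq_fun_def)
  qed auto
  moreover have "(LINT x:Q|\<mu>. s K x powr (p/2) - c * norm (z K x) powr p) \<le> (LINT x:Q|\<mu>. \<Phi> K x)"
  proof (rule set_integral_mono)
    show "set_integrable \<mu> Q (\<lambda>x. s K x powr (p/2) - c * norm (z K x) powr p)"
      by (rule adapted_set_integrable[OF _ Q, of K]) (intro adapted_intros as martingale_fromD(1)[OF z] K)
    show "set_integrable \<mu> Q (\<Phi> K)" by (rule adapted_set_integrable[OF a\<Phi>[OF K] Q])
    show "s K x powr (p/2) - c * norm (z K x) powr p \<le> \<Phi> K x" for x
      using norm_powr_le_sq(2)[of p "s K x" "z K x"] p s0 by (simp add: \<Phi>_def)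
  qed
  moreover have "(LINT x:Q|\<mu>. s K x powr (p/2) - c * norm (z K x) powr p)
     = (LINT x:Q|\<mu>. s K x powr (p/2)) - c * (LINT x:Q|\<mu>. norm (z K x) powr p)"
    by (subst set_integral_diff(2))
       (auto intro!: adapted_set_integrable[OF _ Q, of K] adapted_intros as martingale_fromD(1)[OF z] K)
  ultimately show ?thesis by (simp add: s_def c_def)
qed

section \<open>Sums of powers of increments\<close>

text \<open>Each step of |z|^p gains 2^(1-p) |h|^p by uniform convexity, so 2^(1-p) s - |z|^p is a
  supermartingale, with s the sum on the left.\<close>

lemma sum_incr_powr_le_mart:
  fixes z :: "int \<Rightarrow> real ^ 'd \<Rightarrow> 'b::euclidean_space"
  assumes p: "2 \<le> p" and z: "martingale_from k0 z" and z0: "\<And>x. z k0 x = 0" and Q: "Q \<in> D k0" and K: "k0 \<le> K"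
  shows "(LINT x:Q|\<mu>. (\<Sum>j\<in>{k0..<K}. norm (z (j + 1) x - z j x) powr p)) \<le> 2 powr (p - 1) * (LINT x:Q|\<mu>. norm (z K x) powr p)"
proof -
  define s where "s k x = (\<Sum>j\<in>{k0..<k}. norm (z (j + 1) x - z j x) powr p)" for k x
  define \<Phi> where "\<Phi> k x = 2 powr (1 - p) * s k x - norm (z k x) powr p" for k x
  define V where "V k x = (0 - p * norm (z k x) powr (p - 2)) *\<^sub>R z k x" for k x
  have as: "adapted k (s k)" if "k0 \<le> k" for k
    unfolding s_def[abs_def] by (intro adapted_intros mart_adapted[OF z]) (use that in auto)
  have a\<Phi>: "adapted k (\<Phi> k)" if "k0 \<le> k" for k
    unfolding \<Phi>_def[abs_def] using that by (intro adapted_intros as martingale_fromD(1)[OF z])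
  have "(LINT x:Q|\<mu>. \<Phi> K x) \<le> 0"
  proof (rule supermartingale_nonpos[OF Q K martingale_fromD(2)[OF z] a\<Phi>, where V = V])
    show "adapted k (V k)" if "k0 \<le> k" for k
      unfolding V_def[abs_def] using that by (intro adapted_intros martingale_fromD(1)[OF z])
    show "\<Phi> (k + 1) x \<le> \<Phi> k x + inner (V k x) (z (k + 1) x - z k x)" if k: "k0 \<le> k" for k x
      using norm_powr_above_tangent_ge_2[OF p, of "z k x" "z (k + 1) x - z k x"]
      by (simp add: \<Phi>_def V_def s_def sum_int_Suc[OF k] distrib_left)
    show "\<Phi> k0 x \<le> 0" for x by (simp add: \<Phi>_def z0 s_def)
  qed auto
  moreover have "(LINT x:Q|\<mu>. \<Phi> K x) = 2 powr (1 - p) * (LINT x:Q|\<mu>. s K x) - (LINT x:Q|\<mu>. norm (z K x) powr p)"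
    unfolding \<Phi>_def by (subst set_integral_diff(2))
       (auto intro!: adapted_set_integrable[OF _ Q, of K] adapted_intros as martingale_fromD(1)[OF z] K)
  ultimately have "2 powr (p - 1) * (2 powr (1 - p) * (LINT x:Q|\<mu>. s K x)) \<le> 2 powr (p - 1) * (LINT x:Q|\<mu>. norm (z K x) powr p)"
    by (intro mult_left_mono) auto
  moreover have "(2::real) powr (p - 1) * (2 powr (1 - p) * X) = X" for X
    by (simp flip: mult.assoc powr_add)
  ultimately show ?thesis by (simp add: s_def)
qed

text \<open>The weight |z_j|^(p-2) keeps the martingale itself on the right-hand side; it is
  absorbed later through the maximal inequality.\<close>

lemma mart_le_sum_incr:
  fixes z :: "int \<Rightarrow> real ^ 'd \<Rightarrow> 'b::euclidean_space"
  assumes z: "martingale_from k0 z" and z0: "\<And>x. z k0 x = 0" and Q: "Q \<in> D k0" and K: "k0 \<le> K"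
    and p: "0 < p" and C: "\<And>a h :: 'b. norm (a + h) powr p \<le> norm a powr p + p * norm a powr (p - 2) * inner a h
        + C * (norm a powr (p - 2) * norm h ^2 + norm h powr p)"
  shows "(LINT x:Q|\<mu>. norm (z K x) powr p) \<le> C * (LINT x:Q|\<mu>. (\<Sum>j\<in>{k0..<K}.
      norm (z j x) powr (p - 2) * norm (z (j + 1) x - z j x) ^ 2 + norm (z (j + 1) x - z j x) powr p))"
proof -
  define s where "s k x = (\<Sum>j\<in>{k0..<k}. norm (z j x) powr (p - 2) * norm (z (j + 1) x - z j x) ^ 2
     + norm (z (j + 1) x - z j x) powr p)" for k x
  define \<Phi> where "\<Phi> k x = norm (z k x) powr p - C * s k x" for k x
  define V where "V k x = (p * norm (z k x) powr (p - 2)) *\<^sub>R z k x" for k x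
  have as: "adapted k (s k)" if "k0 \<le> k" for k
    unfolding s_def[abs_def] by (intro adapted_intros mart_adapted[OF z]) (use that in auto)
  have a\<Phi>: "adapted k (\<Phi> k)" if "k0 \<le> k" for k
    unfolding \<Phi>_def[abs_def] using that by (intro adapted_intros as martingale_fromD(1)[OF z])
  have "(LINT x:Q|\<mu>. \<Phi> K x) \<le> 0"
  proof (rule supermartingale_nonpos[OF Q K martingale_fromD(2)[OF z] a\<Phi>, where V = V])
    show "adapted k (V k)" if "k0 \<le> k" for k
      unfolding V_def[abs_def] using that by (intro adapted_intros martingale_fromD(1)[OF z])
    show "\<Phi> (k + 1) x \<le> \<Phi> k x + inner (V k x) (z (k + 1) x - z k x)" if k: "k0 \<le> k" for k x
      using C[of "z k x" "z (k + 1) x - z k x"]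
      by (simp add: \<Phi>_def V_def s_def sum_int_Suc[OF k] distrib_left)
    show "\<Phi> k0 x \<le> 0" for x by (simp add: \<Phi>_def z0 s_def p)
  qed auto
  moreover have "(LINT x:Q|\<mu>. \<Phi> K x) = (LINT x:Q|\<mu>. norm (z K x) powr p) - C * (LINT x:Q|\<mu>. s K x)"
    unfolding \<Phi>_def by (subst set_integral_diff(2))
       (auto intro!: adapted_set_integrable[OF _ Q, of K] adapted_intros as martingale_fromD(1)[OF z] K)
  ultimately show ?thesis by (simp add: s_def)
qed

section \<open>Carleson embedding\<close>

text \<open>The coefficient a is constant on the cubes of generation k and factors out of the
  integral over each of them.\<close>

lemma carleson_step:
  assumes Q: "Q \<in> D j" and "j \<le> k" and a: "adapted k a" "\<And>x. 0 \<le> a x"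
    and T: "adapted K T" "\<And>x. 0 \<le> T x"
    and carl: "\<And>P. P \<in> D k \<Longrightarrow> (LINT x:P|\<mu>. T x powr r) \<le> \<kappa> * measure \<mu> P"
  shows "(LINT x:Q|\<mu>. (a x * T x) powr r) \<le> \<kappa> * (LINT x:Q|\<mu>. a x powr r)"
proof -
  have aK: "adapted (max k K) a" and TK: "adapted (max k K) T"
    by (rule adapted_mono[OF a(1)] adapted_mono[OF T(1)]; simp)+
  have "(LINT x:Q|\<mu>. (a x * T x) powr r) \<le> (LINT x:Q|\<mu>. \<kappa> * a x powr r)"
  proof (rule set_integral_le_by_cubes[OF Q \<open>j \<le> k\<close>])
    show "set_integrable \<mu> Q (\<lambda>x. (a x * T x) powr r)"
      by (rule adapted_set_integrable[OF _ Q, of "max k K"]) (intro adapted_intros aK TK)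
    show "set_integrable \<mu> Q (\<lambda>x. \<kappa> * a x powr r)"
      by (rule adapted_set_integrable[OF _ Q, of "max k K"]) (intro adapted_intros aK)
    fix P assume P: "P \<in> D k"
    then obtain z where z: "z \<in> P" using D_nonempty by blast
    have "(LINT x:P|\<mu>. (a x * T x) powr r) = (LINT x:P|\<mu>. a z powr r * T x powr r)"
    proof (rule set_integral_cong_D[OF P])
      fix x assume "x \<in> P"
      have "a x = a z" by (rule adaptedD[OF a(1) P \<open>x \<in> P\<close> z])
      then show "(a x * T x) powr r = a z powr r * T x powr r" by (simp add: powr_mult)
    qed
    also have "\<dots> = a z powr r * (LINT x:P|\<mu>. T x powr r)" by simp
    also have "\<dots> \<le> a z powr r * (\<kappa> * measure \<mu> P)"
      using carl[OF P] by (intro mult_left_mono) auto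
    also have "\<dots> = (LINT x:P|\<mu>. \<kappa> * a z powr r)"
      by (simp only: set_integral_const_D[OF P] real_scaleR_def mult_ac)
    also have "\<dots> = (LINT x:P|\<mu>. \<kappa> * a x powr r)"
    proof (rule set_integral_cong_D[OF P])
      fix x assume "x \<in> P"
      have "a x = a z" by (rule adaptedD[OF a(1) P \<open>x \<in> P\<close> z])
      then show "\<kappa> * a z powr r = \<kappa> * a x powr r" by simp
    qed
    finally show "(LINT x:P|\<mu>. (a x * T x) powr r) \<le> (LINT x:P|\<mu>. \<kappa> * a x powr r)" .
  qed
  then show ?thesis by simp
qed

text \<open>The sum is estimated by Abel summation along the generations.\<close>

lemma carleson_embedding:
  fixes \<theta> B :: "int \<Rightarrow> real ^ 'd \<Rightarrow> real"
  assumes r: "0 < r" "r \<le> 1" and Q: "Q \<in> D k0" and K: "k0 \<le> K"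
    and \<theta>: "\<And>j. adapted (j + 1) (\<theta> j)" "\<And>j x. 0 \<le> \<theta> j x"
    and B: "\<And>j. k0 \<le> j \<Longrightarrow> adapted j (B j)" "\<And>x. 0 \<le> B k0 x" "\<And>j x. k0 \<le> j \<Longrightarrow> B j x \<le> B (j + 1) x"
    and carl: "\<And>k P. k0 \<le> k \<Longrightarrow> k \<le> K \<Longrightarrow> P \<in> D k \<Longrightarrow>
      (LINT x:P|\<mu>. (\<Sum>j\<in>{k..<K}. \<theta> j x) powr r) \<le> \<kappa> * measure \<mu> P"
  shows "(LINT x:Q|\<mu>. (\<Sum>j\<in>{k0..<K}. B j x * \<theta> j x) powr r)
    \<le> \<kappa> * (LINT x:Q|\<mu>. B k0 x powr r + (\<Sum>j\<in>{k0..<K}. (B (j + 1) x - B j x) powr r))"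
proof -
  define T where "T k x = (\<Sum>j\<in>{k..<K}. \<theta> j x)" for k x
  define X where "X k x = (\<Sum>j\<in>{k0..<k}. B j x * \<theta> j x) + B k x * T k x" for k x
  define Y where "Y k x = B k0 x powr r + (\<Sum>j\<in>{k0..<k}. (B (j + 1) x - B j x) powr r)" for k x
  have Bad: "adapted l (B j)" if "k0 \<le> j" "j \<le> l" for j l by (rule adapted_mono[OF B(1)]) (use that in auto)
  have \<theta>ad: "adapted l (\<theta> j)" if "j + 1 \<le> l" for j l by (rule adapted_mono[OF \<theta>(1) that])
  have Tad: "adapted K (T k)" for k unfolding T_def[abs_def] by (intro adapted_intros \<theta>ad) auto
  have T0: "0 \<le> T k x" for k x by (auto simp: T_def intro: sum_nonneg \<theta>(2))
  have B0: "0 \<le> B k x" if "k0 \<le> k" for k x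
    using that by (induction k rule: int_ge_induct) (use B(2,3) order_trans in blast)+
  have Xad: "adapted K (X k)" if "k0 \<le> k" "k \<le> K" for k
    unfolding X_def[abs_def] by (intro adapted_intros Tad Bad \<theta>ad) (use that in auto)
  have Yad: "adapted k (Y k)" if "k0 \<le> k" for k
    unfolding Y_def[abs_def] by (intro adapted_intros Bad) (use that in auto)
  have "k \<le> K \<longrightarrow> (LINT x:Q|\<mu>. X k x powr r) \<le> \<kappa> * (LINT x:Q|\<mu>. Y k x)" if "k0 \<le> k" for k
    using that
  proof (induction k rule: int_ge_induct)
    case base
    show ?case
      using carleson_step[OF Q order_refl B(1)[OF order_refl] B(2) Tad T0, where r = r and \<kappa> = \<kappa>] carl[of k0] K
      by (simp add: X_def Y_def T_def)
  next
    case (step k)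
    show ?case
    proof
      assume kK: "k + 1 \<le> K"
      define b where "b x = B (k + 1) x - B k x" for x
      have bad: "adapted (k + 1) b" unfolding b_def[abs_def] by (intro adapted_intros Bad) (use step.hyps in auto)
      have b0: "0 \<le> b x" for x using B(3)[OF step.hyps] by (simp add: b_def)
      have Tk: "T k x = \<theta> k x + T (k + 1) x" for x
        unfolding T_def using kK by (intro sum_int_head) simp
      \<comment> \<open>Only the weight of the tail changes, by the increment b; subadditivity for r
        \<le> 1 then separates the two terms.\<close>
      have Xk: "X (k + 1) x = X k x + b x * T (k + 1) x" for x
        unfolding X_def sum_int_Suc[OF step.hyps] Tk b_def by (simp add: algebra_simps)
      have X0: "0 \<le> X k x" for x
        unfolding X_def using T0 B0 step.hyps \<theta>(2) by (intro add_nonneg_nonneg sum_nonneg mult_nonneg_nonneg) auto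
      have i1: "set_integrable \<mu> Q (\<lambda>x. X k x powr r)"
        by (rule adapted_set_integrable[OF _ Q, of K]) (intro adapted_powr Xad, use step.hyps kK in auto)
      have i2: "set_integrable \<mu> Q (\<lambda>x. (b x * T (k + 1) x) powr r)"
        by (rule adapted_set_integrable[OF _ Q, of K])
           (intro adapted_intros Tad adapted_mono[OF bad], use kK in auto)
      have i3: "set_integrable \<mu> Q (\<lambda>x. X (k + 1) x powr r)"
        by (rule adapted_set_integrable[OF _ Q, of K]) (intro adapted_powr Xad, use step.hyps kK in auto)
      have "(LINT x:Q|\<mu>. X (k + 1) x powr r) \<le> (LINT x:Q|\<mu>. X k x powr r + (b x * T (k + 1) x) powr r)"
        by (rule set_integral_mono[OF i3 set_integral_add(1)[OF i1 i2]])
           (unfold Xk, rule powr_subadd[OF r X0 mult_nonneg_nonneg[OF b0 T0]])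
      also have "\<dots> = (LINT x:Q|\<mu>. X k x powr r) + (LINT x:Q|\<mu>. (b x * T (k + 1) x) powr r)"
        by (rule set_integral_add(2)[OF i1 i2])
      also have "(LINT x:Q|\<mu>. (b x * T (k + 1) x) powr r) \<le> \<kappa> * (LINT x:Q|\<mu>. b x powr r)"
        by (rule carleson_step[OF Q _ bad b0 Tad T0]) (use carl step.hyps kK in \<open>auto simp: T_def\<close>)
      also have "(LINT x:Q|\<mu>. X k x powr r) \<le> \<kappa> * (LINT x:Q|\<mu>. Y k x)" using step.IH kK by simp
      also have "\<kappa> * (LINT x:Q|\<mu>. Y k x) + \<kappa> * (LINT x:Q|\<mu>. b x powr r) = \<kappa> * (LINT x:Q|\<mu>. Y k x + b x powr r)"
        by (subst set_integral_add(2))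
           (auto simp: distrib_left intro!: adapted_set_integrable[OF Yad[OF step.hyps] Q] adapted_set_integrable[OF adapted_powr[OF bad] Q])
      also have "(\<lambda>x. Y k x + b x powr r) = Y (k + 1)"
        by (auto simp: fun_eq_iff Y_def b_def sum_int_Suc[OF step.hyps])
      finally show "(LINT x:Q|\<mu>. X (k + 1) x powr r) \<le> \<kappa> * (LINT x:Q|\<mu>. Y (k + 1) x)" by simp
    qed
  qed
  from this[OF K] show ?thesis by (simp add: X_def T_def Y_def)
qed

end

subsection \<open>Paraproducts under Carleson conditions\<close>

text \<open>The least power of two that is at least t, or 0 for t \<le> 0. A nondecreasing sequence
  rounded in this way changes only by factors of at least 2, and then the increments of its squares,
  raised to p/2, are dominated by a telescoping sum.\<close>

definition pow2_ceiling :: "real \<Rightarrow> real" where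
  "pow2_ceiling t = (if t \<le> 0 then 0 else 2 powr (of_int \<lceil>log 2 t\<rceil>))"

lemma pow2_ceiling_nonneg: "0 \<le> pow2_ceiling t"
  by (simp add: pow2_ceiling_def)

lemma pow2_ceiling_ge: "t \<le> pow2_ceiling t"
proof (cases "t \<le> 0")
  case False
  then have "t = 2 powr (log 2 t)" by simp
  also have "\<dots> \<le> 2 powr (of_int \<lceil>log 2 t\<rceil>)" by (intro powr_mono) auto
  finally show ?thesis using False by (simp add: pow2_ceiling_def)
qed (simp add: pow2_ceiling_def)

lemma pow2_ceiling_le: "0 \<le> t \<Longrightarrow> pow2_ceiling t \<le> 2 * t"
proof (cases "t \<le> 0")
  case False
  have "of_int \<lceil>log 2 t\<rceil> \<le> log 2 t + 1" by linarith
  then have "2 powr (of_int \<lceil>log 2 t\<rceil>) \<le> (2::real) powr (log 2 t + 1)" by (intro powr_mono) auto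
  also have "\<dots> = 2 * t" using False by (simp add: powr_add)
  finally show ?thesis using False by (simp add: pow2_ceiling_def)
qed (simp add: pow2_ceiling_def)

lemma pow2_ceiling_mono: "s \<le> t \<Longrightarrow> pow2_ceiling s \<le> pow2_ceiling t"
  by (auto simp: pow2_ceiling_def intro!: powr_mono ceiling_mono log_mono)

lemma pow2_ceiling_gap:
  assumes "s \<le> t" "pow2_ceiling s \<noteq> pow2_ceiling t"
  shows "2 * pow2_ceiling s \<le> pow2_ceiling t"
proof (cases "s \<le> 0")
  case False
  then have st: "0 < s" "0 < t" using assms by auto
  have "\<lceil>log 2 s\<rceil> \<le> \<lceil>log 2 t\<rceil>" using st assms by (intro ceiling_mono log_mono) auto
  moreover have "\<lceil>log 2 s\<rceil> \<noteq> \<lceil>log 2 t\<rceil>" using assms(2) st by (auto simp: pow2_ceiling_def)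
  ultimately have "of_int \<lceil>log 2 s\<rceil> + 1 \<le> (of_int \<lceil>log 2 t\<rceil> :: real)" by linarith
  then have "2 powr (of_int \<lceil>log 2 s\<rceil> + 1) \<le> (2::real) powr (of_int \<lceil>log 2 t\<rceil>)" by (intro powr_mono) auto
  then show ?thesis using st by (simp add: pow2_ceiling_def powr_add)
qed (auto simp: pow2_ceiling_def)

text \<open>If the rounded values s and t differ, then 2 s^p \<le> t^p, hence t^p \<le> 2 (t^p -
  s^p); otherwise both sides vanish.\<close>

lemma pow2_ceiling_increment:
  assumes "s \<le> t" "1 \<le> p"
  shows "((pow2_ceiling t)^2 - (pow2_ceiling s)^2) powr (p/2) \<le> 2 * (pow2_ceiling t powr p - pow2_ceiling s powr p)"
proof (cases "pow2_ceiling s = pow2_ceiling t")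
  case False
  let ?s = "pow2_ceiling s" and ?t = "pow2_ceiling t"
  have "2 powr 1 * ?s powr p \<le> 2 powr p * ?s powr p" using assms by (intro mult_right_mono powr_mono) auto
  also have "\<dots> = (2 * ?s) powr p" by (simp add: powr_mult)
  also have "\<dots> \<le> ?t powr p"
    using assms pow2_ceiling_gap[OF assms(1) False] pow2_ceiling_nonneg[of s] by (intro powr_mono2) auto
  finally have "2 * ?s powr p \<le> ?t powr p" by simp
  moreover have "(?t^2 - ?s^2) powr (p/2) \<le> (?t^2) powr (p/2)"
    using assms pow2_ceiling_mono[OF assms(1)] pow2_ceiling_nonneg[of s] by (intro powr_mono2) (auto intro: power_mono)
  moreover have "(?t^2) powr (p/2) = ?t powr p"
    using powr_norm_eq[of ?t p] pow2_ceiling_nonneg[of t] by simp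
  ultimately show ?thesis by simp
qed simp

lemma sum_telescope_int: "k0 \<le> K \<Longrightarrow> (\<Sum>j\<in>{k0..<K}. f (j + 1) - f j) = f K - f k0" for f :: "int \<Rightarrow> real"
  by (induction K rule: int_ge_induct) (simp_all add: sum_int_Suc)

context dyadic begin

definition locally_integrable :: "(real ^ 'd \<Rightarrow> 'b::{banach, second_countable_topology}) \<Rightarrow> bool" where
  "locally_integrable f \<longleftrightarrow> (\<forall>k. \<forall>Q\<in>D k. set_integrable \<mu> Q f)"

definition mdiff :: "(real ^ 'd \<Rightarrow> 'b::{banach, second_countable_topology}) \<Rightarrow> int \<Rightarrow> real ^ 'd \<Rightarrow> 'b" where
  "mdiff b k x = cond_exp (k + 1) b x - cond_exp k b x"

lemma martingale_increment_mdiff: "locally_integrable b \<Longrightarrow> martingale_increment k (mdiff b k)"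
  unfolding mdiff_def[abs_def] by (rule martingale_increment_cond_exp) (auto simp: locally_integrable_def)

lemma adapted_mdiff: "k + 1 \<le> l \<Longrightarrow> adapted l (mdiff b k)"
  unfolding mdiff_def[abs_def] by (intro adapted_diff adapted_cond_exp) auto

lemma mart_cond_exp: "locally_integrable f \<Longrightarrow> martingale_from k0 (\<lambda>k. cond_exp k f)"
  using martingale_increment_mdiff[of f] by (auto simp: martingale_from_def mdiff_def[abs_def] intro: adapted_cond_exp)

text \<open>Each point lies in one cube per generation, so the functions |D_Q b|^s 1_Q with Q in G
  become a sequence indexed by generations.\<close>

definition energy :: "real \<Rightarrow> (real ^ 'd) set set \<Rightarrow> (real ^ 'd \<Rightarrow> 'b::{banach, second_countable_topology}) \<Rightarrow> int \<Rightarrow> real ^ 'd \<Rightarrow> real" where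
  "energy s G b k x = (if cube k x \<in> G then norm (mdiff b k x) powr s else 0)"

lemma energy_nonneg: "0 \<le> energy s G b k x"
  by (simp add: energy_def)

lemma adapted_energy: "k + 1 \<le> l \<Longrightarrow> adapted l (energy s G b k)"
proof -
  assume "k + 1 \<le> l"
  then have "adapted l (\<lambda>x. of_bool (cube k x \<in> G) * norm (mdiff b k x) powr s)"
    by (intro adapted_intros adapted_cube[where F="\<lambda>Q. of_bool (Q \<in> G)"] adapted_mdiff) auto
  moreover have "(\<lambda>x. of_bool (cube k x \<in> G) * norm (mdiff b k x) powr s) = energy s G b k"
    by (auto simp: energy_def fun_eq_iff)
  ultimately show ?thesis by (simp only:)
qed

text \<open>For s = 2 and r = 1 this is the classical packing condition for |D_Q b|^2. The upper
  generation K keeps the sums finite while \<kappa> is uniform in it; P ranges over all cubes,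
  inside or outside G.\<close>

definition carleson :: "real \<Rightarrow> real \<Rightarrow> (real ^ 'd) set set \<Rightarrow> (real ^ 'd \<Rightarrow> 'b::{banach, second_countable_topology}) \<Rightarrow> real \<Rightarrow> bool" where
  "carleson s r G b \<kappa> \<longleftrightarrow> (\<forall>k K P. k \<le> K \<longrightarrow> P \<in> D k \<longrightarrow>
     (LINT x:P|\<mu>. (\<Sum>j\<in>{k..<K}. energy s G b j x) powr r) \<le> \<kappa> * measure \<mu> P)"

text \<open>Exponents for which the energy of the martingale differences is controlled by the
  \<open>q\<close>-th power of the oscillation: \<open>s = 2\<close>, \<open>r = q/2\<close> is the square function, while for
  \<open>q \<ge> 2\<close> the larger powers \<open>s = q\<close> suffice.\<close>

definition admissible :: "real \<Rightarrow> real \<Rightarrow> real \<Rightarrow> bool" where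
  "admissible q s r \<longleftrightarrow> 1 < q \<and> (q \<le> 2 \<and> s = 2 \<and> r = q/2 \<or> 2 \<le> q \<and> s = q \<and> r = 1)"

text \<open>The sum of the constants of \<open>sq_fun_le_mart\<close> and
  \<open>sum_incr_powr_le_mart\<close>, so that one expression covers both kinds of admissible
  exponents.\<close>

definition energy_const :: "real \<Rightarrow> real" where
  "energy_const q = 160/(q - 1) + 2 powr (q - 1)"

text \<open>The energies are powers of increments of E_j b - <b>_Q, which is 0 on Q at the start;
  restriction to G only lowers their sum. Martingale inequalities bound it by the final value E_K b
  - <b>_Q, and Jensen passes to b itself.\<close>

lemma energy_le_oscillation:
  fixes b :: "real ^ 'd \<Rightarrow> 'b::euclidean_space"
  assumes adm: "admissible q s r" and b: "locally_integrable b" and Q: "Q \<in> D k" and K: "k \<le> K"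
    and bq: "set_integrable \<mu> Q (\<lambda>x. norm (b x - average \<mu> b Q) powr q)"
  shows "(LINT x:Q|\<mu>. (\<Sum>j\<in>{k..<K}. energy s G b j x) powr r)
    \<le> energy_const q * (LINT x:Q|\<mu>. norm (b x - average \<mu> b Q) powr q)"
proof -
  have q: "1 < q" using adm by (simp add: admissible_def)
  define z where "z j x = cond_exp j b x - cond_exp k b x" for j x
  have z: "martingale_from k z" unfolding martingale_from_def
  proof (intro allI impI conjI)
    fix j assume "k \<le> j"
    then show "adapted j (z j)" unfolding z_def[abs_def] by (intro adapted_diff adapted_cond_exp) auto
    have "(\<lambda>x. z (j + 1) x - z j x) = mdiff b j" by (auto simp: z_def mdiff_def)
    then show "martingale_increment j (\<lambda>x. z (j + 1) x - z j x)" using martingale_increment_mdiff[OF b] by simp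
  qed
  have z0: "z k x = 0" for x by (simp add: z_def)
  have dz: "z (j + 1) x - z j x = mdiff b j x" for j x by (simp add: z_def mdiff_def)
  let ?I = "LINT x:Q|\<mu>. norm (b x - average \<mu> b Q) powr q"
  have "(LINT x:Q|\<mu>. norm (z K x) powr q) = (LINT x:Q|\<mu>. norm (cond_exp K b x - average \<mu> b Q) powr q)"
    by (rule set_integral_cong_D[OF Q]) (simp add: z_def cond_exp_eq[OF Q])
  also have "\<dots> \<le> ?I"
    by (rule jensen_cond_exp[OF q Q K _ bq]) (use b Q in \<open>auto simp: locally_integrable_def\<close>)
  finally have zI: "(LINT x:Q|\<mu>. norm (z K x) powr q) \<le> ?I" .
  have r: "0 < r" using adm by (auto simp: admissible_def)
  have "(LINT x:Q|\<mu>. (\<Sum>j\<in>{k..<K}. energy s G b j x) powr r)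
      \<le> (LINT x:Q|\<mu>. (\<Sum>j\<in>{k..<K}. norm (z (j + 1) x - z j x) powr s) powr r)"
  proof (rule set_integral_mono)
    show "set_integrable \<mu> Q (\<lambda>x. (\<Sum>j\<in>{k..<K}. energy s G b j x) powr r)"
      by (rule adapted_set_integrable[OF _ Q, of K]) (intro adapted_intros adapted_energy, auto)
    show "set_integrable \<mu> Q (\<lambda>x. (\<Sum>j\<in>{k..<K}. norm (z (j + 1) x - z j x) powr s) powr r)"
      unfolding dz by (rule adapted_set_integrable[OF _ Q, of K]) (intro adapted_intros adapted_mdiff, auto)
    show "(\<Sum>j\<in>{k..<K}. energy s G b j x) powr r \<le> (\<Sum>j\<in>{k..<K}. norm (z (j + 1) x - z j x) powr s) powr r" for x
      unfolding dz using r by (intro powr_mono2 sum_mono sum_nonneg) (auto simp: energy_def)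
  qed
  also have "\<dots> \<le> energy_const q * (LINT x:Q|\<mu>. norm (z K x) powr q)"
  proof -
    have I0: "0 \<le> (LINT x:Q|\<mu>. norm (z K x) powr q)"
      unfolding set_lebesgue_integral_def by (intro Bochner_Integration.integral_nonneg) auto
    from adm consider "q \<le> 2" "s = 2" "r = q/2" | "2 \<le> q" "s = q" "r = 1" by (auto simp: admissible_def)
    then show ?thesis
    proof cases
      case 1
      have "(LINT x:Q|\<mu>. (\<Sum>j\<in>{k..<K}. norm (z (j + 1) x - z j x) powr s) powr r) = (LINT x:Q|\<mu>. sq_fun k z K x powr (q/2))"
        by (rule set_integral_cong_D[OF Q]) (simp add: 1 sq_fun_def)
      also have "\<dots> \<le> 160/(q - 1) * (LINT x:Q|\<mu>. norm (z K x) powr q)"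
        by (rule sq_fun_le_mart[OF q 1(1) z z0 Q K])
      also have "\<dots> \<le> energy_const q * (LINT x:Q|\<mu>. norm (z K x) powr q)"
        by (rule mult_right_mono[OF _ I0]) (simp add: energy_const_def)
      finally show ?thesis .
    next
      case 2
      have "(LINT x:Q|\<mu>. (\<Sum>j\<in>{k..<K}. norm (z (j + 1) x - z j x) powr s) powr r)
         = (LINT x:Q|\<mu>. (\<Sum>j\<in>{k..<K}. norm (z (j + 1) x - z j x) powr q))"
        by (rule set_integral_cong_D[OF Q]) (simp add: 2 sum_nonneg)
      also have "\<dots> \<le> 2 powr (q - 1) * (LINT x:Q|\<mu>. norm (z K x) powr q)"
        by (rule sum_incr_powr_le_mart[OF 2(1) z z0 Q K])
      also have "\<dots> \<le> energy_const q * (LINT x:Q|\<mu>. norm (z K x) powr q)"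
        by (rule mult_right_mono[OF _ I0]) (use q in \<open>simp add: energy_const_def\<close>)
      finally show ?thesis .
    qed
  qed
  also have "\<dots> \<le> energy_const q * ?I"
    by (rule mult_left_mono[OF zI]) (use q in \<open>simp add: energy_const_def\<close>)
  finally show ?thesis .
qed

section \<open>Martingale transforms with the averages of f\<close>

text \<open>For fixed k0 and locally integrable b this is a martingale in k, the transform of the
  increments of b by coefficients that are constant on the cubes of their generation.\<close>

definition partial_paraproduct ::
  "(real ^ 'd) set set \<Rightarrow> (real ^ 'd \<Rightarrow> 'b::{real_normed_field, euclidean_space}) \<Rightarrow> (real ^ 'd \<Rightarrow> 'b) \<Rightarrow>
    int \<Rightarrow> int \<Rightarrow> real ^ 'd \<Rightarrow> 'b" where
  "partial_paraproduct G b f k0 k x =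
    (\<Sum>j\<in>{k0..<k}. (if cube j x \<in> G then cond_exp j f x else 0) * mdiff b j x)"

lemma adapted_paraproduct_coeff:
  "k \<le> l \<Longrightarrow> adapted l (\<lambda>x. if cube k x \<in> G then cond_exp k f x else (0::'b::{real_normed_field, euclidean_space}))"
  unfolding cond_exp_def using adapted_cube[of k l "\<lambda>Q. if Q \<in> G then average \<mu> f Q else 0"] .

lemma adapted_partial_paraproduct: "adapted k (partial_paraproduct G b f k0 k)"
  unfolding partial_paraproduct_def[abs_def]
  by (intro adapted_intros adapted_paraproduct_coeff adapted_mdiff) auto

context
  fixes b f :: "real ^ 'd \<Rightarrow> 'b::{real_normed_field, euclidean_space}" and G :: "(real ^ 'd) set set" and k0 K :: int and Q :: "(real ^ 'd) set" and p :: real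
  assumes b: "locally_integrable b" and f: "locally_integrable f"
    and Q: "Q \<in> D k0" and K: "k0 \<le> K" and p: "1 < p"
    and fp: "set_integrable \<mu> Q (\<lambda>x. norm (f x) powr p)"
begin

private abbreviation "z \<equiv> partial_paraproduct G b f k0"
private abbreviation "m \<equiv> max_fun k0 (\<lambda>k. cond_exp k f)"

lemma partial_paraproduct_diff: "k0 \<le> k \<Longrightarrow> z (k + 1) x - z k x = (if cube k x \<in> G then cond_exp k f x else 0) * mdiff b k x"
  by (simp add: partial_paraproduct_def sum_int_Suc)

lemma partial_paraproduct_base: "z k0 x = 0"
  by (simp add: partial_paraproduct_def)

lemma martingale_partial_paraproduct: "martingale_from k0 z"
  unfolding martingale_from_def
proof (intro allI impI conjI)
  fix k assume k: "k0 \<le> k"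
  show "adapted k (z k)" by (rule adapted_partial_paraproduct)
  show "martingale_increment k (\<lambda>x. z (k + 1) x - z k x)"
    unfolding partial_paraproduct_diff[OF k] by (intro martingale_increment_mult martingale_increment_mdiff b adapted_paraproduct_coeff) auto
qed

text \<open>The maximal function m k is constant on cubes of generation k and nondecreasing in k, as
  a weight in \<open>carleson_embedding\<close> has to be; the averages of f are not
  monotone.\<close>

lemma partial_paraproduct_diff_norm: "k0 \<le> k \<Longrightarrow> 0 < s \<Longrightarrow> norm (z (k + 1) x - z k x) powr s \<le> m k x powr s * energy s G b k x"
  unfolding partial_paraproduct_diff norm_mult powr_mult energy_def
  using norm_le_max_fun[of k0 k k "\<lambda>k. cond_exp k f" x]
  by (auto intro!: mult_right_mono powr_mono2)

lemma max_fun_bound: "(LINT x:Q|\<mu>. m K x powr p) \<le> 2 powr p / (p - 1) * (LINT x:Q|\<mu>. norm (f x) powr p)"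
proof -
  have "(LINT x:Q|\<mu>. m K x powr p) \<le> 2 powr p / (p - 1) * (LINT x:Q|\<mu>. norm (cond_exp K f x) powr p)"
    by (rule doob[OF p mart_cond_exp[OF f] Q K])
  also have "(LINT x:Q|\<mu>. norm (cond_exp K f x) powr p) \<le> (LINT x:Q|\<mu>. norm (f x) powr p)"
    using jensen_cond_exp[OF p Q K, of f 0] fp f Q by (simp add: locally_integrable_def)
  then have "2 powr p / (p - 1) * (LINT x:Q|\<mu>. norm (cond_exp K f x) powr p) \<le> 2 powr p / (p - 1) * (LINT x:Q|\<mu>. norm (f x) powr p)"
    by (rule mult_left_mono) (use p in auto)
  finally show ?thesis .
qed

lemma adapted_max_cond_exp: "k0 \<le> k \<Longrightarrow> k \<le> l \<Longrightarrow> adapted l (m k)"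
  by (rule adapted_max_fun[OF mart_cond_exp[OF f]])

lemma max_cond_exp_nonneg: "k0 \<le> k \<Longrightarrow> 0 \<le> m k x"
  by (rule max_fun_nonneg)

lemma max_cond_exp_mono: "k0 \<le> k \<Longrightarrow> m k x \<le> m (k + 1) x"
  by (rule max_fun_mono) auto

text \<open>The square function of z is a sum of energies with weights at most m^2. The weight is
  enlarged to the square of the rounded maximal function, whose increments to the power p/2 are
  controlled by telescoping; the embedding and Doob's inequality conclude.\<close>

lemma partial_paraproduct_bound_le_2:
  assumes "p \<le> 2" and carl: "carleson 2 (p/2) G b \<kappa>" and \<kappa>: "0 \<le> \<kappa>"
  shows "(LINT x:Q|\<mu>. norm (z K x) powr p) \<le> 80 * 8 powr p / (p - 1) * \<kappa> * (LINT x:Q|\<mu>. norm (f x) powr p)"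
proof -
  define A where "A k x = pow2_ceiling (m k x)" for k x
  have aA: "adapted l (A k)" if "k0 \<le> k" "k \<le> l" for k l
    unfolding A_def[abs_def] by (rule adapted_compose[OF adapted_max_cond_exp[OF that]])
  have A0: "0 \<le> A k x" for k x by (simp add: A_def pow2_ceiling_nonneg)
  have Am: "A k x \<le> A (k + 1) x" if "k0 \<le> k" for k x
    unfolding A_def by (rule pow2_ceiling_mono[OF max_cond_exp_mono[OF that]])
  have "(LINT x:Q|\<mu>. norm (z K x) powr p) \<le> 40 * (LINT x:Q|\<mu>. sq_fun k0 z K x powr (p/2))"
    by (rule mart_le_sq_fun[OF p assms(1) martingale_partial_paraproduct partial_paraproduct_base Q K])
  also have "(LINT x:Q|\<mu>. sq_fun k0 z K x powr (p/2)) \<le> (LINT x:Q|\<mu>. (\<Sum>j\<in>{k0..<K}. A j x ^ 2 * energy 2 G b j x) powr (p/2))"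
  proof (rule set_integral_mono)
    show "set_integrable \<mu> Q (\<lambda>x. sq_fun k0 z K x powr (p/2))"
      by (rule adapted_set_integrable[OF adapted_powr[OF adapted_sq_fun[OF martingale_partial_paraproduct K]] Q])
    show "set_integrable \<mu> Q (\<lambda>x. (\<Sum>j\<in>{k0..<K}. A j x ^ 2 * energy 2 G b j x) powr (p/2))"
      by (rule adapted_set_integrable[OF _ Q, of K]) (intro adapted_intros aA adapted_energy, auto)
    show "sq_fun k0 z K x powr (p/2) \<le> (\<Sum>j\<in>{k0..<K}. A j x ^ 2 * energy 2 G b j x) powr (p/2)" for x
    proof (rule powr_mono2)
      show "sq_fun k0 z K x \<le> (\<Sum>j\<in>{k0..<K}. A j x ^ 2 * energy 2 G b j x)"
        unfolding sq_fun_def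
      proof (rule sum_mono)
        fix j assume j: "j \<in> {k0..<K}"
        have "norm (z (j + 1) x - z j x) ^ 2 \<le> m j x ^ 2 * energy 2 G b j x"
          using partial_paraproduct_diff_norm[of j 2 x] j max_cond_exp_nonneg[of j x] by simp
        also have "\<dots> \<le> A j x ^ 2 * energy 2 G b j x"
          using max_cond_exp_nonneg[of j x] j pow2_ceiling_ge[of "m j x"] by (intro mult_right_mono power_mono) (auto simp: A_def energy_nonneg)
        finally show "norm (z (j + 1) x - z j x) ^ 2 \<le> A j x ^ 2 * energy 2 G b j x" .
      qed
    qed (use p in \<open>auto simp: sq_fun_nonneg\<close>)
  qed
  also have "\<dots> \<le> \<kappa> * (LINT x:Q|\<mu>. (A k0 x ^ 2) powr (p/2) + (\<Sum>j\<in>{k0..<K}. (A (j + 1) x ^ 2 - A j x ^ 2) powr (p/2)))"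
  proof (rule carleson_embedding[OF _ _ Q K])
    show "A j x ^ 2 \<le> A (j + 1) x ^ 2" if "k0 \<le> j" for j x
      using Am[OF that] A0 by (intro power_mono) auto
    show "adapted j (\<lambda>x. A j x ^ 2)" if "k0 \<le> j" for j by (intro adapted_intros aA that order_refl)
    show "(LINT x:P|\<mu>. (\<Sum>j\<in>{k..<K}. energy 2 G b j x) powr (p/2)) \<le> \<kappa> * measure \<mu> P" if "k \<le> K" "P \<in> D k" for k P
      using carl that by (simp add: carleson_def)
    show "adapted (j + 1) (energy 2 G b j)" for j by (rule adapted_energy[OF order_refl])
  qed (use p assms(1) energy_nonneg in auto)
  also have "(LINT x:Q|\<mu>. (A k0 x ^ 2) powr (p/2) + (\<Sum>j\<in>{k0..<K}. (A (j + 1) x ^ 2 - A j x ^ 2) powr (p/2)))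
      \<le> (LINT x:Q|\<mu>. 2 * 2 powr p * m K x powr p)"
  proof (rule set_integral_mono)
    show "set_integrable \<mu> Q (\<lambda>x. (A k0 x ^ 2) powr (p/2) + (\<Sum>j\<in>{k0..<K}. (A (j + 1) x ^ 2 - A j x ^ 2) powr (p/2)))"
      by (rule adapted_set_integrable[OF _ Q, of K]) (intro adapted_intros aA, use K in auto)
    show "set_integrable \<mu> Q (\<lambda>x. 2 * 2 powr p * m K x powr p)"
      by (rule adapted_set_integrable[OF _ Q, of K]) (intro adapted_intros adapted_max_cond_exp K order_refl)
    fix x
    have "(A k0 x ^ 2) powr (p/2) = A k0 x powr p"
      using powr_norm_eq[of "A k0 x" p] A0[of k0 x] by simp
    moreover have "(\<Sum>j\<in>{k0..<K}. (A (j + 1) x ^ 2 - A j x ^ 2) powr (p/2)) \<le> (\<Sum>j\<in>{k0..<K}. 2 * A (j + 1) x powr p - 2 * A j x powr p)"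
      using pow2_ceiling_increment[OF max_cond_exp_mono, of _ p x] p by (intro sum_mono) (auto simp: A_def)
    moreover have "(\<Sum>j\<in>{k0..<K}. 2 * A (j + 1) x powr p - 2 * A j x powr p) = 2 * A K x powr p - 2 * A k0 x powr p"
      by (rule sum_telescope_int[OF K])
    moreover have "A K x powr p \<le> (2 * m K x) powr p"
      using p A0[of K x] pow2_ceiling_le[OF max_cond_exp_nonneg[OF K, of x]] by (intro powr_mono2) (auto simp: A_def)
    then have "2 * A K x powr p \<le> 2 * 2 powr p * m K x powr p" by (simp add: powr_mult)
    moreover have "0 \<le> A k0 x powr p" by simp
    ultimately show "(A k0 x ^ 2) powr (p/2) + (\<Sum>j\<in>{k0..<K}. (A (j + 1) x ^ 2 - A j x ^ 2) powr (p/2)) \<le> 2 * 2 powr p * m K x powr p"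
      by linarith
  qed
  also have "(LINT x:Q|\<mu>. 2 * 2 powr p * m K x powr p) = 2 * 2 powr p * (LINT x:Q|\<mu>. m K x powr p)" by simp
  also have "\<dots> \<le> 2 * 2 powr p * (2 powr p / (p - 1) * (LINT x:Q|\<mu>. norm (f x) powr p))"
    by (rule mult_left_mono[OF max_fun_bound]) simp
  finally have "(LINT x:Q|\<mu>. norm (z K x) powr p) \<le> 40 * (\<kappa> * (2 * 2 powr p * (2 powr p / (p - 1) * (LINT x:Q|\<mu>. norm (f x) powr p))))"
    using \<kappa> by (auto simp: mult_left_mono)
  also have "\<dots> = (2 powr p * 2 powr p) * (80 / (p - 1) * \<kappa> * (LINT x:Q|\<mu>. norm (f x) powr p))" by simp
  also have "\<dots> \<le> 8 powr p * (80 / (p - 1) * \<kappa> * (LINT x:Q|\<mu>. norm (f x) powr p))"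
  proof (rule mult_right_mono)
    show "2 powr p * 2 powr p \<le> (8::real) powr p"
      using p by (simp flip: powr_mult) (intro powr_mono2; simp)
    have "0 \<le> (LINT x:Q|\<mu>. norm (f x) powr p)"
      unfolding set_lebesgue_integral_def by (intro Bochner_Integration.integral_nonneg) auto
    then show "0 \<le> 80 / (p - 1) * \<kappa> * (LINT x:Q|\<mu>. norm (f x) powr p)" using p \<kappa> by simp
  qed
  finally show ?thesis by (simp add: mult_ac)
qed

text \<open>Here z occurs in its own weight |z|^(p-2) m^2, which is bounded through the running
  maximum y of z. Young splits it into a small multiple of y^p, absorbed by Doob, and a multiple of
  m^p. Carleson constants \<delta>^2 and \<delta>^p make both contributions scale as
  \<delta>^p.\<close>

lemma partial_paraproduct_bound_gt_2:
  assumes p2: "2 < p" and \<delta>: "0 < \<delta>"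
    and carl2: "carleson 2 1 G b (\<delta>^2)" and carlp: "carleson p 1 G b (\<delta> powr p)"
    and C: "0 < C" "\<And>a h :: 'b. norm (a + h) powr p \<le> norm a powr p + p * norm a powr (p - 2) * inner a h
        + C * (norm a powr (p - 2) * norm h ^2 + norm h powr p)"
  shows "(LINT x:Q|\<mu>. norm (z K x) powr p) \<le>
    2 * C * ((2 * C * (2 powr p / (p - 1))) powr ((p - 2)/2) + 1) * (2 powr p / (p - 1)) * \<delta> powr p * (LINT x:Q|\<mu>. norm (f x) powr p)"
proof -
  define y where "y = max_fun k0 z"
  define L where "L = 2 powr p / (p - 1)"
  have L: "0 < L" using p by (simp add: L_def)
  \<comment> \<open>Chosen so that C e L = 1/2: absorption then leaves half of the left-hand
    side.\<close>
  define e where "e = 1 / (2 * C * L)"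
  have e: "0 < e" using C L by (simp add: e_def)
  define E where "E = (1/e) powr ((p - 2)/2)"
  have E: "0 \<le> E" by (simp add: E_def)
  have ay: "adapted l (y k)" if "k0 \<le> k" "k \<le> l" for k l
    unfolding y_def by (rule adapted_max_fun[OF martingale_partial_paraproduct that])
  have y0: "0 \<le> y k x" if "k0 \<le> k" for k x unfolding y_def by (rule max_fun_nonneg[OF that])
  have y_mono: "y k x \<le> y (k + 1) x" if "k0 \<le> k" for k x unfolding y_def by (rule max_fun_mono) (use that in auto)
  have az: "adapted l (z k)" if "k0 \<le> k" "k \<le> l" for k l by (rule mart_adapted[OF martingale_partial_paraproduct that])
  \<comment> \<open>Running maxima replace the current values because the weights in the embedding
    must be nondecreasing in the generation.\<close>
  define B1 where "B1 k x = y k x powr (p - 2) * m k x ^ 2" for k x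
  define B2 where "B2 k x = m k x powr p" for k x
  have aB1: "adapted l (B1 k)" if "k0 \<le> k" "k \<le> l" for k l
    unfolding B1_def[abs_def] by (intro adapted_intros ay adapted_max_cond_exp that)
  have aB2: "adapted l (B2 k)" if "k0 \<le> k" "k \<le> l" for k l
    unfolding B2_def[abs_def] by (intro adapted_intros ay adapted_max_cond_exp that)
  have B10: "0 \<le> B1 k x" for k x by (simp add: B1_def)
  have B20: "0 \<le> B2 k x" for k x by (simp add: B2_def)
  have B1m: "B1 k x \<le> B1 (k + 1) x" if "k0 \<le> k" for k x unfolding B1_def
    using y_mono[OF that, of x] max_cond_exp_mono[OF that, of x] y0[OF that, of x] max_cond_exp_nonneg[OF that, of x] p2
    by (intro mult_mono powr_mono2 power_mono) auto
  have B2m: "B2 k x \<le> B2 (k + 1) x" if "k0 \<le> k" for k x unfolding B2_def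
    using max_cond_exp_mono[OF that, of x] max_cond_exp_nonneg[OF that, of x] p2 by (intro powr_mono2) auto
  \<comment> \<open>With r = 1 the increments of a nondecreasing weight telescope to its final
    value.\<close>
  have embed: "(LINT x:Q|\<mu>. (\<Sum>j\<in>{k0..<K}. B j x * energy s G b j x)) \<le> \<kappa> * (LINT x:Q|\<mu>. B K x)"
    if carl: "carleson s 1 G b \<kappa>" and aB: "\<And>k l. k0 \<le> k \<Longrightarrow> k \<le> l \<Longrightarrow> adapted l (B k)"
      and B0: "\<And>k x. 0 \<le> B k x" and Bm: "\<And>k x. k0 \<le> k \<Longrightarrow> B k x \<le> B (k + 1) x" for B s \<kappa>
  proof -
    have "(LINT x:Q|\<mu>. (\<Sum>j\<in>{k0..<K}. B j x * energy s G b j x) powr 1)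
       \<le> \<kappa> * (LINT x:Q|\<mu>. B k0 x powr 1 + (\<Sum>j\<in>{k0..<K}. (B (j + 1) x - B j x) powr 1))"
    proof (rule carleson_embedding[OF _ _ Q K])
      show "(LINT x:P|\<mu>. (\<Sum>j\<in>{k..<K}. energy s G b j x) powr 1) \<le> \<kappa> * measure \<mu> P" if "k \<le> K" "P \<in> D k" for k P
        using carl that by (simp add: carleson_def)
      show "adapted (j + 1) (energy s G b j)" for j by (rule adapted_energy[OF order_refl])
    qed (use aB B0 Bm energy_nonneg in auto)
    also have "(LINT x:Q|\<mu>. (\<Sum>j\<in>{k0..<K}. B j x * energy s G b j x) powr 1) = (LINT x:Q|\<mu>. (\<Sum>j\<in>{k0..<K}. B j x * energy s G b j x))"
      by (intro set_integral_cong_D[OF Q] powr_one sum_nonneg mult_nonneg_nonneg B0 energy_nonneg)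
    also have "(LINT x:Q|\<mu>. B k0 x powr 1 + (\<Sum>j\<in>{k0..<K}. (B (j + 1) x - B j x) powr 1)) = (LINT x:Q|\<mu>. B K x)"
    proof (rule set_integral_cong_D[OF Q])
      fix x
      have "(\<Sum>j\<in>{k0..<K}. (B (j + 1) x - B j x) powr 1) = (\<Sum>j\<in>{k0..<K}. B (j + 1) x - B j x)"
        by (intro sum.cong refl powr_one) (use Bm in auto)
      also have "\<dots> = B K x - B k0 x" by (rule sum_telescope_int[OF K])
      finally show "B k0 x powr 1 + (\<Sum>j\<in>{k0..<K}. (B (j + 1) x - B j x) powr 1) = B K x"
        using B0[of k0 x] by simp
    qed
    finally show ?thesis .
  qed
  let ?S = "\<lambda>x. \<Sum>j\<in>{k0..<K}. norm (z j x) powr (p - 2) * norm (z (j + 1) x - z j x) ^ 2 + norm (z (j + 1) x - z j x) powr p"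
  let ?S1 = "\<lambda>x. \<Sum>j\<in>{k0..<K}. B1 j x * energy 2 G b j x" and ?S2 = "\<lambda>x. \<Sum>j\<in>{k0..<K}. B2 j x * energy p G b j x"
  have i1: "set_integrable \<mu> Q ?S1"
    by (rule adapted_set_integrable[OF _ Q, of K]) (intro adapted_intros aB1 adapted_energy, auto)
  have i2: "set_integrable \<mu> Q ?S2"
    by (rule adapted_set_integrable[OF _ Q, of K]) (intro adapted_intros aB2 adapted_energy, auto)
  have "(LINT x:Q|\<mu>. ?S x) \<le> (LINT x:Q|\<mu>. ?S1 x + ?S2 x)"
  proof (rule set_integral_mono[OF _ set_integral_add(1)[OF i1 i2]])
    show "set_integrable \<mu> Q ?S"
      by (rule adapted_set_integrable[OF _ Q, of K]) (intro adapted_intros az, auto)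
    fix x
    show "?S x \<le> ?S1 x + ?S2 x"
      unfolding sum.distrib[symmetric]
    proof (rule sum_mono)
      fix j assume j: "j \<in> {k0..<K}"
      then have j0: "k0 \<le> j" by simp
      have "norm (z j x) powr (p - 2) \<le> y j x powr (p - 2)"
        unfolding y_def by (rule powr_mono2) (use p2 norm_le_max_fun[of k0 j j z x] j0 in auto)
      moreover have "norm (z (j + 1) x - z j x) ^ 2 \<le> m j x ^ 2 * energy 2 G b j x"
        using partial_paraproduct_diff_norm[OF j0, of 2 x] max_cond_exp_nonneg[OF j0, of x] by simp
      ultimately have "norm (z j x) powr (p - 2) * norm (z (j + 1) x - z j x) ^ 2 \<le> y j x powr (p - 2) * (m j x ^ 2 * energy 2 G b j x)"
        by (intro mult_mono) auto
      moreover have "norm (z (j + 1) x - z j x) powr p \<le> B2 j x * energy p G b j x"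
        unfolding B2_def by (rule partial_paraproduct_diff_norm[OF j0]) (use p in auto)
      ultimately show "norm (z j x) powr (p - 2) * norm (z (j + 1) x - z j x) ^ 2 + norm (z (j + 1) x - z j x) powr p
         \<le> B1 j x * energy 2 G b j x + B2 j x * energy p G b j x" by (simp add: B1_def mult.assoc)
    qed
  qed
  also have "\<dots> = (LINT x:Q|\<mu>. ?S1 x) + (LINT x:Q|\<mu>. ?S2 x)" by (rule set_integral_add(2)[OF i1 i2])
  also have "\<dots> \<le> \<delta>^2 * (LINT x:Q|\<mu>. B1 K x) + \<delta> powr p * (LINT x:Q|\<mu>. B2 K x)"
    by (intro add_mono embed carl2 carlp aB1 aB2 B10 B20 B1m B2m)
  also have "\<dots> = (LINT x:Q|\<mu>. \<delta>^2 * B1 K x + \<delta> powr p * B2 K x)"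
    by (subst set_integral_add(2))
       (auto intro!: set_integrable_mult_right adapted_set_integrable[OF aB1[OF K order_refl] Q] adapted_set_integrable[OF aB2[OF K order_refl] Q])
  also have "\<dots> \<le> (LINT x:Q|\<mu>. e * y K x powr p + (E + 1) * \<delta> powr p * m K x powr p)"
  proof (rule set_integral_mono)
    show "set_integrable \<mu> Q (\<lambda>x. \<delta>^2 * B1 K x + \<delta> powr p * B2 K x)"
      by (rule adapted_set_integrable[OF _ Q, of K]) (intro adapted_intros aB1 aB2 K order_refl)
    show "set_integrable \<mu> Q (\<lambda>x. e * y K x powr p + (E + 1) * \<delta> powr p * m K x powr p)"
      by (rule adapted_set_integrable[OF _ Q, of K]) (intro adapted_intros ay adapted_max_cond_exp K order_refl)
    fix x
    have "y K x powr (p - 2) * (\<delta> * m K x)^2 \<le> e * y K x powr p + E * (\<delta> * m K x) powr p"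
      unfolding E_def using p2 e y0[OF K] max_cond_exp_nonneg[OF K] \<delta> by (intro powr_mult_square_le) auto
    then have "\<delta>^2 * B1 K x \<le> e * y K x powr p + E * (\<delta> powr p * m K x powr p)"
      by (simp add: B1_def power_mult_distrib powr_mult mult_ac)
    then show "\<delta>^2 * B1 K x + \<delta> powr p * B2 K x \<le> e * y K x powr p + (E + 1) * \<delta> powr p * m K x powr p"
      by (simp add: B2_def distrib_right mult.assoc)
  qed
  also have "\<dots> = e * (LINT x:Q|\<mu>. y K x powr p) + (E + 1) * \<delta> powr p * (LINT x:Q|\<mu>. m K x powr p)"
  proof -
    have "set_integrable \<mu> Q (\<lambda>x. e * y K x powr p)" "set_integrable \<mu> Q (\<lambda>x. (E + 1) * \<delta> powr p * m K x powr p)"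
      by (rule adapted_set_integrable[OF _ Q, of K], intro adapted_intros ay adapted_max_cond_exp K order_refl)+
    from set_integral_add(2)[OF this] show ?thesis by simp
  qed
  also have "\<dots> \<le> e * (L * (LINT x:Q|\<mu>. norm (z K x) powr p)) + (E + 1) * \<delta> powr p * (L * (LINT x:Q|\<mu>. norm (f x) powr p))"
  proof (intro add_mono mult_left_mono)
    show "(LINT x:Q|\<mu>. y K x powr p) \<le> L * (LINT x:Q|\<mu>. norm (z K x) powr p)"
      unfolding y_def L_def by (rule doob[OF p martingale_partial_paraproduct Q K])
    show "(LINT x:Q|\<mu>. m K x powr p) \<le> L * (LINT x:Q|\<mu>. norm (f x) powr p)"
      unfolding L_def by (rule max_fun_bound)
  qed (use e E in auto)
  finally have S: "(LINT x:Q|\<mu>. ?S x) \<le> e * (L * (LINT x:Q|\<mu>. norm (z K x) powr p)) + (E + 1) * \<delta> powr p * (L * (LINT x:Q|\<mu>. norm (f x) powr p))" .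
  let ?Z = "LINT x:Q|\<mu>. norm (z K x) powr p" and ?F = "LINT x:Q|\<mu>. norm (f x) powr p"
  have "?Z \<le> C * (LINT x:Q|\<mu>. ?S x)"
    by (rule mart_le_sum_incr[OF martingale_partial_paraproduct partial_paraproduct_base Q K _ C(2)]) (use p in auto)
  also have "\<dots> \<le> C * (e * (L * ?Z) + (E + 1) * \<delta> powr p * (L * ?F))"
    by (rule mult_left_mono[OF S]) (use C in auto)
  also have "\<dots> = (C * e * L) * ?Z + C * (E + 1) * L * \<delta> powr p * ?F" by (simp add: distrib_left)
  also have "C * e * L = 1/2" using C L by (simp add: e_def)
  finally have "?Z \<le> 2 * (C * (E + 1) * L * \<delta> powr p * ?F)" by linarith
  moreover have "1/e = 2 * C * L" by (simp add: e_def)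
  ultimately show ?thesis unfolding E_def L_def by (simp add: mult.assoc)
qed

end

end

subsection \<open>Carleson conditions from vanishing mean oscillation\<close>

text \<open>For r < 1 the integrals of the single \<theta>_i^r may have an infinite sum, so tails
  cannot be estimated term by term. Instead the partial sums S_n along an enumeration increase to a
  limit L, finite almost everywhere, and (L - S_n)^r tends to 0 below the integrable function
  \<psi>.\<close>

lemma small_tails:
  fixes \<theta> :: "'i \<Rightarrow> 'a \<Rightarrow> real"
  assumes H: "countable H" and \<theta>: "\<And>i. i \<in> H \<Longrightarrow> \<theta> i \<in> borel_measurable M" "\<And>i x. 0 \<le> \<theta> i x" and r: "0 < r"
    and B: "\<And>G. finite G \<Longrightarrow> G \<subseteq> H \<Longrightarrow> (\<integral>\<^sup>+x. ennreal ((\<Sum>i\<in>G. \<theta> i x) powr r) \<partial>M) \<le> ennreal B"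
    and \<eta>: "0 < \<eta>"
  shows "\<exists>F\<subseteq>H. finite F \<and> (\<forall>G. finite G \<longrightarrow> G \<subseteq> H - F \<longrightarrow>
     (\<integral>\<^sup>+x. ennreal ((\<Sum>i\<in>G. \<theta> i x) powr r) \<partial>M) \<le> ennreal \<eta>)"
proof (cases "H = {}")
  case False
  define e where "e = from_nat_into H"
  have e: "range e = H" unfolding e_def using False H by (rule range_from_nat_into)
  define Hn where "Hn n = e ` {..<n}" for n
  have Hn: "finite (Hn n)" "Hn n \<subseteq> H" for n using e by (auto simp: Hn_def)
  have Hn_mono: "m \<le> n \<Longrightarrow> Hn m \<subseteq> Hn n" for m n by (auto simp: Hn_def)
  define S where "S n x = (\<Sum>i\<in>Hn n. \<theta> i x)" for n x
  have S_meas [measurable]: "S n \<in> borel_measurable M" for n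
    unfolding S_def[abs_def] using \<theta>(1) Hn(2)[of n] by (intro borel_measurable_sum) auto
  have S0: "0 \<le> S n x" for n x by (auto simp: S_def intro: sum_nonneg \<theta>)
  have S_mono: "m \<le> n \<Longrightarrow> S m x \<le> S n x" for m n x
    unfolding S_def using Hn_mono \<theta>(2) Hn(1) by (intro sum_mono2) auto
  define \<psi> where "\<psi> x = (SUP n. ennreal (S n x powr r))" for x
  have [measurable]: "\<psi> \<in> borel_measurable M" unfolding \<psi>_def[abs_def] by measurable
  have "(\<integral>\<^sup>+x. \<psi> x \<partial>M) = (SUP n. \<integral>\<^sup>+x. ennreal (S n x powr r) \<partial>M)"
    unfolding \<psi>_def
  proof (rule nn_integral_monotone_convergence_SUP)
    show "incseq (\<lambda>n x. ennreal (S n x powr r))"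
      using S_mono S0 r by (auto simp: incseq_def le_fun_def intro!: ennreal_leI powr_mono2)
  qed measurable
  also have "\<dots> \<le> ennreal B" by (rule SUP_least) (use B Hn in \<open>simp add: S_def\<close>)
  finally have int\<psi>: "(\<integral>\<^sup>+x. \<psi> x \<partial>M) < \<infinity>" by (simp add: le_less_trans)
  have fin: "AE x in M. \<psi> x \<noteq> \<infinity>" by (rule nn_integral_PInf_AE) (use int\<psi> in auto)
  define L where "L x = lim (\<lambda>n. S n x)" for x
  have [measurable]: "L \<in> borel_measurable M" unfolding L_def[abs_def] by measurable
  have conv: "(\<lambda>n. S n x) \<longlonglongrightarrow> L x" and SL: "S n x \<le> L x" and L\<psi>: "ennreal (L x powr r) \<le> \<psi> x"
    if \<psi>x: "\<psi> x \<noteq> \<infinity>" for n x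
  proof -
    obtain c where c: "0 \<le> c" "\<psi> x = ennreal c" using \<psi>x by (cases "\<psi> x") auto
    have "S n x \<le> c powr (1/r)" for n
    proof -
      have "ennreal (S n x powr r) \<le> ennreal c" unfolding c(2)[symmetric] \<psi>_def by (rule SUP_upper) simp
      then have "S n x powr r \<le> c" using c by simp
      then have "(S n x powr r) powr (1/r) \<le> c powr (1/r)" using r by (intro powr_mono2) auto
      then show ?thesis using r S0 by (simp add: powr_powr)
    qed
    then have "convergent (\<lambda>n. S n x)"
      using S_mono by (intro Bseq_monoseq_convergent BseqI'[where K="c powr (1/r)"]) (auto simp: S0 monoseq_def)
    then show lim: "(\<lambda>n. S n x) \<longlonglongrightarrow> L x" by (simp add: L_def convergent_LIMSEQ_iff)
    show "S n x \<le> L x" by (rule LIMSEQ_le_const[OF lim]) (use S_mono in auto)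
    have "(\<lambda>n. ennreal (S n x powr r)) \<longlonglongrightarrow> ennreal (L x powr r)"
      using r S0 by (intro tendsto_ennrealI tendsto_powr' lim) auto
    then show "ennreal (L x powr r) \<le> \<psi> x"
      by (rule LIMSEQ_le_const2) (auto simp: \<psi>_def intro!: SUP_upper)
  qed
  have "(\<lambda>n. \<integral>\<^sup>+x. ennreal ((L x - S n x) powr r) \<partial>M) \<longlonglongrightarrow> (\<integral>\<^sup>+x. 0 \<partial>M)"
  proof (rule nn_integral_dominated_convergence[where w=\<psi>])
    show "AE x in M. ennreal ((L x - S n x) powr r) \<le> \<psi> x" for n
      using fin
    proof eventually_elim
      case (elim x)
      have "(L x - S n x) powr r \<le> L x powr r" using SL[OF elim, of n] S0[of n x] r by (intro powr_mono2) auto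
      then show ?case using L\<psi>[OF elim] by (meson ennreal_leI order_trans)
    qed
    show "AE x in M. (\<lambda>n. ennreal ((L x - S n x) powr r)) \<longlonglongrightarrow> 0"
      using fin
    proof eventually_elim
      case (elim x)
      have "(\<lambda>n. L x - S n x) \<longlonglongrightarrow> 0" using tendsto_diff[OF tendsto_const[of "L x"] conv[OF elim]] by simp
      then have "(\<lambda>n. (L x - S n x) powr r) \<longlonglongrightarrow> 0 powr r"
        using r SL[OF elim] by (intro tendsto_powr') auto
      then show ?case using tendsto_ennrealI by fastforce
    qed
  qed (use int\<psi> in auto)
  then have "\<forall>\<^sub>F n in sequentially. (\<integral>\<^sup>+x. ennreal ((L x - S n x) powr r) \<partial>M) < ennreal \<eta>"
    using \<eta> by (intro order_tendstoD) auto
  then obtain n where n: "(\<integral>\<^sup>+x. ennreal ((L x - S n x) powr r) \<partial>M) < ennreal \<eta>"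
    by (auto simp: eventually_sequentially)
  have "(\<integral>\<^sup>+x. ennreal ((\<Sum>i\<in>G. \<theta> i x) powr r) \<partial>M) \<le> ennreal \<eta>" if G: "finite G" "G \<subseteq> H - Hn n" for G
  proof -
    have "\<forall>i\<in>G. \<exists>m. i = e m" using G e by auto
    then obtain g where g: "\<And>i. i \<in> G \<Longrightarrow> i = e (g i)" by metis
    define m where "m = max n (Suc (Max (g ` G)))"
    have "G \<subseteq> Hn m"
    proof
      fix i assume i: "i \<in> G"
      have "g i \<le> Max (g ` G)" using G(1) i by (intro Max_ge) auto
      then have "g i < m" by (simp add: m_def)
      then show "i \<in> Hn m" unfolding Hn_def using g[OF i] by blast
    qed
    then have subcubes: "G \<subseteq> Hn m - Hn n" using G(2) by blast
    have "(\<Sum>i\<in>G. \<theta> i x) \<le> S m x - S n x" for x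
    proof -
      have "(\<Sum>i\<in>G. \<theta> i x) \<le> (\<Sum>i\<in>Hn m - Hn n. \<theta> i x)"
        using subcubes Hn(1) \<theta>(2) by (intro sum_mono2) auto
      also have "\<dots> = S m x - S n x"
        unfolding S_def by (rule sum_diff[OF Hn(1) Hn_mono]) (simp add: m_def)
      finally show ?thesis .
    qed
    then have "(\<integral>\<^sup>+x. ennreal ((\<Sum>i\<in>G. \<theta> i x) powr r) \<partial>M) \<le> (\<integral>\<^sup>+x. ennreal ((L x - S n x) powr r) \<partial>M)"
    proof (intro nn_integral_mono_AE)
      assume *: "\<And>x. (\<Sum>i\<in>G. \<theta> i x) \<le> S m x - S n x"
      show "AE x in M. ennreal ((\<Sum>i\<in>G. \<theta> i x) powr r) \<le> ennreal ((L x - S n x) powr r)"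
        using fin
      proof eventually_elim
        case (elim x)
        have "(\<Sum>i\<in>G. \<theta> i x) \<le> L x - S n x" using *[of x] SL[OF elim, of m] by linarith
        then show ?case using r \<theta>(2) by (intro ennreal_leI powr_mono2 sum_nonneg) auto
      qed
    qed
    then show ?thesis using n by (meson less_imp_le order_trans)
  qed
  then show ?thesis using Hn[of n] by (intro exI[of _ "Hn n"] conjI allI impI)
qed (use \<eta> in auto)

context dyadic begin

text \<open>A cube has only one generation and each generation has one cube through x, so the cubes
  of G containing x are enumerated injectively.\<close>

lemma sum_over_cubes:
  assumes G: "finite G" "G \<subseteq> (\<Union>j\<in>{k..<K}. D j)" and F: "\<And>Q. Q \<in> G \<Longrightarrow> x \<notin> Q \<Longrightarrow> F Q = 0"
  shows "(\<Sum>Q\<in>G. F Q) = (\<Sum>j\<in>{k..<K}. if cube j x \<in> G then F (cube j x) else 0)"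
proof -
  have "(\<Sum>Q\<in>G. F Q) = (\<Sum>Q\<in>{Q \<in> G. x \<in> Q}. F Q)"
    using G F by (intro sum.mono_neutral_right) auto
  also have "\<dots> = (\<Sum>j\<in>{j \<in> {k..<K}. cube j x \<in> G}. F (cube j x))"
  proof (rule sum.reindex_cong[of "\<lambda>j. cube j x"])
    show "inj_on (\<lambda>j. cube j x) {j \<in> {k..<K}. cube j x \<in> G}"
    proof (rule inj_onI)
      fix i j assume "cube i x = cube j x"
      then have "cube i x \<in> D j" by simp
      then show "i = j" by (rule D_inj[OF cube_in])
    qed
    show "{Q \<in> G. x \<in> Q} = (\<lambda>j. cube j x) ` {j \<in> {k..<K}. cube j x \<in> G}"
    proof (intro equalityI subsetI)
      fix Q assume Q: "Q \<in> {Q \<in> G. x \<in> Q}"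
      then obtain j where j: "j \<in> {k..<K}" "Q \<in> D j" using G(2) by blast
      have "Q = cube j x" using cube_eqI[OF j(2)] Q by simp
      then show "Q \<in> (\<lambda>j. cube j x) ` {j \<in> {k..<K}. cube j x \<in> G}" using j Q by blast
    qed auto
  qed simp
  also have "\<dots> = (\<Sum>j\<in>{k..<K}. if cube j x \<in> G then F (cube j x) else 0)"
    by (simp add: sum.If_cases Int_def)
  finally show ?thesis .
qed

lemma finite_cubes_range:
  assumes "finite G" "G \<subseteq> cubes"
  shows "\<exists>k K. k \<le> K \<and> G \<subseteq> (\<Union>j\<in>{k..<K}. D j)"
  using assms
proof (induction G rule: finite_induct)
  case (insert Q G)
  then obtain k K j where *: "k \<le> K" "G \<subseteq> (\<Union>j\<in>{k..<K}. D j)" "Q \<in> D j" by auto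
  have "j \<in> {min k j..<max K (j + 1)}" "{k..<K} \<subseteq> {min k j..<max K (j + 1)}" by auto
  then have "insert Q G \<subseteq> (\<Union>i\<in>{min k j..<max K (j + 1)}. D i)"
    using *(2,3) by blast
  moreover have "min k j \<le> max K (j + 1)" by auto
  ultimately show ?case by blast
qed auto

lemma mart_diff_eq:
  fixes b :: "real ^ 'd \<Rightarrow> 'b::{real_normed_field, euclidean_space}"
  assumes Q: "Q \<in> D k"
  shows "mart_diff \<mu> cubes b Q x = (if x \<in> Q then mdiff b k x else 0)"
proof -
  have ch: "dyadic_children cubes Q = subcubes (k + 1) Q" using dyadic_children_eq[OF Q] by (simp add: subcubes_def)
  let ?t = "\<lambda>P. (average \<mu> b P - average \<mu> b Q) * indicator P x"
  show ?thesis
  proof (cases "x \<in> Q")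
    case True
    have "cube (k + 1) x \<in> subcubes (k + 1) Q"
      using D_nested[OF Q cube_in, of "k + 1" x x] True by (simp add: subcubes_def)
    then have "(\<Sum>P\<in>subcubes (k + 1) Q. ?t P) = ?t (cube (k + 1) x) + (\<Sum>P\<in>subcubes (k + 1) Q - {cube (k + 1) x}. ?t P)"
      by (rule sum.remove[OF finite_subcubes[OF Q]])
    also have "(\<Sum>P\<in>subcubes (k + 1) Q - {cube (k + 1) x}. ?t P) = 0"
    proof (rule sum.neutral, rule ballI)
      fix P assume "P \<in> subcubes (k + 1) Q - {cube (k + 1) x}"
      then have "x \<notin> P" using cube_eqI[of P "k + 1" x] by (auto simp: subcubes_def)
      then show "?t P = 0" by simp
    qed
    finally show ?thesis using True
      by (simp add: mart_diff_def ch mdiff_def cond_exp_eq[OF Q True]) (simp add: cond_exp_def)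
  next
    case False
    then have "(\<Sum>P\<in>subcubes (k + 1) Q. ?t P) = 0" by (intro sum.neutral) (auto simp: subcubes_def indicator_def)
    then show ?thesis using False by (simp add: mart_diff_def ch)
  qed
qed

lemma measurable_mart_diff:
  fixes b :: "real ^ 'd \<Rightarrow> 'b::{real_normed_field, euclidean_space}"
  assumes Q: "Q \<in> cubes"
  shows "mart_diff \<mu> cubes b Q \<in> borel_measurable \<mu>"
proof -
  obtain k where Qk: "Q \<in> D k" using Q by auto
  have [measurable]: "Q \<in> sets \<mu>" "mdiff b k \<in> borel_measurable \<mu>"
    using Qk adapted_measurable[OF adapted_mdiff[OF order_refl]] by auto
  have "mart_diff \<mu> cubes b Q = (\<lambda>x. indicator Q x *\<^sub>R mdiff b k x)"
    by (auto simp: fun_eq_iff mart_diff_eq[OF Qk])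
  then show ?thesis by simp
qed

lemma energy_eq_mart_diff:
  fixes b :: "real ^ 'd \<Rightarrow> 'b::{real_normed_field, euclidean_space}"
  assumes G: "finite G" "G \<subseteq> (\<Union>j\<in>{k..<K}. D j)"
  shows "(\<Sum>Q\<in>G. norm (mart_diff \<mu> cubes b Q x) powr s) = (\<Sum>j\<in>{k..<K}. energy s G b j x)"
proof -
  have out: "mart_diff \<mu> cubes b Q x = 0" if Qx: "Q \<in> G" "x \<notin> Q" for Q
  proof -
    obtain j where "Q \<in> D j" using Qx G by blast
    then show ?thesis using mart_diff_eq[of Q j b x] Qx by simp
  qed
  have "(\<Sum>Q\<in>G. norm (mart_diff \<mu> cubes b Q x) powr s)
      = (\<Sum>j\<in>{k..<K}. if cube j x \<in> G then norm (mart_diff \<mu> cubes b (cube j x) x) powr s else 0)"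
    by (rule sum_over_cubes[OF G]) (simp add: out)
  then show ?thesis by (simp add: energy_def mart_diff_eq[OF cube_in] cong: if_cong)
qed

lemma energy_restrict:
  assumes "P \<in> D k" "x \<in> P" "k \<le> j" "j < K"
  shows "energy s G b j x = energy s {Q \<in> G. Q \<subseteq> P \<and> (\<exists>i\<in>{k..<K}. Q \<in> D i)} b j x"
proof -
  have "cube j x \<subseteq> P" using D_nested[OF assms(1) cube_in assms(3), of x x] assms(2) by simp
  then show ?thesis using assms by (auto simp: energy_def)
qed

section \<open>From oscillation bounds to Carleson bounds\<close>

lemma osc_integral_le:
  fixes b :: "real ^ 'd \<Rightarrow> 'b::euclidean_space"
  assumes p: "0 < p" and b: "b \<in> borel_measurable \<mu>" and Q: "Q \<in> D k"
    and osc: "osc \<mu> p b Q \<le> ennreal \<delta>" and \<delta>: "0 \<le> \<delta>"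
  shows "(\<integral>\<^sup>+x\<in>Q. ennreal (norm (b x - average \<mu> b Q) powr p) \<partial>\<mu>) \<le> ennreal (\<delta> powr p) * emeasure \<mu> Q"
proof (cases "emeasure \<mu> Q = 0")
  case True
  then have "Q \<in> null_sets \<mu>" using Q by auto
  then show ?thesis by (simp add: nn_integral_null_set)
next
  case False
  define I where "I = (\<integral>\<^sup>+x\<in>Q. ennreal (norm (b x - average \<mu> b Q) powr p) \<partial>\<mu>)"
  have *: "ennreal_rpow (I / emeasure \<mu> Q) (1/p) \<le> ennreal \<delta>"
    using osc False by (simp add: osc_def I_def)
  \<comment> \<open>The root of an infinite mean is infinite by definition, so
    \<open>enn2real\<close> loses nothing below.\<close>
  then have fin: "I / emeasure \<mu> Q \<noteq> \<infinity>" by (auto simp: ennreal_rpow_def top_unique)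
  then have "enn2real (I / emeasure \<mu> Q) powr (1/p) \<le> \<delta>" using * \<delta> by (simp add: ennreal_rpow_def)
  then have "(enn2real (I / emeasure \<mu> Q) powr (1/p)) powr p \<le> \<delta> powr p" using p by (intro powr_mono2) auto
  then have "enn2real (I / emeasure \<mu> Q) \<le> \<delta> powr p" using p by (simp add: powr_powr)
  moreover obtain c where "0 \<le> c" "I / emeasure \<mu> Q = ennreal c"
    using fin by (cases "I / emeasure \<mu> Q") auto
  ultimately have "I / emeasure \<mu> Q \<le> ennreal (\<delta> powr p)" by (simp add: ennreal_leI)
  then have "I / emeasure \<mu> Q * emeasure \<mu> Q \<le> ennreal (\<delta> powr p) * emeasure \<mu> Q" by (rule mult_right_mono) simp
  moreover have "I / emeasure \<mu> Q * emeasure \<mu> Q = I"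
    using False emeasure_D_finite[OF Q] by (simp add: ennreal_divide_times ennreal_divide_self mult_divide_eq_ennreal)
  ultimately show ?thesis by (simp add: I_def)
qed

text \<open>For p > 2 the exponent q = 2 is needed besides q = p. Splitting at the level \<delta>
  gives |.|^q \<le> \<delta>^q + \<delta>^(q-p) |.|^p pointwise, and each term integrates to at most
  \<delta>^q \<mu>(Q), whence the factor 2.\<close>

lemma osc_integral_le_lower_exponent:
  fixes b :: "real ^ 'd \<Rightarrow> 'b::euclidean_space"
  assumes q: "0 < q" "q \<le> p" and b: "b \<in> borel_measurable \<mu>" and Q: "Q \<in> D k"
    and osc: "osc \<mu> p b Q \<le> ennreal \<delta>" and \<delta>: "0 < \<delta>"
  shows "set_integrable \<mu> Q (\<lambda>x. norm (b x - average \<mu> b Q) powr q)"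
    and "(LINT x:Q|\<mu>. norm (b x - average \<mu> b Q) powr q) \<le> 2 * \<delta> powr q * measure \<mu> Q"
proof -
  let ?n = "\<lambda>x. norm (b x - average \<mu> b Q)"
  note [measurable] = b D_sets[OF Q]
  have Lp_integral: "(\<integral>\<^sup>+x\<in>Q. ennreal (?n x powr p) \<partial>\<mu>) \<le> ennreal (\<delta> powr p * measure \<mu> Q)"
    using osc_integral_le[OF _ b Q osc] q \<delta> by (simp add: emeasure_D[OF Q] ennreal_mult)
  have eqn: "(\<integral>\<^sup>+x\<in>Q. ennreal (?n x powr p) \<partial>\<mu>) = (\<integral>\<^sup>+x. ennreal (indicator Q x *\<^sub>R ?n x powr p) \<partial>\<mu>)"
    by (intro nn_integral_cong) (auto simp: indicator_def)
  have ip: "set_integrable \<mu> Q (\<lambda>x. ?n x powr p)" unfolding set_integrable_def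
    using Lp_integral eqn by (intro integrableI_nonneg) (auto simp: le_less_trans)
  have "ennreal (LINT x:Q|\<mu>. ?n x powr p) \<le> ennreal (\<delta> powr p * measure \<mu> Q)"
    using Lp_integral nn_integral_eq_integral[OF ip[unfolded set_integrable_def]] eqn by (simp add: set_lebesgue_integral_def)
  then have Ip: "(LINT x:Q|\<mu>. ?n x powr p) \<le> \<delta> powr p * measure \<mu> Q" by (subst (asm) ennreal_le_iff) auto
  have pw: "?n x powr q \<le> \<delta> powr q + \<delta> powr (q - p) * ?n x powr p" for x
  proof (cases "?n x \<le> \<delta>")
    case True
    then have "?n x powr q \<le> \<delta> powr q" using q by (intro powr_mono2) auto
    then show ?thesis by (simp add: add_increasing2)
  next
    case False
    have "?n x powr (q - p) \<le> \<delta> powr (q - p)" using False q \<delta> by (intro powr_mono2') auto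
    then have "?n x powr (q - p) * ?n x powr p \<le> \<delta> powr (q - p) * ?n x powr p" by (rule mult_right_mono) simp
    then show ?thesis by (simp add: add_increasing flip: powr_add)
  qed
  have i: "set_integrable \<mu> Q (\<lambda>x. \<delta> powr q + \<delta> powr (q - p) * ?n x powr p)"
    by (intro set_integral_add(1) set_integrable_mult_right ip adapted_set_integrable[OF adapted_const Q])
  show iq: "set_integrable \<mu> Q (\<lambda>x. ?n x powr q)"
  proof (rule set_integrable_bound[OF i])
    show "set_borel_measurable \<mu> Q (\<lambda>x. ?n x powr q)" unfolding set_borel_measurable_def by measurable
    show "AE x in \<mu>. x \<in> Q \<longrightarrow> norm (?n x powr q) \<le> norm (\<delta> powr q + \<delta> powr (q - p) * ?n x powr p)"
      using pw by (intro AE_I2) (auto intro: order_trans[OF _ abs_ge_self])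
  qed
  have "(LINT x:Q|\<mu>. ?n x powr q) \<le> (LINT x:Q|\<mu>. \<delta> powr q + \<delta> powr (q - p) * ?n x powr p)"
    by (rule set_integral_mono[OF iq i pw])
  also have "\<dots> = \<delta> powr q * measure \<mu> Q + \<delta> powr (q - p) * (LINT x:Q|\<mu>. ?n x powr p)"
    by (subst set_integral_add(2)[OF adapted_set_integrable[OF adapted_const Q] set_integrable_mult_right[OF ip]])
       (simp add: set_integral_const_D[OF Q])
  also have "\<dots> \<le> \<delta> powr q * measure \<mu> Q + \<delta> powr (q - p) * (\<delta> powr p * measure \<mu> Q)"
    using Ip by (intro add_left_mono mult_left_mono) auto
  also have "\<dots> = 2 * \<delta> powr q * measure \<mu> Q" by (simp flip: mult.assoc powr_add)
  finally show "(LINT x:Q|\<mu>. ?n x powr q) \<le> 2 * \<delta> powr q * measure \<mu> Q" .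
qed

lemma L1_loc_locally_integrable:
  fixes b :: "real ^ 'd \<Rightarrow> 'b::euclidean_space"
  assumes "b \<in> L1_loc \<mu>" shows "locally_integrable b"
  unfolding locally_integrable_def
proof (intro allI ballI)
  fix k Q assume Q: "Q \<in> D k"
  have "compact (closure Q)" using bounded_D[OF Q] by simp
  then have "set_integrable \<mu> (closure Q) b" using assms by (auto simp: L1_loc_def)
  then show "set_integrable \<mu> Q b" by (rule set_integrable_subset) (use Q closure_subset in auto)
qed

text \<open>A cube outside G contributes no energy of its own, so its integral is a sum over its
  children of sums started one generation later. The descent stops at cubes of G or at generation K,
  where the sum is empty.\<close>

lemma carleson_by_stopping:
  fixes b :: "real ^ 'd \<Rightarrow> 'b::euclidean_space"
  assumes r: "0 < r" and \<kappa>: "0 \<le> \<kappa>"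
    and stop: "\<And>k K P. k \<le> K \<Longrightarrow> P \<in> D k \<Longrightarrow> P \<in> G \<Longrightarrow>
      (LINT x:P|\<mu>. (\<Sum>j\<in>{k..<K}. energy s G b j x) powr r) \<le> \<kappa> * measure \<mu> P"
  shows "carleson s r G b \<kappa>"
  unfolding carleson_def
proof (intro allI impI)
  fix k K :: int and P assume "k \<le> K" "P \<in> D k"
  then show "(LINT x:P|\<mu>. (\<Sum>j\<in>{k..<K}. energy s G b j x) powr r) \<le> \<kappa> * measure \<mu> P"
  proof (induction k arbitrary: P rule: int_le_induct)
    case base
    then show ?case using \<kappa> by simp
  next
    case (step k)
    note P = \<open>P \<in> D (k - 1)\<close>
    show ?case
    proof (cases "P \<in> G")
      case True
      then show ?thesis using stop[of "k - 1" K P] P step.hyps by simp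
    next
      case False
      have ad: "adapted K (\<lambda>x. (\<Sum>j\<in>{k..<K}. energy s G b j x) powr r)"
        by (intro adapted_intros adapted_energy) auto
      have "(LINT x:P|\<mu>. (\<Sum>j\<in>{k - 1..<K}. energy s G b j x) powr r) = (LINT x:P|\<mu>. (\<Sum>j\<in>{k..<K}. energy s G b j x) powr r)"
      proof (rule set_integral_cong_D[OF P])
        fix x assume "x \<in> P"
        then have "cube (k - 1) x = P" by (rule cube_eqI[OF P])
        then have "energy s G b (k - 1) x = 0" using False by (simp add: energy_def)
        then show "(\<Sum>j\<in>{k - 1..<K}. energy s G b j x) powr r = (\<Sum>j\<in>{k..<K}. energy s G b j x) powr r"
          using sum_int_head[of "k - 1" K "\<lambda>j. energy s G b j x"] step.hyps by simp
      qed
      also have "\<dots> \<le> (LINT x:P|\<mu>. \<kappa>)"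
      proof (rule set_integral_le_by_cubes[OF P, of k])
        fix P' assume "P' \<in> D k"
        then show "(LINT x:P'|\<mu>. (\<Sum>j\<in>{k..<K}. energy s G b j x) powr r) \<le> (LINT x:P'|\<mu>. \<kappa>)"
          using step.IH[of P'] by (simp add: set_integral_const_D mult.commute)
      qed (simp_all add: adapted_set_integrable[OF ad P] adapted_set_integrable[OF adapted_const P])
      finally show ?thesis by (simp add: set_integral_const_D[OF P] mult.commute)
    qed
  qed
qed

end

context dyadic begin

lemma nn_integral_D_eq:
  assumes "set_integrable \<mu> Q \<phi>" "\<And>x. 0 \<le> \<phi> x"
  shows "(\<integral>\<^sup>+x\<in>Q. ennreal (\<phi> x) \<partial>\<mu>) = ennreal (LINT x:Q|\<mu>. \<phi> x)"
proof -
  have "(\<integral>\<^sup>+x\<in>Q. ennreal (\<phi> x) \<partial>\<mu>) = (\<integral>\<^sup>+x. ennreal (indicator Q x *\<^sub>R \<phi> x) \<partial>\<mu>)"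
    by (intro nn_integral_cong) (auto simp: indicator_def)
  also have "\<dots> = ennreal (LINT x:Q|\<mu>. \<phi> x)"
    unfolding set_lebesgue_integral_def
    by (rule nn_integral_eq_integral) (use assms in \<open>auto simp: set_integrable_def\<close>)
  finally show ?thesis .
qed

text \<open>All cubes of G lie in R, so their total energy is bounded by the oscillation on R alone,
  uniformly in the number of cubes.\<close>

lemma energy_total_bound:
  fixes b :: "real ^ 'd \<Rightarrow> 'b::{real_normed_field, euclidean_space}"
  assumes adm: "admissible q s r" and qp: "q \<le> p" and b: "b \<in> borel_measurable \<mu>" "locally_integrable b"
    and \<beta>: "0 < \<beta>" and R: "R \<in> D k" "osc \<mu> p b R \<le> ennreal \<beta>"
    and G: "finite G" "G \<subseteq> cubes" "\<And>P. P \<in> G \<Longrightarrow> P \<subseteq> R"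
  shows "(\<integral>\<^sup>+x. ennreal ((\<Sum>P\<in>G. norm (mart_diff \<mu> cubes b P x) powr s) powr r) \<partial>\<mu>)
    \<le> ennreal (energy_const q * (2 * \<beta> powr q * measure \<mu> R))"
proof -
  have q: "0 < q" "0 \<le> energy_const q" using adm by (auto simp: admissible_def energy_const_def)
  obtain k' K where "k' \<le> K" and G': "G \<subseteq> (\<Union>j\<in>{k'..<K}. D j)" using finite_cubes_range[OF G(1,2)] by blast
  have Gk: "G \<subseteq> (\<Union>j\<in>{k..<max k K}. D j)"
  proof
    fix P assume P: "P \<in> G"
    then obtain j where j: "j \<in> {k'..<K}" "P \<in> D j" using G' by blast
    then have "j \<in> {k..<max k K}" using D_subset_le[OF j(2) R(1) G(3)[OF P]] by auto
    then show "P \<in> (\<Union>j\<in>{k..<max k K}. D j)" using j by blast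
  qed
  let ?S = "\<lambda>x. (\<Sum>j\<in>{k..<max k K}. energy s G b j x) powr r"
  have i: "set_integrable \<mu> R ?S"
    by (rule adapted_set_integrable[OF _ R(1), of "max k K"]) (intro adapted_intros adapted_energy, auto)
  have "(\<integral>\<^sup>+x. ennreal ((\<Sum>P\<in>G. norm (mart_diff \<mu> cubes b P x) powr s) powr r) \<partial>\<mu>) = (\<integral>\<^sup>+x\<in>R. ennreal (?S x) \<partial>\<mu>)"
  proof (rule nn_integral_cong)
    fix x
    show "ennreal ((\<Sum>P\<in>G. norm (mart_diff \<mu> cubes b P x) powr s) powr r) = ennreal (?S x) * indicator R x"
    proof (cases "x \<in> R")
      case False
      have "mart_diff \<mu> cubes b P x = 0" if P: "P \<in> G" for P
      proof -
        obtain j where "P \<in> D j" using P G(2) by blast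
        then show ?thesis using mart_diff_eq[of P j b x] G(3)[OF P] False by auto
      qed
      then show ?thesis using False by simp
    qed (simp add: energy_eq_mart_diff[OF G(1) Gk])
  qed
  also have "\<dots> = ennreal (LINT x:R|\<mu>. ?S x)" by (rule nn_integral_D_eq[OF i]) simp
  also have "\<dots> \<le> ennreal (energy_const q * (2 * \<beta> powr q * measure \<mu> R))"
  proof (rule ennreal_leI)
    have "(LINT x:R|\<mu>. ?S x) \<le> energy_const q * (LINT x:R|\<mu>. norm (b x - average \<mu> b R) powr q)"
      by (rule energy_le_oscillation[OF adm b(2) R(1) _ osc_integral_le_lower_exponent(1)[OF q(1) qp b(1) R \<beta>]]) simp
    also have "\<dots> \<le> energy_const q * (2 * \<beta> powr q * measure \<mu> R)"
      by (rule mult_left_mono[OF osc_integral_le_lower_exponent(2)[OF q(1) qp b(1) R \<beta>] q(2)])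
    finally show "(LINT x:R|\<mu>. ?S x) \<le> energy_const q * (2 * \<beta> powr q * measure \<mu> R)" .
  qed
  finally show ?thesis .
qed

lemma VMO_good_cubes:
  assumes "b \<in> VMO \<mu> p cubes" "0 < \<delta>"
  shows "\<exists>M>0. \<forall>Q\<in>cubes. ennreal M \<le> emeasure \<mu> Q \<or> emeasure \<mu> Q \<le> ennreal (1/M) \<or> M \<le> infdist 0 Q \<longrightarrow>
      osc \<mu> p b Q \<le> ennreal \<delta>"
proof -
  have "\<forall>\<^sub>F M::real in at_top. (SUP Q\<in>{Q\<in>cubes. emeasure \<mu> Q \<ge> ennreal M}. osc \<mu> p b Q) < ennreal \<delta>"
       "\<forall>\<^sub>F M::real in at_top. (SUP Q\<in>{Q\<in>cubes. emeasure \<mu> Q \<le> ennreal (1/M)}. osc \<mu> p b Q) < ennreal \<delta>"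
       "\<forall>\<^sub>F M::real in at_top. (SUP Q\<in>{Q\<in>cubes. infdist 0 Q \<ge> M}. osc \<mu> p b Q) < ennreal \<delta>"
    using assms unfolding VMO_def by (auto intro!: order_tendstoD(2))
  then have "\<forall>\<^sub>F M::real in at_top. 0 < M \<and> (SUP Q\<in>{Q\<in>cubes. emeasure \<mu> Q \<ge> ennreal M}. osc \<mu> p b Q) < ennreal \<delta> \<and>
       (SUP Q\<in>{Q\<in>cubes. emeasure \<mu> Q \<le> ennreal (1/M)}. osc \<mu> p b Q) < ennreal \<delta> \<and>
       (SUP Q\<in>{Q\<in>cubes. infdist 0 Q \<ge> M}. osc \<mu> p b Q) < ennreal \<delta>"
    by (intro eventually_conj eventually_gt_at_top)
  then obtain M :: real where M: "0 < M" "(SUP Q\<in>{Q\<in>cubes. emeasure \<mu> Q \<ge> ennreal M}. osc \<mu> p b Q) < ennreal \<delta>"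
       "(SUP Q\<in>{Q\<in>cubes. emeasure \<mu> Q \<le> ennreal (1/M)}. osc \<mu> p b Q) < ennreal \<delta>"
       "(SUP Q\<in>{Q\<in>cubes. infdist 0 Q \<ge> M}. osc \<mu> p b Q) < ennreal \<delta>"
    using eventually_happens'[OF trivial_limit_at_top_linorder] by blast
  show ?thesis
  proof (intro exI[of _ M] conjI ballI impI M(1))
    fix Q assume Q: "Q \<in> cubes" "ennreal M \<le> emeasure \<mu> Q \<or> emeasure \<mu> Q \<le> ennreal (1/M) \<or> M \<le> infdist 0 Q"
    have up: "osc \<mu> p b Q \<le> ennreal \<delta>" if "Q \<in> A" "(SUP Q\<in>A. osc \<mu> p b Q) < ennreal \<delta>" for A
      using SUP_upper[OF that(1), of "osc \<mu> p b"] that(2) by (meson less_imp_le order_trans)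
    from Q(2) consider "ennreal M \<le> emeasure \<mu> Q" | "emeasure \<mu> Q \<le> ennreal (1/M)" | "M \<le> infdist 0 Q" by blast
    then show "osc \<mu> p b Q \<le> ennreal \<delta>"
    proof cases
      case 1 then show ?thesis by (intro up[OF _ M(2)]) (use Q(1) in simp)
    next
      case 2 then show ?thesis by (intro up[OF _ M(3)]) (use Q(1) in simp)
    next
      case 3 then show ?thesis by (intro up[OF _ M(4)]) (use Q(1) in simp)
    qed
  qed
qed

text \<open>The cubes containing a fixed cube C form a chain under inclusion, so among finitely many
  there is a largest.\<close>

lemma finite_common_ancestor:
  assumes C: "C \<in> D j" "C \<in> \<R>" and \<R>: "\<R> \<subseteq> cubes"
    and G: "finite G" "\<And>P. P \<in> G \<Longrightarrow> \<exists>R\<in>\<R>. C \<subseteq> R \<and> P \<subseteq> R"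
  shows "\<exists>R\<in>\<R>. C \<subseteq> R \<and> (\<forall>P\<in>G. P \<subseteq> R)"
  using G
proof (induction G rule: finite_induct)
  case empty
  then show ?case using C by auto
next
  case (insert P G)
  obtain R where R: "R \<in> \<R>" "C \<subseteq> R" "\<forall>P\<in>G. P \<subseteq> R" using insert.IH insert.prems by blast
  obtain R' where R': "R' \<in> \<R>" "C \<subseteq> R'" "P \<subseteq> R'" using insert.prems by blast
  obtain k k' where k: "R \<in> D k" "R' \<in> D k'" using R(1) R'(1) \<R> by blast
  obtain x where "x \<in> C" using D_nonempty[OF C(1)] by blast
  then have x: "x \<in> R" "x \<in> R'" using R R' by auto
  show ?case
  proof (cases "k \<le> k'")
    case True
    then have "R' \<subseteq> R" using D_nested[OF k(1,2) _ x(2,1)] by blast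
    then show ?thesis using R R' by (intro bexI[of _ R]) auto
  next
    case False
    then have "R \<subseteq> R'" using D_nested[OF k(2,1) _ x(1,2)] by simp
    then show ?thesis using R R' by (intro bexI[of _ R']) auto
  qed
qed

text \<open>On cubes of small oscillation the Carleson bound is the energy estimate itself. On the
  remaining ones only the integral of a tail is small; it becomes a Carleson bound because such
  cubes have measure at least 1/M.\<close>

proposition VMO_small_carleson:
  fixes b :: "real ^ 'd \<Rightarrow> 'b::{real_normed_field, euclidean_space}"
  assumes adm: "admissible q s r" and qp: "q \<le> p" and b: "b \<in> VMO \<mu> p cubes" and \<kappa>: "0 < \<kappa>"
  shows "\<exists>F\<subseteq>cubes. finite F \<and> (\<forall>G\<subseteq>cubes - F. carleson s r G b \<kappa>)"
proof -
  have q: "0 < q" "0 < energy_const q" and r: "0 < r"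
    using adm by (auto simp: admissible_def energy_const_def intro: add_nonneg_pos)
  have bL: "b \<in> L1_loc \<mu>" and bB: "(SUP Q\<in>cubes. osc \<mu> p b Q) < \<infinity>" using b by (auto simp: VMO_def BMO_def)
  have bm: "b \<in> borel_measurable \<mu>" using bL by (simp add: L1_loc_def)
  have bl: "locally_integrable b" by (rule L1_loc_locally_integrable[OF bL])
  obtain \<beta> where \<beta>: "0 < \<beta>" "\<And>Q. Q \<in> cubes \<Longrightarrow> osc \<mu> p b Q \<le> ennreal \<beta>"
  proof -
    obtain c where c: "0 \<le> c" "(SUP Q\<in>cubes. osc \<mu> p b Q) = ennreal c"
      using bB by (cases "SUP Q\<in>cubes. osc \<mu> p b Q") auto
    have "osc \<mu> p b Q \<le> ennreal (c + 1)" if "Q \<in> cubes" for Q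
      using SUP_upper[OF that, of "osc \<mu> p b"] c by (auto intro: order_trans ennreal_leI)
    then show ?thesis using c by (intro that[of "c + 1"]) auto
  qed
  \<comment> \<open>The solution of
    \<open>energy_const q * (2 * \<delta> powr q) = \<kappa>\<close>.\<close>
  define \<delta> where "\<delta> = (\<kappa> / (2 * energy_const q)) powr (1/q)"
  have \<delta>: "0 < \<delta>" using \<kappa> q by (simp add: \<delta>_def)
  have "\<delta> powr q = \<kappa> / (2 * energy_const q)" using \<kappa> q by (simp add: \<delta>_def powr_powr)
  then have \<delta>q: "energy_const q * (2 * \<delta> powr q * w) = \<kappa> * w" for w using q by simp
  from VMO_good_cubes[OF b \<delta>]
  obtain M where M_good: "0 < M \<and> (\<forall>Q\<in>cubes. ennreal M \<le> emeasure \<mu> Q \<or> emeasure \<mu> Q \<le> ennreal (1/M) \<or>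
      M \<le> infdist 0 Q \<longrightarrow> osc \<mu> p b Q \<le> ennreal \<delta>)" by (elim exE)
  have M: "0 < M" by (rule conjunct1[OF M_good])
  note good = conjunct2[OF M_good, rule_format]
  \<comment> \<open>A cube of large oscillation meets the ball of radius M, hence contains or is
    contained in one of these unit cubes.\<close>
  define \<C> where "\<C> = {C \<in> D 0. C \<inter> ball 0 M \<noteq> {}}"
  have fin\<C>: "finite \<C>" unfolding \<C>_def by (intro finite_D_meeting bounded_ball)
  \<comment> \<open>The maximum with the measure of C makes C itself a member, as required when the
    cube of large oscillation lies inside C.\<close>
  define \<R> where "\<R> C = {R \<in> cubes. measure \<mu> R \<le> max M (measure \<mu> C)}" for C
  define fam where "fam C = {P \<in> cubes. \<exists>R\<in>\<R> C. C \<subseteq> R \<and> P \<subseteq> R}" for C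
  let ?S = "\<lambda>G x. (\<Sum>P\<in>G. norm (mart_diff \<mu> cubes b P x) powr s)"
  have "\<exists>F\<subseteq>fam C. finite F \<and> (\<forall>G. finite G \<longrightarrow> G \<subseteq> fam C - F \<longrightarrow>
     (\<integral>\<^sup>+x. ennreal (?S G x powr r) \<partial>\<mu>) \<le> ennreal (\<kappa>/M))" if C: "C \<in> \<C>" for C
  proof (rule small_tails[where B = "energy_const q * (2 * \<beta> powr q * max M (measure \<mu> C))"])
    have "countable cubes" by (intro countable_UN countable_D) simp
    then show "countable (fam C)" by (rule countable_subset[rotated]) (auto simp: fam_def)
    show "(\<lambda>x. norm (mart_diff \<mu> cubes b P x) powr s) \<in> borel_measurable \<mu>" if "P \<in> fam C" for P
      using measurable_mart_diff[of P b] that by (auto simp: fam_def)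
    fix G assume G: "finite G" "G \<subseteq> fam C"
    have C0: "C \<in> D 0" using C by (simp add: \<C>_def)
    \<comment> \<open>The ancestors of C of bounded measure may have no largest element, so a common
      one is taken for each finite G; the resulting bound depends on C only.\<close>
    have "\<exists>R\<in>\<R> C. C \<subseteq> R \<and> (\<forall>P\<in>G. P \<subseteq> R)"
      by (rule finite_common_ancestor[OF C0 _ _ G(1)]) (use C0 G(2) in \<open>auto simp: \<R>_def fam_def\<close>)
    then obtain R k where R: "R \<in> D k" "measure \<mu> R \<le> max M (measure \<mu> C)" "\<And>P. P \<in> G \<Longrightarrow> P \<subseteq> R"
      by (auto simp: \<R>_def)
    have "(\<integral>\<^sup>+x. ennreal (?S G x powr r) \<partial>\<mu>) \<le> ennreal (energy_const q * (2 * \<beta> powr q * measure \<mu> R))"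
      by (rule energy_total_bound[OF adm qp bm bl \<beta>(1) R(1) _ G(1) _ R(3)]) (use R(1) \<beta>(2) G(2) in \<open>auto simp: fam_def\<close>)
    also have "\<dots> \<le> ennreal (energy_const q * (2 * \<beta> powr q * max M (measure \<mu> C)))"
      using R(2) q by (intro ennreal_leI mult_left_mono) auto
    finally show "(\<integral>\<^sup>+x. ennreal (?S G x powr r) \<partial>\<mu>) \<le> ennreal (energy_const q * (2 * \<beta> powr q * max M (measure \<mu> C)))" .
  qed (use r \<kappa> M in auto)
  then have "\<forall>C\<in>\<C>. \<exists>F. F \<subseteq> fam C \<and> finite F \<and> (\<forall>G. finite G \<longrightarrow> G \<subseteq> fam C - F \<longrightarrow>
     (\<integral>\<^sup>+x. ennreal (?S G x powr r) \<partial>\<mu>) \<le> ennreal (\<kappa>/M))" by blast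
  from bchoice[OF this] obtain F where F: "\<forall>C\<in>\<C>. F C \<subseteq> fam C \<and> finite (F C) \<and> (\<forall>G. finite G \<longrightarrow> G \<subseteq> fam C - F C \<longrightarrow>
     (\<integral>\<^sup>+x. ennreal (?S G x powr r) \<partial>\<mu>) \<le> ennreal (\<kappa>/M))" by (elim exE)
  have F1: "F C \<subseteq> fam C" and F2: "finite (F C)" and F3: "finite G \<Longrightarrow> G \<subseteq> fam C - F C \<Longrightarrow>
     (\<integral>\<^sup>+x. ennreal (?S G x powr r) \<partial>\<mu>) \<le> ennreal (\<kappa>/M)" if "C \<in> \<C>" for C G
    using bspec[OF F that] by simp_all
  have "carleson s r G b \<kappa>" if G: "G \<subseteq> cubes - (\<Union>C\<in>\<C>. F C)" for G
  proof (rule carleson_by_stopping[OF r])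
    fix k K :: int and P assume kK: "k \<le> K" and P: "P \<in> D k" "P \<in> G"
    show "(LINT x:P|\<mu>. (\<Sum>j\<in>{k..<K}. energy s G b j x) powr r) \<le> \<kappa> * measure \<mu> P"
    proof (cases "osc \<mu> p b P \<le> ennreal \<delta>")
      case True
      have "(LINT x:P|\<mu>. (\<Sum>j\<in>{k..<K}. energy s G b j x) powr r) \<le> energy_const q * (LINT x:P|\<mu>. norm (b x - average \<mu> b P) powr q)"
        by (rule energy_le_oscillation[OF adm bl P(1) kK osc_integral_le_lower_exponent(1)[OF q(1) qp bm P(1) True \<delta>]])
      also have "\<dots> \<le> energy_const q * (2 * \<delta> powr q * measure \<mu> P)"
        by (rule mult_left_mono[OF osc_integral_le_lower_exponent(2)[OF q(1) qp bm P(1) True \<delta>]]) (use q in simp)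
      finally show ?thesis unfolding \<delta>q .
    next
      case False
      have Pc: "P \<in> cubes" using P by blast
      have bad: "\<not> ennreal M \<le> emeasure \<mu> P" "\<not> emeasure \<mu> P \<le> ennreal (1/M)" "\<not> M \<le> infdist 0 P"
        using good[OF Pc] False by argo+
      have w: "measure \<mu> P \<le> M" "1/M \<le> measure \<mu> P"
        using bad(1,2) M emeasure_D[OF P(1)] by (auto simp: ennreal_le_iff not_le)
      have "\<exists>y\<in>P. dist 0 y < M"
        using bad(3) unfolding infdist_notempty[OF D_nonempty[OF P(1)]] not_le
        by (rule cINF_less_iff[OF D_nonempty[OF P(1)] bdd_below_image_dist, THEN iffD1])
      then obtain y where y: "y \<in> P" "y \<in> ball 0 M" by auto
      define C where "C = cube 0 y"
      have C: "C \<in> \<C>" "C \<in> D 0" "y \<in> C" using y unfolding \<C>_def C_def by auto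
      \<comment> \<open>Either P contains the unit cube C around y and is itself an ancestor of
        bounded measure, or P lies in C and C serves as the ancestor.\<close>
      have fam: "Q \<in> fam C" if "Q \<in> cubes" "Q \<subseteq> P" for Q
      proof (cases "k \<le> 0")
        case True
        have "C \<subseteq> P" by (rule D_nested[OF P(1) C(2) True C(3) y(1)])
        then show ?thesis using that Pc w(1) unfolding fam_def \<R>_def by auto
      next
        case False
        have "P \<subseteq> C" by (rule D_nested[OF C(2) P(1) _ y(1) C(3)]) (use False in simp)
        moreover have "C \<in> \<R> C" using C(2) unfolding \<R>_def by auto
        ultimately show ?thesis using that unfolding fam_def by blast
      qed
      define H where "H = {Q \<in> G. Q \<subseteq> P \<and> (\<exists>i\<in>{k..<K}. Q \<in> D i)}"
      have "finite H"
        by (rule finite_subset[of _ "\<Union>i\<in>{k..<K}. subcubes i P"]) (use finite_subcubes[OF P(1)] in \<open>auto simp: H_def subcubes_def\<close>)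
      have H: "H \<subseteq> (\<Union>i\<in>{k..<K}. D i)" "H \<subseteq> fam C - F C" using fam G C(1) by (auto simp: H_def)
      have i: "set_integrable \<mu> P (\<lambda>x. (\<Sum>j\<in>{k..<K}. energy s H b j x) powr r)"
        by (rule adapted_set_integrable[OF _ P(1), of K]) (intro adapted_intros adapted_energy, auto)
      have "(LINT x:P|\<mu>. (\<Sum>j\<in>{k..<K}. energy s G b j x) powr r) = (LINT x:P|\<mu>. (\<Sum>j\<in>{k..<K}. energy s H b j x) powr r)"
      proof (rule set_integral_cong_D[OF P(1)])
        fix x assume "x \<in> P"
        have "(\<Sum>j\<in>{k..<K}. energy s G b j x) = (\<Sum>j\<in>{k..<K}. energy s H b j x)"
          unfolding H_def by (rule sum.cong[OF refl], rule energy_restrict[OF P(1) \<open>x \<in> P\<close>]) auto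
        then show "(\<Sum>j\<in>{k..<K}. energy s G b j x) powr r = (\<Sum>j\<in>{k..<K}. energy s H b j x) powr r" by (simp only:)
      qed
      moreover have "ennreal (LINT x:P|\<mu>. (\<Sum>j\<in>{k..<K}. energy s H b j x) powr r) \<le> ennreal (\<kappa>/M)"
      proof -
        have "ennreal (LINT x:P|\<mu>. (\<Sum>j\<in>{k..<K}. energy s H b j x) powr r)
            = (\<integral>\<^sup>+x\<in>P. ennreal ((\<Sum>j\<in>{k..<K}. energy s H b j x) powr r) \<partial>\<mu>)"
          by (rule nn_integral_D_eq[OF i, symmetric]) simp
        also have "\<dots> \<le> (\<integral>\<^sup>+x. ennreal (?S H x powr r) \<partial>\<mu>)"
          unfolding energy_eq_mart_diff[OF \<open>finite H\<close> H(1)] by (intro nn_integral_mono) (auto simp: indicator_def)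
        also have "\<dots> \<le> ennreal (\<kappa>/M)" by (rule F3[OF C(1) \<open>finite H\<close> H(2)])
        finally show ?thesis .
      qed
      then have "(LINT x:P|\<mu>. (\<Sum>j\<in>{k..<K}. energy s H b j x) powr r) \<le> \<kappa>/M"
        by (subst (asm) ennreal_le_iff) (use \<kappa> M in auto)
      moreover have "\<kappa>/M \<le> \<kappa> * measure \<mu> P" using mult_left_mono[OF w(2), of \<kappa>] \<kappa> by simp
      ultimately show ?thesis by linarith
    qed
  qed (use \<kappa> in simp)
  moreover have "finite (\<Union>C\<in>\<C>. F C)" using fin\<C> F2 by simp
  moreover have "(\<Union>C\<in>\<C>. F C) \<subseteq> cubes"
  proof (rule UN_least)
    fix C assume "C \<in> \<C>"
    have "fam C \<subseteq> cubes" unfolding fam_def by (rule Collect_restrict)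
    then show "F C \<subseteq> cubes" using F1[OF \<open>C \<in> \<C>\<close>] by (rule order_trans[rotated])
  qed
  ultimately show ?thesis by (intro exI[of _ "\<Union>C\<in>\<C>. F C"] conjI allI impI)
qed

text \<open>The exceptional set F is independent of f, Q, k and K, so this is a bound of operator
  norms. For p > 2 the sets belonging to the exponents 2 and p are united.\<close>

proposition VMO_small_partial_paraproducts:
  fixes b :: "real ^ 'd \<Rightarrow> 'b::{real_normed_field, euclidean_space}"
  assumes p: "1 < p" and b: "b \<in> VMO \<mu> p cubes" and \<epsilon>: "0 < \<epsilon>"
  shows "\<exists>F. F \<subseteq> cubes \<and> finite F \<and> (\<forall>G f k K Q. G \<subseteq> cubes - F \<longrightarrow> locally_integrable f \<longrightarrow> Q \<in> D k \<longrightarrow> k \<le> K \<longrightarrow>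
      set_integrable \<mu> Q (\<lambda>x. norm (f x) powr p) \<longrightarrow>
      (LINT x:Q|\<mu>. norm (partial_paraproduct G b f k K x) powr p) \<le> \<epsilon> * (LINT x:Q|\<mu>. norm (f x) powr p))"
proof -
  have bl: "locally_integrable b" using b by (intro L1_loc_locally_integrable) (auto simp: VMO_def BMO_def)
  show ?thesis
  proof (cases "p \<le> 2")
    case True
    define \<kappa> where "\<kappa> = \<epsilon> / (80 * 8 powr p / (p - 1))"
    have \<kappa>: "0 < \<kappa>" "80 * 8 powr p / (p - 1) * \<kappa> = \<epsilon>" using p \<epsilon> by (auto simp: \<kappa>_def)
    have "admissible p 2 (p/2)" using p True by (simp add: admissible_def)
    from VMO_small_carleson[OF this order_refl b \<kappa>(1)] obtain F
      where F: "F \<subseteq> cubes" "finite F" "\<And>G. G \<subseteq> cubes - F \<Longrightarrow> carleson 2 (p/2) G b \<kappa>" by blast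
    show ?thesis
    proof (intro exI[of _ F] conjI allI impI F(1,2))
      fix G f k K Q
      assume *: "G \<subseteq> cubes - F" "locally_integrable f" "Q \<in> D k" "k \<le> K" "set_integrable \<mu> Q (\<lambda>x. norm (f x :: 'b) powr p)"
      show "(LINT x:Q|\<mu>. norm (partial_paraproduct G b f k K x) powr p) \<le> \<epsilon> * (LINT x:Q|\<mu>. norm (f x) powr p)"
        using partial_paraproduct_bound_le_2[OF bl *(2-4) p *(5) True F(3)[OF *(1)]] \<kappa>(1) unfolding \<kappa>(2) by simp
    qed
  next
    case False
    then have p2: "2 < p" by simp
    obtain C where C: "0 < C" "\<And>a h :: 'b. norm (a + h) powr p \<le> norm a powr p + p * norm a powr (p - 2) * inner a h
        + C * (norm a powr (p - 2) * norm h ^2 + norm h powr p)"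
      using norm_powr_upper_bound[OF p2] by blast
    define A where "A = 2 * C * ((2 * C * (2 powr p / (p - 1))) powr ((p - 2)/2) + 1) * (2 powr p / (p - 1))"
    have A: "0 < A" unfolding A_def using C p by (intro mult_pos_pos add_nonneg_pos) auto
    define \<delta> where "\<delta> = (\<epsilon> / A) powr (1/p)"
    have \<delta>: "0 < \<delta>" "A * \<delta> powr p = \<epsilon>" using \<epsilon> A p by (auto simp: \<delta>_def powr_powr)
    have "admissible 2 2 1" "admissible p p 1" using p2 by (auto simp: admissible_def)
    moreover have "0 < \<delta>^2" "0 < \<delta> powr p" using \<delta> by auto
    ultimately obtain F1 F2
      where F1: "F1 \<subseteq> cubes" "finite F1" "\<And>G. G \<subseteq> cubes - F1 \<Longrightarrow> carleson 2 1 G b (\<delta>^2)"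
        and F2: "F2 \<subseteq> cubes" "finite F2" "\<And>G. G \<subseteq> cubes - F2 \<Longrightarrow> carleson p 1 G b (\<delta> powr p)"
      using VMO_small_carleson[of 2 2 1 p b "\<delta>^2"] VMO_small_carleson[of p p 1 p b "\<delta> powr p"] b p2 by fastforce
    show ?thesis
    proof (intro exI[of _ "F1 \<union> F2"] conjI allI impI)
      fix G f k K Q
      assume *: "G \<subseteq> cubes - (F1 \<union> F2)" "locally_integrable f" "Q \<in> D k" "k \<le> K" "set_integrable \<mu> Q (\<lambda>x. norm (f x :: 'b) powr p)"
      have G12: "G \<subseteq> cubes - F1" "G \<subseteq> cubes - F2" using *(1) by auto
      show "(LINT x:Q|\<mu>. norm (partial_paraproduct G b f k K x) powr p) \<le> \<epsilon> * (LINT x:Q|\<mu>. norm (f x) powr p)"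
        using partial_paraproduct_bound_gt_2[OF bl *(2-4) p *(5) p2 \<delta>(1) F1(3)[OF G12(1)] F2(3)[OF G12(2)] C]
        unfolding \<delta>(2)[symmetric] A_def by simp
    qed (use F1 F2 in auto)
  qed
qed

end

subsection \<open>Lebesgue spaces\<close>

lemma ennreal_rpow_less_iff:
  assumes "0 < p" "0 < \<epsilon>"
  shows "ennreal_rpow X (1/p) < ennreal \<epsilon> \<longleftrightarrow> X < ennreal (\<epsilon> powr p)"
proof (cases X)
  case (real x)
  have "x powr (1/p) < \<epsilon> \<longleftrightarrow> x < \<epsilon> powr p"
  proof
    assume "x powr (1/p) < \<epsilon>"
    then have "(x powr (1/p)) powr p < \<epsilon> powr p" by (intro powr_less_mono2) (use assms in auto)
    then show "x < \<epsilon> powr p" using assms real by (simp add: powr_powr)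
  next
    assume "x < \<epsilon> powr p"
    then have "x powr (1/p) < (\<epsilon> powr p) powr (1/p)" by (intro powr_less_mono2) (use assms real in auto)
    then show "x powr (1/p) < \<epsilon>" using assms by (simp add: powr_powr)
  qed
  then show ?thesis using real assms by (simp add: ennreal_rpow_def ennreal_less_iff)
qed (simp add: ennreal_rpow_def)

text \<open>Neighbourhoods of 0 in the extended half-line are tested by positive real radii, which
  keeps later estimates among finite numbers.\<close>

lemma tendsto_0_ennreal_iff:
  fixes f :: "'i \<Rightarrow> ennreal"
  shows "(f \<longlongrightarrow> 0) F \<longleftrightarrow> (\<forall>\<epsilon>>0. \<forall>\<^sub>F i in F. f i < ennreal \<epsilon>)"
proof
  assume "(f \<longlongrightarrow> 0) F"
  then show "\<forall>\<epsilon>>0. \<forall>\<^sub>F i in F. f i < ennreal \<epsilon>" by (auto intro!: order_tendstoD(2))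
next
  assume *: "\<forall>\<epsilon>>0. \<forall>\<^sub>F i in F. f i < ennreal \<epsilon>"
  show "(f \<longlongrightarrow> 0) F"
  proof (rule order_tendstoI)
    fix a :: ennreal assume "0 < a"
    then obtain e where e: "0 < e" "ennreal e \<le> a"
      by (cases a) (auto intro: that[of 1] simp: ennreal_zero_less_one)
    have "\<forall>\<^sub>F i in F. f i < ennreal e" using * e(1) by blast
    then show "\<forall>\<^sub>F i in F. f i < a" by (rule eventually_mono) (use e(2) in order)
  qed auto
qed

section \<open>Integrals of p-th powers and completeness\<close>

text \<open>The p-th power of the Lp norm. Finiteness and convergence to 0 are unaffected by the
  root, and contributions of disjoint cubes add up.\<close>

definition Lp_integral :: "'a measure \<Rightarrow> real \<Rightarrow> ('a \<Rightarrow> 'b::real_normed_vector) \<Rightarrow> ennreal" where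
  "Lp_integral M p f = (\<integral>\<^sup>+x. ennreal (norm (f x) powr p) \<partial>M)"

lemma Lp_norm_Lp_integral: "Lp_norm M p f = ennreal_rpow (Lp_integral M p f) (1/p)"
  by (simp add: Lp_norm_def Lp_integral_def)

lemma tendsto_Lp_norm_iff:
  assumes "0 < p"
  shows "((\<lambda>i. Lp_norm M p (f i)) \<longlongrightarrow> 0) F \<longleftrightarrow> ((\<lambda>i. Lp_integral M p (f i)) \<longlongrightarrow> 0) F"
  unfolding tendsto_0_ennreal_iff Lp_norm_Lp_integral
proof (intro iffI allI impI)
  fix \<epsilon> :: real assume *: "\<forall>\<epsilon>>0. \<forall>\<^sub>F i in F. ennreal_rpow (Lp_integral M p (f i)) (1/p) < ennreal \<epsilon>" and \<epsilon>: "0 < \<epsilon>"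
  have "0 < \<epsilon> powr (1/p)" using \<epsilon> by simp
  with * have "\<forall>\<^sub>F i in F. ennreal_rpow (Lp_integral M p (f i)) (1/p) < ennreal (\<epsilon> powr (1/p))" by blast
  then show "\<forall>\<^sub>F i in F. Lp_integral M p (f i) < ennreal \<epsilon>"
    by (rule eventually_mono) (use assms \<epsilon> in \<open>simp add: ennreal_rpow_less_iff powr_powr\<close>)
next
  fix \<epsilon> :: real assume *: "\<forall>\<epsilon>>0. \<forall>\<^sub>F i in F. Lp_integral M p (f i) < ennreal \<epsilon>" and \<epsilon>: "0 < \<epsilon>"
  have "0 < \<epsilon> powr p" using \<epsilon> by simp
  with * have "\<forall>\<^sub>F i in F. Lp_integral M p (f i) < ennreal (\<epsilon> powr p)" by blast
  then show "\<forall>\<^sub>F i in F. ennreal_rpow (Lp_integral M p (f i)) (1/p) < ennreal \<epsilon>"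
    by (rule eventually_mono) (use assms \<epsilon> in \<open>simp add: ennreal_rpow_less_iff\<close>)
qed

lemma Lp_space_iff: "f \<in> Lp_space M p \<longleftrightarrow> f \<in> borel_measurable M \<and> Lp_integral M p f < \<infinity>"
  by (auto simp: Lp_space_def Lp_norm_Lp_integral ennreal_rpow_def less_top)

lemma Lp_integral_mono: "(\<And>x. norm (f x) \<le> norm (g x)) \<Longrightarrow> 0 < p \<Longrightarrow> Lp_integral M p f \<le> Lp_integral M p g"
  unfolding Lp_integral_def by (intro nn_integral_mono ennreal_leI powr_mono2) auto

lemma Lp_integral_add:
  fixes f g :: "'a \<Rightarrow> 'b::{real_normed_vector, second_countable_topology}"
  assumes [measurable]: "f \<in> borel_measurable M" "g \<in> borel_measurable M" and p: "0 < p"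
  shows "Lp_integral M p (\<lambda>x. f x + g x) \<le> ennreal (2 powr p) * (Lp_integral M p f + Lp_integral M p g)"
proof -
  have "Lp_integral M p (\<lambda>x. f x + g x) \<le> (\<integral>\<^sup>+x. ennreal (2 powr p) * (ennreal (norm (f x) powr p) + ennreal (norm (g x) powr p)) \<partial>M)"
    unfolding Lp_integral_def
  proof (rule nn_integral_mono)
    fix x
    have "norm (f x + g x) powr p \<le> (norm (f x) + norm (g x)) powr p"
      using p by (intro powr_mono2 norm_triangle_ineq) auto
    also have "\<dots> \<le> 2 powr p * (norm (f x) powr p + norm (g x) powr p)" by (rule powr_add_le[OF p]) auto
    finally show "ennreal (norm (f x + g x) powr p) \<le> ennreal (2 powr p) * (ennreal (norm (f x) powr p) + ennreal (norm (g x) powr p))"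
      by (simp flip: ennreal_plus ennreal_mult)
  qed
  also have "\<dots> = ennreal (2 powr p) * (Lp_integral M p f + Lp_integral M p g)"
    unfolding Lp_integral_def by (subst nn_integral_cmult, measurable, subst nn_integral_add) auto
  finally show ?thesis .
qed

lemma Lp_integral_uminus: "Lp_integral M p (\<lambda>x. - f x) = Lp_integral M p f"
  by (simp add: Lp_integral_def)

lemma Lp_integral_minus_commute: "Lp_integral M p (\<lambda>x. f x - g x) = Lp_integral M p (\<lambda>x. g x - f x)"
  by (simp add: Lp_integral_def norm_minus_commute)

lemma Lp_integral_diff:
  fixes f g :: "'a \<Rightarrow> 'b::{real_normed_vector, second_countable_topology}"
  assumes "f \<in> borel_measurable M" "g \<in> borel_measurable M" "0 < p"
  shows "Lp_integral M p (\<lambda>x. f x - g x) \<le> ennreal (2 powr p) * (Lp_integral M p f + Lp_integral M p g)"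
  using Lp_integral_add[of f M "\<lambda>x. - g x" p] assms by (simp add: Lp_integral_uminus)

lemma Lp_integral_triangle:
  fixes f g h :: "'a \<Rightarrow> 'b::{real_normed_vector, second_countable_topology}"
  assumes [measurable]: "f \<in> borel_measurable M" "g \<in> borel_measurable M" "h \<in> borel_measurable M" and "0 < p"
  shows "Lp_integral M p (\<lambda>x. f x - h x) \<le> ennreal (2 powr p) * (Lp_integral M p (\<lambda>x. f x - g x) + Lp_integral M p (\<lambda>x. g x - h x))"
  using Lp_integral_add[of "\<lambda>x. f x - g x" M "\<lambda>x. g x - h x" p] assms by simp

lemma Lp_integral_cmult:
  fixes f :: "'a \<Rightarrow> 'b::real_normed_field"
  assumes "f \<in> borel_measurable M"
  shows "Lp_integral M p (\<lambda>x. c * f x) = ennreal (norm c powr p) * Lp_integral M p f"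
  unfolding Lp_integral_def using assms
  by (subst nn_integral_cmult[symmetric]) (auto simp: norm_mult powr_mult ennreal_mult)

lemma Lp_integral_sum_finite:
  fixes f :: "'i \<Rightarrow> 'a \<Rightarrow> 'b::{real_normed_vector, second_countable_topology}"
  assumes "finite I" "0 < p" "\<And>i. i \<in> I \<Longrightarrow> f i \<in> borel_measurable M" "\<And>i. i \<in> I \<Longrightarrow> Lp_integral M p (f i) < \<infinity>"
  shows "Lp_integral M p (\<lambda>x. \<Sum>i\<in>I. f i x) < \<infinity>"
  using assms(1,3,4)
proof (induction I rule: finite_induct)
  case (insert i I)
  have "Lp_integral M p (\<lambda>x. f i x + (\<Sum>i\<in>I. f i x)) \<le> ennreal (2 powr p) * (Lp_integral M p (f i) + Lp_integral M p (\<lambda>x. \<Sum>i\<in>I. f i x))"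
    by (rule Lp_integral_add[OF _ _ assms(2)]) (use insert.prems in auto)
  also have "\<dots> < \<infinity>" using insert by (simp add: ennreal_mult_less_top)
  finally show ?case using insert.hyps by simp
qed (simp add: Lp_integral_def)

lemma Lp_integral_eq_0_iff:
  fixes f :: "'a \<Rightarrow> 'b::{real_normed_vector, second_countable_topology}"
  assumes [measurable]: "f \<in> borel_measurable M" and "0 < p"
  shows "Lp_integral M p f = 0 \<longleftrightarrow> (AE x in M. f x = 0)"
  unfolding Lp_integral_def by (subst nn_integral_0_iff_AE) auto

text \<open>The decay 4^(-jp) leaves room for a factor 2^(jp): the functions (2^j |w_j|)^p have
  summable integrals, so almost everywhere they tend to 0 and eventually |w_j| \<le> 2^(-j).\<close>

lemma AE_summable_norm_if_Lp_integral_fast: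
  fixes w :: "nat \<Rightarrow> 'a \<Rightarrow> 'b::{banach, second_countable_topology}"
  assumes [measurable]: "\<And>j. w j \<in> borel_measurable M" and p: "0 < p"
    and w: "\<And>j. Lp_integral M p (w j) \<le> ennreal ((1/4) powr (real j * p))"
  shows "AE x in M. summable (\<lambda>j. norm (w j x))"
proof -
  have "(\<integral>\<^sup>+x. (\<Sum>j. ennreal ((2 ^ j * norm (w j x)) powr p)) \<partial>M) = (\<Sum>j. \<integral>\<^sup>+x. ennreal ((2 ^ j * norm (w j x)) powr p) \<partial>M)"
    by (rule nn_integral_suminf) measurable
  also have "\<dots> \<le> (\<Sum>j. ennreal (((1/2) powr p) ^ j))"
  proof (intro suminf_le summableI)
    fix j
    have "(\<integral>\<^sup>+x. ennreal ((2 ^ j * norm (w j x)) powr p) \<partial>M) = ennreal ((2 ^ j) powr p) * Lp_integral M p (w j)"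
      unfolding Lp_integral_def by (subst nn_integral_cmult[symmetric]) (auto simp: powr_mult ennreal_mult)
    also have "\<dots> \<le> ennreal ((2 ^ j) powr p) * ennreal ((1/4) powr (real j * p))" by (rule mult_left_mono[OF w]) simp
    also have "\<dots> = ennreal ((2 ^ j) powr p * (1/4) powr (real j * p))" by (simp add: ennreal_mult)
    also have "(2 ^ j) powr p * (1/4) powr (real j * p) = ((1/2) powr p) ^ j"
    proof -
      have "(1/4) powr (real j * p) = ((1/4) ^ j) powr p" for p :: real
        by (simp add: powr_powr flip: powr_realpow)
      moreover have "((1/2) powr p) ^ j = ((1/2) ^ j) powr p" 
        by (simp add: powr_powr mult.commute flip: powr_realpow)
      moreover have "(2::real) ^ j * (1/4) ^ j = (1/2) ^ j" by (simp flip: power_mult_distrib)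
      ultimately show ?thesis by (simp flip: powr_mult)
    qed
    finally show "(\<integral>\<^sup>+x. ennreal ((2 ^ j * norm (w j x)) powr p) \<partial>M) \<le> ennreal (((1/2) powr p) ^ j)" .
  qed
  also have "\<dots> < \<infinity>"
  proof -
    have "(1/2) powr p < (1::real)" using powr_less_mono2[of p "1/2" 1] p by simp
    then have "summable (\<lambda>j. ((1/2) powr p) ^ j)" by (intro summable_geometric) simp
    then have "(\<Sum>j. ennreal (((1/2) powr p) ^ j)) \<noteq> top" by (rule ennreal_suminf_neq_top) simp
    then show ?thesis by (simp add: less_top)
  qed
  finally have "AE x in M. (\<Sum>j. ennreal ((2 ^ j * norm (w j x)) powr p)) \<noteq> \<infinity>"
    by (intro nn_integral_PInf_AE) auto
  then show ?thesis
  proof eventually_elim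
    case (elim x)
    then have "summable (\<lambda>j. (2 ^ j * norm (w j x)) powr p)"
      by (intro summable_suminf_not_top) auto
    then have "(\<lambda>j. (2 ^ j * norm (w j x)) powr p) \<longlonglongrightarrow> 0" by (rule summable_LIMSEQ_zero)
    then have "\<forall>\<^sub>F j in sequentially. (2 ^ j * norm (w j x)) powr p < 1" by (rule order_tendstoD) simp
    then have "\<forall>\<^sub>F j in sequentially. norm (w j x) \<le> (1/2) ^ j"
    proof (rule eventually_mono)
      fix j assume "(2 ^ j * norm (w j x)) powr p < 1"
      then have "2 ^ j * norm (w j x) \<le> 1"
        using p powr_mono2[of p 1 "2 ^ j * norm (w j x)"] by (cases "2 ^ j * norm (w j x) \<le> 1") auto
      then show "norm (w j x) \<le> (1/2) ^ j" by (simp add: field_simps)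
    qed
    then show ?case
      by (intro summable_comparison_test_ev[of "\<lambda>j. norm (w j x)" "\<lambda>j. (1/2) ^ j"]) (auto intro: summable_geometric)
  qed
qed

text \<open>Riesz-Fischer: a rapidly Cauchy subsequence converges almost everywhere, and Fatou
  transfers the Cauchy estimate to the limit.\<close>

lemma Lp_complete:
  fixes u :: "nat \<Rightarrow> 'a \<Rightarrow> 'b::{banach, second_countable_topology}"
  assumes p: "0 < p" and u: "\<And>n. u n \<in> Lp_space M p"
    and Cauchy: "\<And>\<epsilon>. 0 < \<epsilon> \<Longrightarrow> \<exists>N. \<forall>m\<ge>N. \<forall>n\<ge>N. Lp_integral M p (\<lambda>x. u m x - u n x) \<le> ennreal \<epsilon>"
  shows "\<exists>g\<in>Lp_space M p. (\<lambda>n. Lp_integral M p (\<lambda>x. u n x - g x)) \<longlonglongrightarrow> 0"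
proof -
  have [measurable]: "u n \<in> borel_measurable M" for n using u by (simp add: Lp_space_iff)
  have "\<forall>j. \<exists>N. \<forall>m\<ge>N. \<forall>n\<ge>N. Lp_integral M p (\<lambda>x. u m x - u n x) \<le> ennreal ((1/4) powr (real j * p))"
    using Cauchy by simp
  from choice[OF this] obtain N where N: "\<forall>j. \<forall>m\<ge>N j. \<forall>n\<ge>N j. Lp_integral M p (\<lambda>x. u m x - u n x) \<le> ennreal ((1/4) powr (real j * p))"
    by (elim exE)
  \<comment> \<open>Summation makes k nondecreasing and at least \<open>N j\<close>; the added 1
    makes k j at least j, so that the subsequence passes every index.\<close>
  define k where "k j = (\<Sum>i\<le>j. N i + 1)" for j
  have kN: "N j \<le> k j" for j using member_le_sum[of j "{..j}" "\<lambda>i. N i + 1"] by (simp add: k_def)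
  have k_Suc: "k j \<le> k (Suc j)" for j by (simp add: k_def)
  have k_ge: "j \<le> k j" for j by (induction j) (auto simp: k_def)
  define w where "w j x = u (k (Suc j)) x - u (k j) x" for j x
  have [measurable]: "w j \<in> borel_measurable M" for j unfolding w_def[abs_def] by measurable
  have "AE x in M. summable (\<lambda>j. norm (w j x))"
  proof (rule AE_summable_norm_if_Lp_integral_fast[OF _ p])
    show "Lp_integral M p (w j) \<le> ennreal ((1/4) powr (real j * p))" for j
      unfolding w_def[abs_def] using N kN[of j] k_Suc[of j] by (meson order_trans)
  qed simp
  then have conv: "AE x in M. (\<lambda>j. u (k j) x) \<longlonglongrightarrow> lim (\<lambda>j. u (k j) x)"
  proof eventually_elim
    case (elim x)
    then have "summable (\<lambda>j. w j x)" by (rule summable_norm_cancel)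
    then have "(\<lambda>n. \<Sum>j<n. w j x) \<longlonglongrightarrow> (\<Sum>j. w j x)" by (rule summable_LIMSEQ)
    moreover have "(\<Sum>j<n. w j x) = u (k n) x - u (k 0) x" for n
      unfolding w_def by (rule sum_lessThan_telescope)
    ultimately have "(\<lambda>n. u (k n) x - u (k 0) x + u (k 0) x) \<longlonglongrightarrow> (\<Sum>j. w j x) + u (k 0) x"
      by (intro tendsto_add tendsto_const) simp
    then have "convergent (\<lambda>n. u (k n) x)" by (auto simp: convergent_def)
    then show ?case by (simp add: convergent_LIMSEQ_iff)
  qed
  define g where "g x = lim (\<lambda>j. u (k j) x)" for x
  have [measurable]: "g \<in> borel_measurable M" unfolding g_def[abs_def] by measurable
  have close: "Lp_integral M p (\<lambda>x. u n x - g x) \<le> ennreal \<epsilon>"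
    if "\<forall>m\<ge>N. \<forall>n\<ge>N. Lp_integral M p (\<lambda>x. u m x - u n x) \<le> ennreal \<epsilon>" "N \<le> n" for N n \<epsilon>
  proof -
    have "Lp_integral M p (\<lambda>x. u n x - g x) = (\<integral>\<^sup>+x. liminf (\<lambda>j. ennreal (norm (u n x - u (k j) x) powr p)) \<partial>M)"
      unfolding Lp_integral_def
    proof (rule nn_integral_cong_AE)
      show "AE x in M. ennreal (norm (u n x - g x) powr p) = liminf (\<lambda>j. ennreal (norm (u n x - u (k j) x) powr p))"
        using conv
      proof eventually_elim
        case (elim x)
        have "(\<lambda>j. ennreal (norm (u n x - u (k j) x) powr p)) \<longlonglongrightarrow> ennreal (norm (u n x - g x) powr p)"
          unfolding g_def using p by (intro tendsto_ennrealI tendsto_powr' tendsto_norm tendsto_diff tendsto_const elim) auto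
        then show ?case by (intro lim_imp_Liminf[symmetric]) auto
      qed
    qed
    also have "\<dots> \<le> liminf (\<lambda>j. \<integral>\<^sup>+x. ennreal (norm (u n x - u (k j) x) powr p) \<partial>M)"
      by (rule nn_integral_liminf) measurable
    also have "\<dots> \<le> ennreal \<epsilon>"
    proof (rule Liminf_le)
      show "\<forall>\<^sub>F j in sequentially. (\<integral>\<^sup>+x. ennreal (norm (u n x - u (k j) x) powr p) \<partial>M) \<le> ennreal \<epsilon>"
        using eventually_ge_at_top[of N]
      proof (rule eventually_mono)
        fix j assume "N \<le> j"
        then have "N \<le> k j" using k_ge[of j] by linarith
        then show "(\<integral>\<^sup>+x. ennreal (norm (u n x - u (k j) x) powr p) \<partial>M) \<le> ennreal \<epsilon>"
          using that by (simp add: Lp_integral_def)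
      qed
    qed simp
    finally show ?thesis .
  qed
  have "(\<lambda>n. Lp_integral M p (\<lambda>x. u n x - g x)) \<longlonglongrightarrow> 0"
    unfolding tendsto_0_ennreal_iff
  proof (intro allI impI)
    fix \<epsilon> :: real assume \<epsilon>: "0 < \<epsilon>"
    then obtain N where "\<forall>m\<ge>N. \<forall>n\<ge>N. Lp_integral M p (\<lambda>x. u m x - u n x) \<le> ennreal (\<epsilon>/2)"
      using Cauchy[of "\<epsilon>/2"] by auto
    from close[OF this] have "\<forall>\<^sub>F n in sequentially. Lp_integral M p (\<lambda>x. u n x - g x) \<le> ennreal (\<epsilon>/2)"
      by (auto simp: eventually_sequentially)
    moreover have "ennreal (\<epsilon>/2) < ennreal \<epsilon>" using \<epsilon> by (simp add: ennreal_less_iff)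
    ultimately show "\<forall>\<^sub>F n in sequentially. Lp_integral M p (\<lambda>x. u n x - g x) < ennreal \<epsilon>"
      by (auto elim!: eventually_mono)
  qed
  moreover have "g \<in> Lp_space M p"
  proof -
    obtain N where "\<forall>m\<ge>N. \<forall>n\<ge>N. Lp_integral M p (\<lambda>x. u m x - u n x) \<le> ennreal 1" using Cauchy[of 1] by auto
    from close[OF this order_refl] have 1: "Lp_integral M p (\<lambda>x. u N x - g x) < \<infinity>" by (simp add: le_less_trans)
    have "Lp_integral M p (\<lambda>x. u N x - (u N x - g x)) \<le> ennreal (2 powr p) * (Lp_integral M p (u N) + Lp_integral M p (\<lambda>x. u N x - g x))"
      by (rule Lp_integral_diff[OF _ _ p]) auto
    also have "\<dots> < \<infinity>" using u[of N] 1 by (simp add: Lp_space_iff ennreal_mult_less_top)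
    finally show ?thesis by (simp add: Lp_space_iff)
  qed
  ultimately show ?thesis by blast
qed

subsection \<open>Convergence and compactness\<close>

context dyadic begin

lemma Lp_set_integrable:
  fixes f :: "real ^ 'd \<Rightarrow> 'b::euclidean_space"
  assumes p: "1 < p" and f: "f \<in> Lp_space \<mu> p" and Q: "Q \<in> D k"
  shows "set_integrable \<mu> Q (\<lambda>x. norm (f x) powr p)" and "set_integrable \<mu> Q f"
proof -
  have [measurable]: "f \<in> borel_measurable \<mu>" and N: "Lp_integral \<mu> p f < \<infinity>" using f by (auto simp: Lp_space_iff)
  note [measurable] = D_sets[OF Q]
  have "integrable \<mu> (\<lambda>x. norm (f x) powr p)"
    using N by (intro integrableI_nonneg) (auto simp: Lp_integral_def)
  then show i: "set_integrable \<mu> Q (\<lambda>x. norm (f x) powr p)"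
    unfolding set_integrable_def by (rule integrable_mult_indicator[OF D_sets[OF Q]])
  have "set_integrable \<mu> Q (\<lambda>x. 1 + norm (f x) powr p)"
    by (rule set_integral_add(1)[OF adapted_set_integrable[OF adapted_const Q] i])
  then show "set_integrable \<mu> Q f"
  proof (rule set_integrable_bound)
    show "set_borel_measurable \<mu> Q f" unfolding set_borel_measurable_def by measurable
    have "norm (f x) \<le> 1 + norm (f x) powr p" for x
    proof (cases "norm (f x) \<le> 1")
      case False
      then have "norm (f x) powr 1 \<le> norm (f x) powr p" using p by (intro powr_mono) auto
      then show ?thesis by simp
    qed (simp add: add_increasing2)
    then show "AE x in \<mu>. x \<in> Q \<longrightarrow> norm (f x) \<le> norm (1 + norm (f x) powr p)"
      by (intro AE_I2) simp
  qed
qed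

lemma Lp_locally_integrable: "1 < p \<Longrightarrow> f \<in> Lp_space \<mu> p \<Longrightarrow> locally_integrable f"
  for f :: "real ^ 'd \<Rightarrow> 'b::euclidean_space"
  unfolding locally_integrable_def using Lp_set_integrable(2) by blast

lemma sum_indicator_D:
  assumes "finite T" "T \<subseteq> D k"
  shows "(\<Sum>Q\<in>T. a * indicator Q x) = (if cube k x \<in> T then a else (0::ennreal))"
proof -
  have "(\<Sum>Q\<in>T. a * indicator Q x) = (\<Sum>Q\<in>T. if Q = cube k x then a else 0)"
  proof (rule sum.cong[OF refl])
    fix Q assume "Q \<in> T"
    then have "x \<in> Q \<longleftrightarrow> Q = cube k x" using assms(2) cube_eqI[of Q k x] by auto
    then show "a * indicator Q x = (if Q = cube k x then a else 0)" by (simp add: indicator_def)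
  qed
  then show ?thesis using assms(1) by simp
qed

end

section \<open>Finite partial sums of the paraproduct\<close>

locale dyadic_VMO = dyadic D \<mu>
  for D :: "int \<Rightarrow> (real ^ 'd) set set" and \<mu> :: "(real ^ 'd) measure" +
  fixes p :: real and b :: "real ^ 'd \<Rightarrow> 'b::{real_normed_field, euclidean_space}"
  assumes p: "1 < p" and b: "b \<in> VMO \<mu> p cubes"
begin

definition paraproduct_sum :: "(real ^ 'd) set set \<Rightarrow> (real ^ 'd \<Rightarrow> 'b) \<Rightarrow> real ^ 'd \<Rightarrow> 'b" where
  "paraproduct_sum G f x = (\<Sum>Q\<in>G. mart_diff \<mu> cubes b Q x * average \<mu> f Q * indicator Q x)"

lemma p_pos: "0 < p" using p by simp

lemma paraproduct_sum_eq_partial_paraproduct: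
  assumes G: "finite G" "G \<subseteq> (\<Union>j\<in>{k..<K}. D j)"
  shows "paraproduct_sum G f x = partial_paraproduct G b f k K x"
proof -
  have "paraproduct_sum G f x = (\<Sum>j\<in>{k..<K}. if cube j x \<in> G
      then mart_diff \<mu> cubes b (cube j x) x * average \<mu> f (cube j x) * indicator (cube j x) x else 0)"
    unfolding paraproduct_sum_def by (rule sum_over_cubes[OF G]) simp
  also have "\<dots> = partial_paraproduct G b f k K x"
    unfolding partial_paraproduct_def
    by (rule sum.cong[OF refl]) (simp add: mart_diff_eq[OF cube_in] cond_exp_def)
  finally show ?thesis .
qed

lemma measurable_paraproduct_sum [measurable]: "G \<subseteq> cubes \<Longrightarrow> paraproduct_sum G f \<in> borel_measurable \<mu>"
  unfolding paraproduct_sum_def[abs_def]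
  by (intro borel_measurable_sum borel_measurable_times borel_measurable_const borel_measurable_indicator measurable_mart_diff) auto

text \<open>The cubes of a finite family lie in finitely many cubes of one coarse generation k.
  These are disjoint, so the local estimates on them add up.\<close>

lemma Lp_integral_paraproduct_sum_le:
  assumes G: "finite G" "G \<subseteq> cubes" and f: "f \<in> Lp_space \<mu> p" and \<epsilon>: "0 \<le> \<epsilon>"
    and le: "\<And>k K Q. k \<le> K \<Longrightarrow> Q \<in> D k \<Longrightarrow>
      (LINT x:Q|\<mu>. norm (partial_paraproduct G b f k K x) powr p) \<le> \<epsilon> * (LINT x:Q|\<mu>. norm (f x) powr p)"
  shows "Lp_integral \<mu> p (paraproduct_sum G f) \<le> ennreal \<epsilon> * Lp_integral \<mu> p f"
proof -
  note [measurable] = measurable_paraproduct_sum[OF G(2), of f]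
  have [measurable]: "f \<in> borel_measurable \<mu>" using f by (simp add: Lp_space_iff)
  obtain k K where kK: "k \<le> K" and Gk: "G \<subseteq> (\<Union>j\<in>{k..<K}. D j)" using finite_cubes_range[OF G] by blast
  \<comment> \<open>The ancestors of generation k of the cubes in G, found through an arbitrary
    point of each; the partial sum vanishes off them.\<close>
  define T where "T = (\<lambda>Q. cube k (SOME x. x \<in> Q)) ` G"
  have T: "finite T" "T \<subseteq> D k" using G(1) by (auto simp: T_def)
  have out: "paraproduct_sum G f x = 0" if "cube k x \<notin> T" for x
    unfolding paraproduct_sum_def
  proof (rule sum.neutral, rule ballI)
    fix Q assume Q: "Q \<in> G"
    have "x \<notin> Q"
    proof
      assume x: "x \<in> Q"
      obtain j where j: "j \<in> {k..<K}" "Q \<in> D j" using Q Gk by blast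
      have "Q \<subseteq> cube k x" by (rule D_nested[OF cube_in j(2) _ x mem_cube]) (use j in simp)
      then have "(SOME x. x \<in> Q) \<in> cube k x" using someI[of "\<lambda>x. x \<in> Q", OF x] by blast
      then have "cube k (SOME x. x \<in> Q) = cube k x" by (rule cube_eqI[OF cube_in])
      then show False using that Q unfolding T_def by (metis image_eqI)
    qed
    then show "mart_diff \<mu> cubes b Q x * average \<mu> f Q * indicator Q x = 0" by simp
  qed
  have loc: "(\<integral>\<^sup>+x\<in>Q. ennreal (norm (paraproduct_sum G f x) powr p) \<partial>\<mu>) \<le> ennreal \<epsilon> * (\<integral>\<^sup>+x\<in>Q. ennreal (norm (f x) powr p) \<partial>\<mu>)" if Q: "Q \<in> D k" for Q
  proof -
    have i: "set_integrable \<mu> Q (\<lambda>x. norm (paraproduct_sum G f x) powr p)"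
      unfolding paraproduct_sum_eq_partial_paraproduct[OF G(1) Gk]
      by (intro adapted_set_integrable[OF _ Q, of K] adapted_intros adapted_partial_paraproduct)
    have "(\<integral>\<^sup>+x\<in>Q. ennreal (norm (paraproduct_sum G f x) powr p) \<partial>\<mu>) = ennreal (LINT x:Q|\<mu>. norm (paraproduct_sum G f x) powr p)"
      by (rule nn_integral_D_eq[OF i]) simp
    also have "\<dots> \<le> ennreal (\<epsilon> * (LINT x:Q|\<mu>. norm (f x) powr p))"
      using le[OF kK Q] by (intro ennreal_leI) (simp add: paraproduct_sum_eq_partial_paraproduct[OF G(1) Gk])
    also have "\<dots> = ennreal \<epsilon> * (\<integral>\<^sup>+x\<in>Q. ennreal (norm (f x) powr p) \<partial>\<mu>)"
      using \<epsilon> by (subst nn_integral_D_eq[OF Lp_set_integrable(1)[OF p f Q]]) (auto simp: ennreal_mult')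
    finally show ?thesis .
  qed
  have "Lp_integral \<mu> p (paraproduct_sum G f) = (\<integral>\<^sup>+x. (\<Sum>Q\<in>T. ennreal (norm (paraproduct_sum G f x) powr p) * indicator Q x) \<partial>\<mu>)"
    unfolding Lp_integral_def by (intro nn_integral_cong) (simp add: sum_indicator_D[OF T] out)
  also have "\<dots> = (\<Sum>Q\<in>T. \<integral>\<^sup>+x\<in>Q. ennreal (norm (paraproduct_sum G f x) powr p) \<partial>\<mu>)"
    by (rule nn_integral_sum) (use T(2) D_sets in \<open>auto intro!: borel_measurable_times_ennreal borel_measurable_indicator\<close>)
  also have "\<dots> \<le> (\<Sum>Q\<in>T. ennreal \<epsilon> * (\<integral>\<^sup>+x\<in>Q. ennreal (norm (f x) powr p) \<partial>\<mu>))"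
    using T(2) by (intro sum_mono loc) auto
  also have "\<dots> = ennreal \<epsilon> * (\<integral>\<^sup>+x. (\<Sum>Q\<in>T. ennreal (norm (f x) powr p) * indicator Q x) \<partial>\<mu>)"
    by (subst nn_integral_sum) (use T(2) D_sets in \<open>auto simp: sum_distrib_left intro!: borel_measurable_times_ennreal borel_measurable_indicator\<close>)
  also have "\<dots> \<le> ennreal \<epsilon> * Lp_integral \<mu> p f"
    unfolding Lp_integral_def by (intro mult_left_mono nn_integral_mono) (simp_all add: sum_indicator_D[OF T])
  finally show ?thesis .
qed

text \<open>One finite F works for all f at once. This uniformity is what gives compactness; for a
  single f it is the Cauchy criterion for the series.\<close>

lemma small_paraproduct_sum:
  assumes "0 < \<epsilon>"
  shows "\<exists>F. F \<subseteq> cubes \<and> finite F \<and> (\<forall>G f. finite G \<longrightarrow> G \<subseteq> cubes - F \<longrightarrow> f \<in> Lp_space \<mu> p \<longrightarrow>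
    Lp_integral \<mu> p (paraproduct_sum G f) \<le> ennreal \<epsilon> * Lp_integral \<mu> p f)"
proof -
  from VMO_small_partial_paraproducts[OF p b assms]
  obtain F where F: "F \<subseteq> cubes \<and> finite F \<and> (\<forall>G f k K Q. G \<subseteq> cubes - F \<longrightarrow> locally_integrable f \<longrightarrow> Q \<in> D k \<longrightarrow> k \<le> K \<longrightarrow>
      set_integrable \<mu> Q (\<lambda>x. norm (f x) powr p) \<longrightarrow>
      (LINT x:Q|\<mu>. norm (partial_paraproduct G b f k K x) powr p) \<le> \<epsilon> * (LINT x:Q|\<mu>. norm (f x) powr p))"
    by (elim exE)
  note F1 = conjunct1[OF F] and F2 = conjunct1[OF conjunct2[OF F]] and F3 = conjunct2[OF conjunct2[OF F], rule_format]
  have "Lp_integral \<mu> p (paraproduct_sum G f) \<le> ennreal \<epsilon> * Lp_integral \<mu> p f" if G: "finite G" "G \<subseteq> cubes - F" and f: "f \<in> Lp_space \<mu> p" for G f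
  proof (rule Lp_integral_paraproduct_sum_le[OF G(1) _ f])
    show "(LINT x:Q|\<mu>. norm (partial_paraproduct G b f k K x) powr p) \<le> \<epsilon> * (LINT x:Q|\<mu>. norm (f x) powr p)"
      if "k \<le> K" "Q \<in> D k" for k K Q
      by (rule F3[OF G(2) Lp_locally_integrable[OF p f] that(2,1) Lp_set_integrable(1)[OF p f that(2)]])
  qed (use assms G in auto)
  then show ?thesis using F1 F2 by (intro exI[of _ F] conjI allI impI)
qed

lemma Lp_integral_mart_diff: "Q \<in> cubes \<Longrightarrow> Lp_integral \<mu> p (mart_diff \<mu> cubes b Q) < \<infinity>"
proof -
  assume "Q \<in> cubes"
  then obtain k where Q: "Q \<in> D k" by blast
  have i: "set_integrable \<mu> Q (\<lambda>x. norm (mdiff b k x) powr p)"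
    by (rule adapted_set_integrable[OF _ Q, of "k + 1"]) (intro adapted_intros adapted_mdiff order_refl)
  have "Lp_integral \<mu> p (mart_diff \<mu> cubes b Q) = (\<integral>\<^sup>+x\<in>Q. ennreal (norm (mdiff b k x) powr p) \<partial>\<mu>)"
    unfolding Lp_integral_def by (intro nn_integral_cong) (auto simp: mart_diff_eq[OF Q])
  also have "\<dots> = ennreal (LINT x:Q|\<mu>. norm (mdiff b k x) powr p)" by (rule nn_integral_D_eq[OF i]) simp
  finally show ?thesis by simp
qed

lemma paraproduct_sum_norm_le: "norm (paraproduct_sum G f x) \<le> (\<Sum>Q\<in>G. norm (mart_diff \<mu> cubes b Q x) * norm (average \<mu> f Q))"
  unfolding paraproduct_sum_def
  by (rule order_trans[OF norm_sum], rule sum_mono) (auto simp: norm_mult indicator_def)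

lemma Lp_integral_sum_mart_diff:
  assumes "finite G" "G \<subseteq> cubes"
  shows "Lp_integral \<mu> p (\<lambda>x. \<Sum>Q\<in>G. norm (mart_diff \<mu> cubes b Q x)) < \<infinity>"
proof (rule Lp_integral_sum_finite[OF assms(1) p_pos])
  fix Q assume Q: "Q \<in> G"
  show "(\<lambda>x. norm (mart_diff \<mu> cubes b Q x)) \<in> borel_measurable \<mu>"
    using measurable_mart_diff[OF subsetD[OF assms(2) Q], of b] by simp
  show "Lp_integral \<mu> p (\<lambda>x. norm (mart_diff \<mu> cubes b Q x)) < \<infinity>"
    using Lp_integral_mart_diff[OF subsetD[OF assms(2) Q]] by (simp add: Lp_integral_def)
qed

text \<open>A finite partial sum depends on f only through its averages on G. The bound serves both
  for membership in Lp and for sequences with converging averages.\<close>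

lemma Lp_integral_paraproduct_sum_le_averages:
  assumes G: "finite G" "G \<subseteq> cubes" and t: "\<And>Q. Q \<in> G \<Longrightarrow> norm (average \<mu> f Q) \<le> t" "0 \<le> t"
  shows "Lp_integral \<mu> p (paraproduct_sum G f) \<le> ennreal (t powr p) * Lp_integral \<mu> p (\<lambda>x. \<Sum>Q\<in>G. norm (mart_diff \<mu> cubes b Q x))"
proof -
  let ?H = "\<lambda>x. \<Sum>Q\<in>G. norm (mart_diff \<mu> cubes b Q x)"
  have H: "?H \<in> borel_measurable \<mu>"
  proof (rule borel_measurable_sum)
    fix Q assume "Q \<in> G"
    then show "(\<lambda>x. norm (mart_diff \<mu> cubes b Q x)) \<in> borel_measurable \<mu>"
      using measurable_mart_diff[OF subsetD[OF G(2)], of Q b] by simp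
  qed
  have "Lp_integral \<mu> p (paraproduct_sum G f) \<le> Lp_integral \<mu> p (\<lambda>x. t * ?H x)"
  proof (rule Lp_integral_mono[OF _ p_pos])
    fix x
    have "norm (paraproduct_sum G f x) \<le> (\<Sum>Q\<in>G. norm (mart_diff \<mu> cubes b Q x) * t)"
      by (rule order_trans[OF paraproduct_sum_norm_le], rule sum_mono) (intro mult_left_mono t, auto)
    also have "\<dots> = t * ?H x" by (simp add: sum_distrib_left mult.commute)
    finally show "norm (paraproduct_sum G f x) \<le> norm (t * ?H x)" by (auto intro: order_trans[OF _ abs_ge_self])
  qed
  also have "\<dots> = ennreal (t powr p) * Lp_integral \<mu> p ?H" using Lp_integral_cmult[OF H, of p t] t(2) by simp
  finally show ?thesis .
qed

lemma paraproduct_sum_Lp: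
  assumes G: "finite G" "G \<subseteq> cubes"
  shows "paraproduct_sum G f \<in> Lp_space \<mu> p"
proof -
  define t where "t = (\<Sum>Q\<in>G. norm (average \<mu> f Q))"
  have "norm (average \<mu> f Q) \<le> t" if "Q \<in> G" for Q
    unfolding t_def using G(1) that by (intro member_le_sum) auto
  moreover have "0 \<le> t" by (simp add: t_def sum_nonneg)
  ultimately have "Lp_integral \<mu> p (paraproduct_sum G f) \<le> ennreal (t powr p) * Lp_integral \<mu> p (\<lambda>x. \<Sum>Q\<in>G. norm (mart_diff \<mu> cubes b Q x))"
    by (rule Lp_integral_paraproduct_sum_le_averages[OF G])
  also have "\<dots> < \<infinity>" using Lp_integral_sum_mart_diff[OF G] by (simp add: ennreal_mult_less_top)
  finally show ?thesis using measurable_paraproduct_sum[OF G(2)] by (simp add: Lp_space_iff)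
qed

lemma average_add:
  fixes f g :: "real ^ 'd \<Rightarrow> 'b"
  assumes "f \<in> Lp_space \<mu> p" "g \<in> Lp_space \<mu> p" "Q \<in> cubes"
  shows "average \<mu> (\<lambda>x. f x + g x) Q = average \<mu> f Q + average \<mu> g Q"
proof -
  obtain k where Q: "Q \<in> D k" using assms(3) by blast
  show ?thesis
    by (simp add: average_def scaleR_add_right
        set_integral_add(2)[OF Lp_set_integrable(2)[OF p assms(1) Q] Lp_set_integrable(2)[OF p assms(2) Q]])
qed

lemma average_cmult: "average \<mu> (\<lambda>x. c * f x) Q = c * average \<mu> f Q" for f :: "real ^ 'd \<Rightarrow> 'b"
  by (simp add: average_def)

lemma paraproduct_sum_add:
  assumes "f \<in> Lp_space \<mu> p" "g \<in> Lp_space \<mu> p" "G \<subseteq> cubes"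
  shows "paraproduct_sum G (\<lambda>x. f x + g x) y = paraproduct_sum G f y + paraproduct_sum G g y"
proof -
  have "paraproduct_sum G (\<lambda>x. f x + g x) y = (\<Sum>Q\<in>G. mart_diff \<mu> cubes b Q y * average \<mu> f Q * indicator Q y
      + mart_diff \<mu> cubes b Q y * average \<mu> g Q * indicator Q y)"
    unfolding paraproduct_sum_def
  proof (rule sum.cong[OF refl])
    fix Q assume "Q \<in> G"
    show "mart_diff \<mu> cubes b Q y * average \<mu> (\<lambda>x. f x + g x) Q * indicator Q y
      = mart_diff \<mu> cubes b Q y * average \<mu> f Q * indicator Q y + mart_diff \<mu> cubes b Q y * average \<mu> g Q * indicator Q y"
      unfolding average_add[OF assms(1,2) subsetD[OF assms(3) \<open>Q \<in> G\<close>]] by (simp only: distrib_left distrib_right)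
  qed
  then show ?thesis by (simp add: paraproduct_sum_def sum.distrib)
qed

lemma paraproduct_sum_cmult: "paraproduct_sum G (\<lambda>x. c * f x) y = c * paraproduct_sum G f y"
  by (simp add: paraproduct_sum_def average_cmult sum_distrib_left mult_ac)

lemma paraproduct_sum_union: "finite A \<Longrightarrow> finite B \<Longrightarrow> A \<inter> B = {} \<Longrightarrow> paraproduct_sum (A \<union> B) f x = paraproduct_sum A f x + paraproduct_sum B f x"
  unfolding paraproduct_sum_def by (rule sum.union_disjoint)

lemma paraproduct_sum_superset: "finite G \<Longrightarrow> F \<subseteq> G \<Longrightarrow> paraproduct_sum G f x - paraproduct_sum F f x = paraproduct_sum (G - F) f x"
proof -
  assume G: "finite G" "F \<subseteq> G"
  have "paraproduct_sum (F \<union> (G - F)) f x = paraproduct_sum F f x + paraproduct_sum (G - F) f x"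
    by (rule paraproduct_sum_union) (use G finite_subset in auto)
  moreover have "F \<union> (G - F) = G" using G by blast
  ultimately show ?thesis by simp
qed

lemma Lp_add: "f \<in> Lp_space \<mu> p \<Longrightarrow> g \<in> Lp_space \<mu> p \<Longrightarrow> (\<lambda>x. f x + g x) \<in> Lp_space \<mu> p"
  for f g :: "real ^ 'd \<Rightarrow> 'b"
  using Lp_integral_add[of f \<mu> g p] p_pos
  by (auto simp: Lp_space_iff ennreal_mult_less_top intro: le_less_trans)

lemma Lp_cmult: "f \<in> Lp_space \<mu> p \<Longrightarrow> (\<lambda>x. c * f x) \<in> Lp_space \<mu> p" for f :: "real ^ 'd \<Rightarrow> 'b"
  using Lp_integral_cmult[of f \<mu> p c] by (auto simp: Lp_space_iff ennreal_mult_less_top)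

section \<open>Unconditional convergence and the operator\<close>

abbreviation "sums_to \<equiv> paraproduct_has_sum \<mu> p cubes b"

lemma sums_to_iff: "sums_to f g \<longleftrightarrow> g \<in> Lp_space \<mu> p \<and>
    ((\<lambda>G. Lp_integral \<mu> p (\<lambda>x. paraproduct_sum G f x - g x)) \<longlongrightarrow> 0) (finite_subsets_at_top cubes)"
  unfolding paraproduct_has_sum_def paraproduct_sum_def tendsto_Lp_norm_iff[OF p_pos] ..

text \<open>Smallness of sums avoiding a finite set is the Cauchy criterion for the net of finite
  sums. A limit is found along the nested finite sets U n and then shown to be the limit of the
  whole net.\<close>

lemma sums_to_exists:
  assumes f: "f \<in> Lp_space \<mu> p"
  shows "\<exists>g. sums_to f g"
proof -
  define B where "B = enn2real (Lp_integral \<mu> p f)"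
  have B: "Lp_integral \<mu> p f = ennreal B" "0 \<le> B" using f by (auto simp: B_def Lp_space_iff ennreal_enn2real)
  have small: "\<exists>F. F \<subseteq> cubes \<and> finite F \<and> (\<forall>G. finite G \<longrightarrow> G \<subseteq> cubes - F \<longrightarrow> Lp_integral \<mu> p (paraproduct_sum G f) \<le> ennreal \<epsilon>)"
    if \<epsilon>: "0 < \<epsilon>" for \<epsilon>
  proof -
    have "0 < \<epsilon> / (B + 1)" using \<epsilon> B by simp
    from small_paraproduct_sum[OF this] obtain F where F: "F \<subseteq> cubes \<and> finite F \<and> (\<forall>G f. finite G \<longrightarrow> G \<subseteq> cubes - F \<longrightarrow> f \<in> Lp_space \<mu> p \<longrightarrow>
      Lp_integral \<mu> p (paraproduct_sum G f) \<le> ennreal (\<epsilon> / (B + 1)) * Lp_integral \<mu> p f)" by (elim exE)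
    have "ennreal (\<epsilon> / (B + 1)) * Lp_integral \<mu> p f \<le> ennreal \<epsilon>"
    proof -
      have "\<epsilon> / (B + 1) * B \<le> \<epsilon>" using \<epsilon> B(2) by (simp add: field_simps)
      then show ?thesis using \<epsilon> B by (simp add: ennreal_leI flip: ennreal_mult)
    qed
    then have "Lp_integral \<mu> p (paraproduct_sum G f) \<le> ennreal \<epsilon>" if "finite G" "G \<subseteq> cubes - F" for G
      by (rule order_trans[OF conjunct2[OF conjunct2[OF F], rule_format, OF that f]])
    then show ?thesis using conjunct1[OF F] conjunct1[OF conjunct2[OF F]] by (intro exI[of _ F] conjI allI impI)
  qed
  have "\<forall>n. \<exists>F. F \<subseteq> cubes \<and> finite F \<and> (\<forall>G. finite G \<longrightarrow> G \<subseteq> cubes - F \<longrightarrow> Lp_integral \<mu> p (paraproduct_sum G f) \<le> ennreal (1 / real (Suc n)))"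
    by (intro allI small) simp
  from choice[OF this] obtain F where F: "\<forall>n. F n \<subseteq> cubes \<and> finite (F n) \<and>
      (\<forall>G. finite G \<longrightarrow> G \<subseteq> cubes - F n \<longrightarrow> Lp_integral \<mu> p (paraproduct_sum G f) \<le> ennreal (1 / real (Suc n)))" by (elim exE)
  define U where "U n = (\<Union>i\<le>n. F i)" for n
  have U: "finite (U n)" "U n \<subseteq> cubes" "F n \<subseteq> U n" for n
  proof -
    show "finite (U n)" unfolding U_def using F by (intro finite_UN_I) simp_all
    show "U n \<subseteq> cubes" unfolding U_def using F by (intro UN_least) simp
    show "F n \<subseteq> U n" unfolding U_def by (rule UN_upper) simp
  qed
  have U_mono: "m \<le> n \<Longrightarrow> U m \<subseteq> U n" for m n by (force simp: U_def)
  have tail: "Lp_integral \<mu> p (paraproduct_sum G f) \<le> ennreal (1 / real (Suc n))" if "finite G" "G \<subseteq> cubes" "G \<inter> U n = {}" for G n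
  proof -
    have "G \<subseteq> cubes - F n" using that U(3)[of n] by blast
    then show ?thesis using spec[OF F, of n] that(1) by simp
  qed
  have cauchy: "Lp_integral \<mu> p (\<lambda>x. paraproduct_sum G f x - paraproduct_sum (U n) f x) \<le> ennreal (1 / real (Suc n))" if "finite G" "G \<subseteq> cubes" "U n \<subseteq> G" for G n
    unfolding paraproduct_sum_superset[OF that(1,3)] by (rule tail) (use that in blast)+
  have "\<exists>g\<in>Lp_space \<mu> p. (\<lambda>n. Lp_integral \<mu> p (\<lambda>x. paraproduct_sum (U n) f x - g x)) \<longlonglongrightarrow> 0"
  proof (rule Lp_complete[OF p_pos paraproduct_sum_Lp[OF U(1,2)]])
    fix \<epsilon> :: real assume \<epsilon>: "0 < \<epsilon>"
    obtain N where N: "1 / real (Suc N) < \<epsilon>" using reals_Archimedean[OF \<epsilon>] by (auto simp: inverse_eq_divide)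
    have *: "Lp_integral \<mu> p (\<lambda>x. paraproduct_sum (U m) f x - paraproduct_sum (U n) f x) \<le> ennreal \<epsilon>" if "N \<le> n" "n \<le> m" for m n
    proof -
      have "1 / real (Suc n) \<le> 1 / real (Suc N)" using that by (intro divide_left_mono) auto
      then have "ennreal (1 / real (Suc n)) \<le> ennreal \<epsilon>" using N by (intro ennreal_leI) linarith
      with cauchy[OF U(1,2) U_mono[OF that(2)]] show ?thesis by (rule order_trans)
    qed
    have "Lp_integral \<mu> p (\<lambda>x. paraproduct_sum (U m) f x - paraproduct_sum (U n) f x) \<le> ennreal \<epsilon>" if "N \<le> m" "N \<le> n" for m n
    proof (cases "n \<le> m")
      case True then show ?thesis by (rule *[OF that(2)])
    next
      case False then show ?thesis using *[OF that(1), of n] by (subst Lp_integral_minus_commute) simp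
    qed
    then show "\<exists>N. \<forall>m\<ge>N. \<forall>n\<ge>N. Lp_integral \<mu> p (\<lambda>x. paraproduct_sum (U m) f x - paraproduct_sum (U n) f x) \<le> ennreal \<epsilon>" by blast
  qed
  then obtain g where g: "g \<in> Lp_space \<mu> p" "(\<lambda>n. Lp_integral \<mu> p (\<lambda>x. paraproduct_sum (U n) f x - g x)) \<longlonglongrightarrow> 0" by blast
  have gm: "g \<in> borel_measurable \<mu>" using g(1) by (simp add: Lp_space_iff)
  have "((\<lambda>G. Lp_integral \<mu> p (\<lambda>x. paraproduct_sum G f x - g x)) \<longlongrightarrow> 0) (finite_subsets_at_top cubes)"
    unfolding tendsto_0_ennreal_iff
  proof (intro allI impI)
    fix \<epsilon> :: real assume \<epsilon>: "0 < \<epsilon>"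
    define \<tau> where "\<tau> = \<epsilon> / (4 * 2 powr p)"
    have \<tau>: "0 < \<tau>" using \<epsilon> by (simp add: \<tau>_def)
    obtain N1 where N1: "1 / real (Suc N1) < \<tau>" using reals_Archimedean[OF \<tau>] by (auto simp: inverse_eq_divide)
    have "\<forall>\<^sub>F n in sequentially. Lp_integral \<mu> p (\<lambda>x. paraproduct_sum (U n) f x - g x) < ennreal \<tau>"
      using g(2) \<tau> unfolding tendsto_0_ennreal_iff by blast
    then obtain N2 where N2: "\<And>n. N2 \<le> n \<Longrightarrow> Lp_integral \<mu> p (\<lambda>x. paraproduct_sum (U n) f x - g x) < ennreal \<tau>"
      by (auto simp: eventually_sequentially)
    define n where "n = max N1 N2"
    have n1: "ennreal (1 / real (Suc n)) \<le> ennreal \<tau>"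
    proof (rule ennreal_leI)
      have "1 / real (Suc n) \<le> 1 / real (Suc N1)" by (intro divide_left_mono) (auto simp: n_def)
      then show "1 / real (Suc n) \<le> \<tau>" using N1 by linarith
    qed
    have "Lp_integral \<mu> p (\<lambda>x. paraproduct_sum G f x - g x) < ennreal \<epsilon>" if G: "finite G" "U n \<subseteq> G" "G \<subseteq> cubes" for G
    proof -
      have "Lp_integral \<mu> p (\<lambda>x. paraproduct_sum G f x - g x) \<le> ennreal (2 powr p) * (Lp_integral \<mu> p (\<lambda>x. paraproduct_sum G f x - paraproduct_sum (U n) f x) + Lp_integral \<mu> p (\<lambda>x. paraproduct_sum (U n) f x - g x))"
        by (rule Lp_integral_triangle[OF measurable_paraproduct_sum[OF G(3)] measurable_paraproduct_sum[OF U(2)] gm p_pos])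
      also have "\<dots> \<le> ennreal (2 powr p) * (ennreal \<tau> + ennreal \<tau>)"
        using cauchy[OF G(1,3,2)] n1 N2[of n] by (intro mult_left_mono add_mono) (auto simp: n_def intro: order_trans)
      also have "\<dots> = ennreal (2 powr p * (\<tau> + \<tau>))" using \<tau> by (simp flip: ennreal_plus ennreal_mult)
      also have "2 powr p * (\<tau> + \<tau>) = \<epsilon> / 2" by (simp add: \<tau>_def)
      also have "ennreal (\<epsilon> / 2) < ennreal \<epsilon>" using \<epsilon> by (simp add: ennreal_less_iff)
      finally show ?thesis .
    qed
    then show "\<forall>\<^sub>F G in finite_subsets_at_top cubes. Lp_integral \<mu> p (\<lambda>x. paraproduct_sum G f x - g x) < ennreal \<epsilon>"
      unfolding eventually_finite_subsets_at_top using U(1,2)[of n] by (intro exI[of _ "U n"]) simp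
  qed
  then show ?thesis using g(1) by (intro exI[of _ g]) (simp add: sums_to_iff)
qed

abbreviation "T \<equiv> paraproduct \<mu> p cubes b"

lemma sums_to_T: "f \<in> Lp_space \<mu> p \<Longrightarrow> sums_to f (T f)"
  unfolding paraproduct_def by (rule someI_ex[OF sums_to_exists])

lemma T_Lp: "f \<in> Lp_space \<mu> p \<Longrightarrow> T f \<in> Lp_space \<mu> p"
  using sums_to_T sums_to_iff by blast

lemma sums_to_approx:
  assumes "sums_to f g" "0 < \<epsilon>"
  shows "\<exists>X. finite X \<and> X \<subseteq> cubes \<and> (\<forall>G. finite G \<longrightarrow> X \<subseteq> G \<longrightarrow> G \<subseteq> cubes \<longrightarrow> Lp_integral \<mu> p (\<lambda>x. paraproduct_sum G f x - g x) < ennreal \<epsilon>)"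
proof -
  have "\<forall>\<^sub>F G in finite_subsets_at_top cubes. Lp_integral \<mu> p (\<lambda>x. paraproduct_sum G f x - g x) < ennreal \<epsilon>"
    using assms unfolding sums_to_iff tendsto_0_ennreal_iff by blast
  then obtain X where X: "finite X \<and> X \<subseteq> cubes \<and>
      (\<forall>G. finite G \<and> X \<subseteq> G \<and> G \<subseteq> cubes \<longrightarrow> Lp_integral \<mu> p (\<lambda>x. paraproduct_sum G f x - g x) < ennreal \<epsilon>)"
    unfolding eventually_finite_subsets_at_top by (elim exE)
  show ?thesis
    by (intro exI[of _ X] conjI allI impI conjunct1[OF X] conjunct1[OF conjunct2[OF X]]
        conjunct2[OF conjunct2[OF X], rule_format])
qed

end

context dyadic_VMO begin

text \<open>A general combination gives both additivity (c = d = 1) and homogeneity (d = 0). Limits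
  in Lp are unique only almost everywhere and \<open>paraproduct\<close> chooses some
  representative, hence the form of the conclusion.\<close>

lemma sums_to_linear_unique:
  assumes sums_to: "sums_to f u" "sums_to g v" "sums_to h w"
    and lin: "\<And>G x. G \<subseteq> cubes \<Longrightarrow> paraproduct_sum G h x = c * paraproduct_sum G f x + d * paraproduct_sum G g x"
  shows "AE x in \<mu>. w x = c * u x + d * v x"
proof -
  have [measurable]: "u \<in> borel_measurable \<mu>" "v \<in> borel_measurable \<mu>" "w \<in> borel_measurable \<mu>"
    using sums_to by (auto simp: sums_to_iff Lp_space_iff)
  \<comment> \<open>Collects one error \<tau> for w and the multiples |c|^p \<tau>, |d|^p \<tau> for
    u and v, with a factor 2^p from each of two triangle inequalities.\<close>
  define C where "C = 2 powr p * (1 + 2 powr p * (norm c powr p + norm d powr p))"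
  have C: "0 < C" unfolding C_def by (intro mult_pos_pos add_pos_nonneg) auto
  have "Lp_integral \<mu> p (\<lambda>x. w x - (c * u x + d * v x)) \<le> ennreal \<epsilon>" if \<epsilon>: "0 < \<epsilon>" for \<epsilon>
  proof -
    define \<tau> where "\<tau> = \<epsilon> / C"
    have \<tau>: "0 < \<tau>" using \<epsilon> C by (simp add: \<tau>_def)
    from sums_to_approx[OF sums_to(1) \<tau>] obtain X1 where X1: "finite X1 \<and> X1 \<subseteq> cubes \<and>
      (\<forall>G. finite G \<longrightarrow> X1 \<subseteq> G \<longrightarrow> G \<subseteq> cubes \<longrightarrow> Lp_integral \<mu> p (\<lambda>x. paraproduct_sum G f x - u x) < ennreal \<tau>)" by (elim exE)
    from sums_to_approx[OF sums_to(2) \<tau>] obtain X2 where X2: "finite X2 \<and> X2 \<subseteq> cubes \<and>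
      (\<forall>G. finite G \<longrightarrow> X2 \<subseteq> G \<longrightarrow> G \<subseteq> cubes \<longrightarrow> Lp_integral \<mu> p (\<lambda>x. paraproduct_sum G g x - v x) < ennreal \<tau>)" by (elim exE)
    from sums_to_approx[OF sums_to(3) \<tau>] obtain X3 where X3: "finite X3 \<and> X3 \<subseteq> cubes \<and>
      (\<forall>G. finite G \<longrightarrow> X3 \<subseteq> G \<longrightarrow> G \<subseteq> cubes \<longrightarrow> Lp_integral \<mu> p (\<lambda>x. paraproduct_sum G h x - w x) < ennreal \<tau>)" by (elim exE)
    note X = conjunct1[OF X1] conjunct1[OF X2] conjunct1[OF X3]
      conjunct1[OF conjunct2[OF X1]] conjunct1[OF conjunct2[OF X2]] conjunct1[OF conjunct2[OF X3]]
    note c1 = conjunct2[OF conjunct2[OF X1], rule_format]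
    note c2 = conjunct2[OF conjunct2[OF X2], rule_format]
    note c3 = conjunct2[OF conjunct2[OF X3], rule_format]
    define G where "G = X1 \<union> X2 \<union> X3"
    have G: "finite G" "G \<subseteq> cubes" unfolding G_def using X by (simp_all only: finite_Un Un_least)
    note [measurable] = measurable_paraproduct_sum[OF G(2)]
    have subcubes: "X1 \<subseteq> G" "X2 \<subseteq> G" "X3 \<subseteq> G" unfolding G_def by blast+
    have n1: "Lp_integral \<mu> p (\<lambda>x. paraproduct_sum G f x - u x) \<le> ennreal \<tau>" by (rule less_imp_le[OF c1[OF G(1) subcubes(1) G(2)]])
    have n2: "Lp_integral \<mu> p (\<lambda>x. paraproduct_sum G g x - v x) \<le> ennreal \<tau>" by (rule less_imp_le[OF c2[OF G(1) subcubes(2) G(2)]])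
    have n3: "Lp_integral \<mu> p (\<lambda>x. w x - paraproduct_sum G h x) \<le> ennreal \<tau>"
      by (subst Lp_integral_minus_commute) (rule less_imp_le[OF c3[OF G(1) subcubes(3) G(2)]])
    let ?r = "\<lambda>x. c * (paraproduct_sum G f x - u x) + d * (paraproduct_sum G g x - v x)"
    have eq: "w x - (c * u x + d * v x) = (w x - paraproduct_sum G h x) + ?r x" for x
      using lin[OF G(2), of x] by (simp add: algebra_simps)
    have "Lp_integral \<mu> p ?r \<le> ennreal (2 powr p) * (Lp_integral \<mu> p (\<lambda>x. c * (paraproduct_sum G f x - u x)) + Lp_integral \<mu> p (\<lambda>x. d * (paraproduct_sum G g x - v x)))"
      by (rule Lp_integral_add[OF _ _ p_pos]) measurable
    also have "\<dots> = ennreal (2 powr p) * (ennreal (norm c powr p) * Lp_integral \<mu> p (\<lambda>x. paraproduct_sum G f x - u x) + ennreal (norm d powr p) * Lp_integral \<mu> p (\<lambda>x. paraproduct_sum G g x - v x))"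
      by (subst (1 2) Lp_integral_cmult) auto
    also have "\<dots> \<le> ennreal (2 powr p) * (ennreal (norm c powr p) * ennreal \<tau> + ennreal (norm d powr p) * ennreal \<tau>)"
      by (intro mult_left_mono add_mono n1 n2) auto
    also have "\<dots> = ennreal (2 powr p * (norm c powr p + norm d powr p) * \<tau>)"
      using \<tau> by (simp add: distrib_left distrib_right mult.assoc flip: ennreal_plus ennreal_mult)
    finally have r: "Lp_integral \<mu> p ?r \<le> ennreal (2 powr p * (norm c powr p + norm d powr p) * \<tau>)" .
    have "Lp_integral \<mu> p (\<lambda>x. w x - (c * u x + d * v x)) \<le> ennreal (2 powr p) * (Lp_integral \<mu> p (\<lambda>x. w x - paraproduct_sum G h x) + Lp_integral \<mu> p ?r)"
      unfolding eq by (rule Lp_integral_add[OF _ _ p_pos]) measurable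
    also have "\<dots> \<le> ennreal (2 powr p) * (ennreal \<tau> + ennreal (2 powr p * (norm c powr p + norm d powr p) * \<tau>))"
      by (intro mult_left_mono add_mono n3 r) auto
    also have "\<dots> = ennreal (2 powr p * (\<tau> + 2 powr p * (norm c powr p + norm d powr p) * \<tau>))"
      using \<tau> by (simp flip: ennreal_plus ennreal_mult)
    also have "2 powr p * (\<tau> + 2 powr p * (norm c powr p + norm d powr p) * \<tau>) = C * \<tau>"
      by (simp add: C_def distrib_left distrib_right mult.assoc)
    also have "C * \<tau> = \<epsilon>" using C by (simp add: \<tau>_def)
    finally show ?thesis .
  qed
  then have "Lp_integral \<mu> p (\<lambda>x. w x - (c * u x + d * v x)) \<le> 0 + ennreal \<epsilon>" if "0 < \<epsilon>" for \<epsilon>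
    using that by simp
  then have "Lp_integral \<mu> p (\<lambda>x. w x - (c * u x + d * v x)) \<le> 0" by (rule ennreal_le_epsilon)
  then have z: "Lp_integral \<mu> p (\<lambda>x. w x - (c * u x + d * v x)) = 0" by simp
  have "(\<lambda>x. w x - (c * u x + d * v x)) \<in> borel_measurable \<mu>" by measurable
  from iffD1[OF Lp_integral_eq_0_iff[OF this p_pos] z] have "AE x in \<mu>. w x - (c * u x + d * v x) = 0" .
  then show ?thesis by simp
qed

text \<open>Large finite sums are close to T f, and what they contain beyond F avoids F, so its
  contribution is small uniformly on bounded sets.\<close>

lemma T_approx:
  assumes \<epsilon>: "0 < \<epsilon>"
    and F: "F \<subseteq> cubes" "finite F" "\<And>G. finite G \<Longrightarrow> G \<subseteq> cubes - F \<Longrightarrow> Lp_integral \<mu> p (paraproduct_sum G f) \<le> ennreal \<epsilon> * Lp_integral \<mu> p f"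
    and f: "f \<in> Lp_space \<mu> p" "Lp_integral \<mu> p f \<le> ennreal B" and B: "0 \<le> B"
  shows "Lp_integral \<mu> p (\<lambda>x. T f x - paraproduct_sum F f x) \<le> ennreal (2 powr p * (\<epsilon> + \<epsilon> * B))"
proof -
  have Tm: "T f \<in> borel_measurable \<mu>" using T_Lp[OF f(1)] by (simp add: Lp_space_iff)
  from sums_to_approx[OF sums_to_T[OF f(1)] \<epsilon>] obtain X where X: "finite X \<and> X \<subseteq> cubes \<and>
    (\<forall>G. finite G \<longrightarrow> X \<subseteq> G \<longrightarrow> G \<subseteq> cubes \<longrightarrow> Lp_integral \<mu> p (\<lambda>x. paraproduct_sum G f x - T f x) < ennreal \<epsilon>)" by (elim exE)
  define G where "G = X \<union> F"
  have G: "finite G" "X \<subseteq> G" "G \<subseteq> cubes" "F \<subseteq> G" using X F(1,2) by (auto simp: G_def)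
  have 1: "Lp_integral \<mu> p (\<lambda>x. T f x - paraproduct_sum G f x) \<le> ennreal \<epsilon>"
    by (subst Lp_integral_minus_commute) (rule less_imp_le[OF conjunct2[OF conjunct2[OF X], rule_format, OF G(1-3)]])
  have "Lp_integral \<mu> p (\<lambda>x. paraproduct_sum G f x - paraproduct_sum F f x) = Lp_integral \<mu> p (paraproduct_sum (G - F) f)"
    using paraproduct_sum_superset[OF G(1,4), of f] by simp
  also have "\<dots> \<le> ennreal \<epsilon> * Lp_integral \<mu> p f" by (rule F(3)) (use G in auto)
  also have "\<dots> \<le> ennreal \<epsilon> * ennreal B" by (rule mult_left_mono[OF f(2)]) simp
  finally have 2: "Lp_integral \<mu> p (\<lambda>x. paraproduct_sum G f x - paraproduct_sum F f x) \<le> ennreal \<epsilon> * ennreal B" .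
  have "Lp_integral \<mu> p (\<lambda>x. T f x - paraproduct_sum F f x) \<le> ennreal (2 powr p) * (Lp_integral \<mu> p (\<lambda>x. T f x - paraproduct_sum G f x) + Lp_integral \<mu> p (\<lambda>x. paraproduct_sum G f x - paraproduct_sum F f x))"
    by (rule Lp_integral_triangle[OF Tm measurable_paraproduct_sum[OF G(3)] measurable_paraproduct_sum[OF F(1)] p_pos])
  also have "\<dots> \<le> ennreal (2 powr p) * (ennreal \<epsilon> + ennreal \<epsilon> * ennreal B)"
    by (intro mult_left_mono add_mono 1 2) simp
  also have "\<dots> = ennreal (2 powr p * (\<epsilon> + \<epsilon> * B))" using \<epsilon> B by (simp flip: ennreal_plus ennreal_mult)
  finally show ?thesis .
qed

section \<open>Compactness\<close>

text \<open>Jensen on the single cube Q bounds \<mu>(Q) |<f>_Q|^p by the integral of |f|^p; on null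
  cubes the average is 0 by convention.\<close>

lemma average_bound:
  assumes Q: "Q \<in> cubes" and B: "0 \<le> B"
  shows "\<exists>A\<ge>0. \<forall>f::real ^ 'd \<Rightarrow> 'b. f \<in> Lp_space \<mu> p \<longrightarrow> Lp_integral \<mu> p f \<le> ennreal B \<longrightarrow> norm (average \<mu> f Q) \<le> A"
proof (cases "emeasure \<mu> Q = 0")
  case True
  then show ?thesis by (intro exI[of _ 0]) (simp add: average_def)
next
  case False
  obtain k where k: "Q \<in> D k" using Q by blast
  have w: "0 < measure \<mu> Q" using False emeasure_D[OF k] by (simp add: zero_less_measure_iff)
  have "norm (average \<mu> f Q) \<le> (B / measure \<mu> Q) powr (1/p)"
    if f: "f \<in> Lp_space \<mu> p" "Lp_integral \<mu> p f \<le> ennreal B" for f :: "real ^ 'd \<Rightarrow> 'b"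
  proof -
    have "measure \<mu> Q * norm (average \<mu> f Q) powr p = (LINT x:Q|\<mu>. norm (average \<mu> f Q) powr p)"
      by (simp add: set_integral_const_D[OF k])
    also have "\<dots> = (LINT x:Q|\<mu>. norm (cond_exp k f x - 0) powr p)"
      by (rule set_integral_cong_D[OF k]) (simp add: cond_exp_eq[OF k])
    also have "\<dots> \<le> (LINT x:Q|\<mu>. norm (f x - 0) powr p)"
      by (rule jensen_cond_exp[OF p k order_refl Lp_set_integrable(2)[OF p f(1) k]])
         (use Lp_set_integrable(1)[OF p f(1) k] in simp)
    also have "\<dots> \<le> B"
    proof -
      have "ennreal (LINT x:Q|\<mu>. norm (f x) powr p) = (\<integral>\<^sup>+x\<in>Q. ennreal (norm (f x) powr p) \<partial>\<mu>)"
        by (rule nn_integral_D_eq[OF Lp_set_integrable(1)[OF p f(1) k], symmetric]) simp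
      also have "\<dots> \<le> Lp_integral \<mu> p f" unfolding Lp_integral_def by (intro nn_integral_mono) (simp add: indicator_def)
      also have "\<dots> \<le> ennreal B" by (rule f(2))
      finally show ?thesis using B by (simp add: ennreal_le_iff)
    qed
    finally have "norm (average \<mu> f Q) powr p \<le> B / measure \<mu> Q" using w by (simp add: field_simps)
    then have "(norm (average \<mu> f Q) powr p) powr (1/p) \<le> (B / measure \<mu> Q) powr (1/p)"
      using p by (intro powr_mono2) auto
    then show ?thesis using p by (simp add: powr_powr)
  qed
  then show ?thesis by (intro exI[of _ "(B / measure \<mu> Q) powr (1/p)"]) simp
qed

text \<open>A diagonal argument over the countably many cubes, so that one subsequence serves every
  finite-rank approximation. Scalars lie in a Euclidean space, where bounded sequences have
  convergent subsequences.\<close>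

lemma convergent_averages_subsequence:
  fixes F :: "nat \<Rightarrow> real ^ 'd \<Rightarrow> 'b"
  assumes F: "\<And>n. F n \<in> Lp_space \<mu> p" "\<And>n. Lp_integral \<mu> p (F n) \<le> ennreal B" and B: "0 \<le> B"
  shows "\<exists>r. strict_mono (r :: nat \<Rightarrow> nat) \<and> (\<forall>Q\<in>cubes. convergent (\<lambda>n. average \<mu> (F (r n)) Q))"
proof -
  have "\<forall>Q\<in>cubes. \<exists>A. 0 \<le> A \<and> (\<forall>n. norm (average \<mu> (F n) Q) \<le> A)"
  proof
    fix Q assume Q: "Q \<in> cubes"
    from average_bound[OF Q B] obtain A where A: "0 \<le> A \<and>
      (\<forall>f::real ^ 'd \<Rightarrow> 'b. f \<in> Lp_space \<mu> p \<longrightarrow> Lp_integral \<mu> p f \<le> ennreal B \<longrightarrow> norm (average \<mu> f Q) \<le> A)" by (elim exE)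
    have "norm (average \<mu> (F n) Q) \<le> A" for n
      by (rule conjunct2[OF A, rule_format, OF F])
    then show "\<exists>A. 0 \<le> A \<and> (\<forall>n. norm (average \<mu> (F n) Q) \<le> A)"
      by (intro exI[of _ A] conjI allI conjunct1[OF A])
  qed
  from bchoice[OF this] obtain A where A: "\<forall>Q\<in>cubes. 0 \<le> A Q \<and> (\<forall>n. norm (average \<mu> (F n) Q) \<le> A Q)" by (elim exE)
  have cnt: "countable cubes" by (intro countable_UN countable_D) simp
  \<comment> \<open>Dividing by \<open>A Q + 1\<close> makes the bound uniform in Q, as the diagonal
    argument requires; the added 1 keeps the divisor positive.\<close>
  have bnd: "norm ((1 / (A Q + 1)) *\<^sub>R average \<mu> (F n) Q) \<le> 1" if "Q \<in> cubes" for n Q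
  proof -
    have "0 \<le> A Q" "norm (average \<mu> (F n) Q) \<le> A Q" using bspec[OF A that] by simp_all
    then show ?thesis by (simp add: divide_le_eq)
  qed
  have "\<exists>r. strict_mono (r :: nat \<Rightarrow> nat) \<and>
    (\<forall>Q\<in>cubes. \<exists>l. (\<lambda>n. (1 / (A Q + 1)) *\<^sub>R average \<mu> (F (r n)) Q) \<longlonglongrightarrow> l)"
    by (rule function_convergent_subsequence[of cubes "\<lambda>n Q. (1 / (A Q + 1)) *\<^sub>R average \<mu> (F n) Q" 1, OF cnt bnd])
       (assumption, rule exI, rule conjI, assumption, rule ballI)
  then obtain r where "strict_mono (r :: nat \<Rightarrow> nat) \<and>
    (\<forall>Q\<in>cubes. \<exists>l. (\<lambda>n. (1 / (A Q + 1)) *\<^sub>R average \<mu> (F (r n)) Q) \<longlonglongrightarrow> l)" by (elim exE)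
  note r = conjunct1[OF this] bspec[OF conjunct2[OF this]]
  have "convergent (\<lambda>n. average \<mu> (F (r n)) Q)" if Q: "Q \<in> cubes" for Q
  proof -
    have A1: "A Q + 1 \<noteq> 0" using bspec[OF A Q] by linarith
    obtain l where "(\<lambda>n. (1 / (A Q + 1)) *\<^sub>R average \<mu> (F (r n)) Q) \<longlonglongrightarrow> l" using r(2)[OF Q] by blast
    then have "(\<lambda>n. (A Q + 1) *\<^sub>R ((1 / (A Q + 1)) *\<^sub>R average \<mu> (F (r n)) Q)) \<longlonglongrightarrow> (A Q + 1) *\<^sub>R l"
      by (intro tendsto_scaleR tendsto_const)
    then have "(\<lambda>n. average \<mu> (F (r n)) Q) \<longlonglongrightarrow> (A Q + 1) *\<^sub>R l" using A1 by simp
    then show ?thesis by (rule convergentI)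
  qed
  then show ?thesis using r(1) by (intro exI[of _ r] conjI ballI)
qed

text \<open>Only finitely many averages enter. Once they are within t of each other, linearity and
  the bound by averages apply to the difference.\<close>

lemma paraproduct_sum_Cauchy:
  fixes f :: "nat \<Rightarrow> real ^ 'd \<Rightarrow> 'b"
  assumes G: "finite G" "G \<subseteq> cubes" and f: "\<And>n. f n \<in> Lp_space \<mu> p"
    and conv: "\<And>Q. Q \<in> cubes \<Longrightarrow> convergent (\<lambda>n. average \<mu> (f n) Q)" and \<tau>: "0 < \<tau>"
  shows "\<exists>N. \<forall>m\<ge>N. \<forall>n\<ge>N. Lp_integral \<mu> p (\<lambda>x. paraproduct_sum G (f m) x - paraproduct_sum G (f n) x) \<le> ennreal \<tau>"
proof -
  let ?H = "\<lambda>x. \<Sum>Q\<in>G. norm (mart_diff \<mu> cubes b Q x)"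
  define h where "h = enn2real (Lp_integral \<mu> p ?H)"
  have h: "Lp_integral \<mu> p ?H = ennreal h" "0 \<le> h" using Lp_integral_sum_mart_diff[OF G] by (auto simp: h_def ennreal_enn2real)
  define t where "t = (\<tau> / (h + 1)) powr (1/p)"
  have t: "0 < t" "t powr p * h \<le> \<tau>"
    using \<tau> h p by (auto simp: t_def powr_powr field_simps)
  have "\<forall>Q\<in>G. \<exists>N. \<forall>m\<ge>N. \<forall>n\<ge>N. norm (average \<mu> (f m) Q - average \<mu> (f n) Q) < t"
  proof
    fix Q assume "Q \<in> G"
    then have "Cauchy (\<lambda>n. average \<mu> (f n) Q)" using conv[OF subsetD[OF G(2)]] by (simp add: Cauchy_convergent_iff)
    then show "\<exists>N. \<forall>m\<ge>N. \<forall>n\<ge>N. norm (average \<mu> (f m) Q - average \<mu> (f n) Q) < t"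
      using t(1) by (rule CauchyD)
  qed
  from bchoice[OF this] obtain N where N: "\<forall>Q\<in>G. \<forall>m\<ge>N Q. \<forall>n\<ge>N Q. norm (average \<mu> (f m) Q - average \<mu> (f n) Q) < t"
    by (elim exE)
  define N0 where "N0 = (\<Sum>Q\<in>G. N Q)"
  have N0: "N Q \<le> N0" if "Q \<in> G" for Q unfolding N0_def using G(1) that by (intro member_le_sum) auto
  have "Lp_integral \<mu> p (\<lambda>x. paraproduct_sum G (f m) x - paraproduct_sum G (f n) x) \<le> ennreal \<tau>" if mn: "N0 \<le> m" "N0 \<le> n" for m n
  proof -
    let ?d = "\<lambda>x. f m x + (-1) * f n x"
    have Lpn: "(\<lambda>x. (-1) * f n x) \<in> Lp_space \<mu> p" by (rule Lp_cmult[OF f])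
    have "paraproduct_sum G ?d x = paraproduct_sum G (f m) x - paraproduct_sum G (f n) x" for x
      using paraproduct_sum_add[OF f[of m] Lpn G(2), of x] paraproduct_sum_cmult[of G "-1" "f n" x] by simp
    then have "Lp_integral \<mu> p (\<lambda>x. paraproduct_sum G (f m) x - paraproduct_sum G (f n) x) = Lp_integral \<mu> p (paraproduct_sum G ?d)" by (simp add: Lp_integral_def)
    also have "\<dots> \<le> ennreal (t powr p) * Lp_integral \<mu> p ?H"
    proof (rule Lp_integral_paraproduct_sum_le_averages[OF G])
      fix Q assume Q: "Q \<in> G"
      have "average \<mu> ?d Q = average \<mu> (f m) Q - average \<mu> (f n) Q"
        using average_add[OF f[of m] Lpn subsetD[OF G(2) Q]] average_cmult[of "-1" "f n" Q] by simp
      moreover have "norm (average \<mu> (f m) Q - average \<mu> (f n) Q) < t"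
        using N[rule_format, OF Q order_trans[OF N0[OF Q] mn(1)] order_trans[OF N0[OF Q] mn(2)]] .
      ultimately show "norm (average \<mu> ?d Q) \<le> t" by simp
    qed (use t in simp)
    also have "\<dots> = ennreal (t powr p * h)" using h by (simp add: ennreal_mult)
    also have "\<dots> \<le> ennreal \<tau>" by (rule ennreal_leI[OF t(2)])
    finally show ?thesis .
  qed
  then show ?thesis by blast
qed

text \<open>The images along the subsequence are Cauchy: each is uniformly close to its sum over a
  finite X, and these finite sums are Cauchy.\<close>

lemma T_compact:
  fixes F :: "nat \<Rightarrow> real ^ 'd \<Rightarrow> 'b"
  assumes F: "\<And>n. F n \<in> Lp_space \<mu> p" "\<And>n. Lp_integral \<mu> p (F n) \<le> ennreal B" and B: "0 \<le> B"
  shows "\<exists>g\<in>Lp_space \<mu> p. \<exists>r. strict_mono (r :: nat \<Rightarrow> nat) \<and> (\<lambda>n. Lp_integral \<mu> p (\<lambda>x. T (F (r n)) x - g x)) \<longlonglongrightarrow> 0"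
proof -
  from convergent_averages_subsequence[where F = F, OF F(1) F(2) B] obtain r where
    r_conv: "strict_mono (r :: nat \<Rightarrow> nat) \<and> (\<forall>Q\<in>cubes. convergent (\<lambda>n. average \<mu> (F (r n)) Q))" by (elim exE)
  note r = conjunct1[OF r_conv] and conv = bspec[OF conjunct2[OF r_conv]]
  define c where "c = (2::real) powr p"
  have c: "1 \<le> c" unfolding c_def using p by (intro ge_one_powr_ge_zero) auto
  have "\<exists>g\<in>Lp_space \<mu> p. (\<lambda>n. Lp_integral \<mu> p (\<lambda>x. T (F (r n)) x - g x)) \<longlonglongrightarrow> 0"
  proof (rule Lp_complete[OF p_pos T_Lp[OF F(1)]])
    fix \<epsilon> :: real assume \<epsilon>: "0 < \<epsilon>"
    \<comment> \<open>Two triangle inequalities with factor c = 2^p produce c^2 \<tau> and (c^2 +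
      c^3) \<delta> (1 + B); with these choices the total is at most 3/4 of \<epsilon>.\<close>
    define \<delta> where "\<delta> = \<epsilon> / (4 * c^3 * (1 + B))"
    define \<tau> where "\<tau> = \<epsilon> / (4 * c^2)"
    have \<delta>: "0 < \<delta>" "0 < \<tau>" using \<epsilon> c B by (auto simp: \<delta>_def \<tau>_def)
    from small_paraproduct_sum[OF \<delta>(1)] obtain X where X: "X \<subseteq> cubes \<and> finite X \<and> (\<forall>G f. finite G \<longrightarrow> G \<subseteq> cubes - X \<longrightarrow> f \<in> Lp_space \<mu> p \<longrightarrow>
      Lp_integral \<mu> p (paraproduct_sum G f) \<le> ennreal \<delta> * Lp_integral \<mu> p f)" by (elim exE)
    note X1 = conjunct1[OF X] and X2 = conjunct1[OF conjunct2[OF X]] and X3 = conjunct2[OF conjunct2[OF X], rule_format]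
    have app: "Lp_integral \<mu> p (\<lambda>x. T (F n) x - paraproduct_sum X (F n) x) \<le> ennreal (c * (\<delta> + \<delta> * B))" for n
      unfolding c_def by (rule T_approx[OF \<delta>(1) X1 X2 X3[OF _ _ F(1)] F(1) F(2) B])
    have "\<exists>N. \<forall>m\<ge>N. \<forall>n\<ge>N. Lp_integral \<mu> p (\<lambda>x. paraproduct_sum X (F (r m)) x - paraproduct_sum X (F (r n)) x) \<le> ennreal \<tau>"
      by (rule paraproduct_sum_Cauchy[OF X2 X1 F(1) conv \<delta>(2)])
    then obtain N where
      N: "\<forall>m\<ge>N. \<forall>n\<ge>N. Lp_integral \<mu> p (\<lambda>x. paraproduct_sum X (F (r m)) x - paraproduct_sum X (F (r n)) x) \<le> ennreal \<tau>" by (elim exE)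
    have "Lp_integral \<mu> p (\<lambda>x. T (F (r m)) x - T (F (r n)) x) \<le> ennreal \<epsilon>" if mn: "N \<le> m" "N \<le> n" for m n
    proof -
      have Tm: "T (F n) \<in> borel_measurable \<mu>" for n using T_Lp[OF F(1)] by (simp add: Lp_space_iff)
      have "Lp_integral \<mu> p (\<lambda>x. paraproduct_sum X (F (r m)) x - T (F (r n)) x)
         \<le> ennreal c * (Lp_integral \<mu> p (\<lambda>x. paraproduct_sum X (F (r m)) x - paraproduct_sum X (F (r n)) x) + Lp_integral \<mu> p (\<lambda>x. paraproduct_sum X (F (r n)) x - T (F (r n)) x))"
        unfolding c_def by (rule Lp_integral_triangle[OF measurable_paraproduct_sum[OF X1] measurable_paraproduct_sum[OF X1] Tm p_pos])
      also have "\<dots> \<le> ennreal c * (ennreal \<tau> + ennreal (c * (\<delta> + \<delta> * B)))"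
      proof (intro mult_left_mono add_mono)
        show "Lp_integral \<mu> p (\<lambda>x. paraproduct_sum X (F (r n)) x - T (F (r n)) x) \<le> ennreal (c * (\<delta> + \<delta> * B))"
          by (subst Lp_integral_minus_commute) (rule app)
      qed (use N mn in auto)
      also have "\<dots> = ennreal (c * (\<tau> + c * (\<delta> + \<delta> * B)))"
        using \<delta> B c by (simp flip: ennreal_plus ennreal_mult)
      finally have 1: "Lp_integral \<mu> p (\<lambda>x. paraproduct_sum X (F (r m)) x - T (F (r n)) x) \<le> ennreal (c * (\<tau> + c * (\<delta> + \<delta> * B)))" .
      have "Lp_integral \<mu> p (\<lambda>x. T (F (r m)) x - T (F (r n)) x)
         \<le> ennreal c * (Lp_integral \<mu> p (\<lambda>x. T (F (r m)) x - paraproduct_sum X (F (r m)) x) + Lp_integral \<mu> p (\<lambda>x. paraproduct_sum X (F (r m)) x - T (F (r n)) x))"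
        unfolding c_def by (rule Lp_integral_triangle[OF Tm measurable_paraproduct_sum[OF X1] Tm p_pos])
      also have "\<dots> \<le> ennreal c * (ennreal (c * (\<delta> + \<delta> * B)) + ennreal (c * (\<tau> + c * (\<delta> + \<delta> * B))))"
        by (intro mult_left_mono add_mono app 1) simp
      also have "\<dots> = ennreal (c * (c * (\<delta> + \<delta> * B) + c * (\<tau> + c * (\<delta> + \<delta> * B))))"
        using \<delta> B c by (simp flip: ennreal_plus ennreal_mult)
      also have "\<dots> \<le> ennreal \<epsilon>"
      proof (rule ennreal_leI)
        have db: "\<delta> + \<delta> * B = \<epsilon> / (4 * c^3)"
        proof -
          have "\<delta> + \<delta> * B = \<delta> * (1 + B)" by (simp add: distrib_left)
          also have "\<dots> = \<epsilon> / (4 * c^3)" using B by (simp add: \<delta>_def)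
          finally show ?thesis .
        qed
        have e1: "c * (c * (\<epsilon> / (4 * c^3))) = \<epsilon> / (4 * c)" using c by (simp add: power3_eq_cube field_simps)
        have e2: "c * (c * \<tau>) = \<epsilon> / 4" using c by (simp add: \<tau>_def power2_eq_square field_simps)
        have e3: "c * (\<epsilon> / (4 * c)) = \<epsilon> / 4" using c by simp
        have "\<epsilon> / (4 * c) \<le> \<epsilon> / 4" using c \<epsilon> by (intro divide_left_mono) auto
        then show "c * (c * (\<delta> + \<delta> * B) + c * (\<tau> + c * (\<delta> + \<delta> * B))) \<le> \<epsilon>"
          unfolding db distrib_left e1 e2 e3 using \<epsilon> by linarith
      qed
      finally show ?thesis .
    qed
    then show "\<exists>N. \<forall>m\<ge>N. \<forall>n\<ge>N. Lp_integral \<mu> p (\<lambda>x. T (F (r m)) x - T (F (r n)) x) \<le> ennreal \<epsilon>" by blast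
  qed
  then obtain g where "g \<in> Lp_space \<mu> p" "(\<lambda>n. Lp_integral \<mu> p (\<lambda>x. T (F (r n)) x - g x)) \<longlonglongrightarrow> 0" by blast
  then show ?thesis using r by (intro bexI[of _ g] exI[of _ r] conjI)
qed

text \<open>Functions equal almost everywhere have the same averages, hence the same possible sums,
  and the choice operator returns the same representative; this is why the equality is
  exact.\<close>

lemma T_cong_AE:
  assumes "AE x in \<mu>. f x = g x" "f \<in> Lp_space \<mu> p" "g \<in> Lp_space \<mu> p"
  shows "T f = T g"
proof -
  have [measurable]: "f \<in> borel_measurable \<mu>" "g \<in> borel_measurable \<mu>" using assms by (auto simp: Lp_space_iff)
  have "average \<mu> f Q = average \<mu> g Q" if Qc: "Q \<in> cubes" for Q
  proof -
    obtain k where Q: "Q \<in> D k" using Qc by blast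
    note [measurable] = D_sets[OF Q]
    have "(LINT x:Q|\<mu>. f x) = (LINT x:Q|\<mu>. g x)"
      unfolding set_lebesgue_integral_def by (rule integral_cong_AE) (use assms(1) in auto)
    then show ?thesis by (simp add: average_def)
  qed
  then have paraproduct_sum_eq: "paraproduct_sum G f = paraproduct_sum G g" if "G \<subseteq> cubes" for G
    unfolding paraproduct_sum_def[abs_def] using that by (intro ext sum.cong refl arg_cong2[of _ _ _ _ "(*)"]) blast
  have "\<forall>\<^sub>F G in finite_subsets_at_top cubes. G \<subseteq> cubes"
    by (auto simp: eventually_finite_subsets_at_top)
  then have "\<forall>\<^sub>F G in finite_subsets_at_top cubes. Lp_integral \<mu> p (\<lambda>x. paraproduct_sum G f x - u x) = Lp_integral \<mu> p (\<lambda>x. paraproduct_sum G g x - u x)" for u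
    by (rule eventually_mono) (simp only: paraproduct_sum_eq)
  then have "((\<lambda>G. Lp_integral \<mu> p (\<lambda>x. paraproduct_sum G f x - u x)) \<longlongrightarrow> 0) (finite_subsets_at_top cubes) \<longleftrightarrow>
      ((\<lambda>G. Lp_integral \<mu> p (\<lambda>x. paraproduct_sum G g x - u x)) \<longlongrightarrow> 0) (finite_subsets_at_top cubes)" for u
    by (rule tendsto_cong)
  then have "sums_to f u = sums_to g u" for u by (simp add: sums_to_iff)
  then show ?thesis by (simp add: paraproduct_def)
qed

theorem paraproduct_compact_VMO: "paraproduct_compact \<mu> p cubes b"
  unfolding paraproduct_compact_def compact_operator_on_Lp_def
proof (intro conjI ballI allI impI)
  show "\<exists>g. sums_to f g" if "f \<in> Lp_space \<mu> p" for f by (rule sums_to_exists[OF that])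
  show "T f \<in> Lp_space \<mu> p" if "f \<in> Lp_space \<mu> p" for f by (rule T_Lp[OF that])
  show "AE x in \<mu>. T f x = T g x" if "f \<in> Lp_space \<mu> p" "g \<in> Lp_space \<mu> p" "AE x in \<mu>. f x = g x" for f g
    using T_cong_AE[OF that(3,1,2)] by simp
  show "AE x in \<mu>. T (\<lambda>y. f y + g y) x = T f x + T g x" if "f \<in> Lp_space \<mu> p" "g \<in> Lp_space \<mu> p" for f g
    using sums_to_linear_unique[OF sums_to_T[OF that(1)] sums_to_T[OF that(2)] sums_to_T[OF Lp_add[OF that]], of 1 1] paraproduct_sum_add[OF that] by simp
  show "AE x in \<mu>. T (\<lambda>y. c * f y) x = c * T f x" if "f \<in> Lp_space \<mu> p" for f c
    using sums_to_linear_unique[OF sums_to_T[OF that] sums_to_T[OF that] sums_to_T[OF Lp_cmult[OF that]], of c c 0] paraproduct_sum_cmult[of _ c f] by simp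
  fix F :: "nat \<Rightarrow> real ^ 'd \<Rightarrow> 'b"
  assume F: "(\<forall>n. F n \<in> Lp_space \<mu> p) \<and> (SUP n. Lp_norm \<mu> p (F n)) < \<infinity>"
  obtain c where c: "0 \<le> c" "(SUP n. Lp_norm \<mu> p (F n)) = ennreal c"
    using F by (cases "SUP n. Lp_norm \<mu> p (F n)") auto
  \<comment> \<open>The value c + 1 provides the strict inequality under which roots and p-th powers
    are compared.\<close>
  have bound: "Lp_integral \<mu> p (F n) \<le> ennreal ((c + 1) powr p)" for n
  proof -
    have "ennreal_rpow (Lp_integral \<mu> p (F n)) (1/p) \<le> ennreal c"
      unfolding c(2)[symmetric] Lp_norm_Lp_integral[symmetric] by (rule SUP_upper) simp
    also have "\<dots> < ennreal (c + 1)" using c(1) by (simp add: ennreal_less_iff)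
    finally show ?thesis using c(1) by (subst (asm) ennreal_rpow_less_iff[OF p_pos]) auto
  qed
  from T_compact[OF _ bound, of] F
  show "\<exists>g\<in>Lp_space \<mu> p. \<exists>r. strict_mono r \<and> (\<lambda>n. Lp_norm \<mu> p (\<lambda>x. T (F (r n)) x - g x)) \<longlonglongrightarrow> 0"
    unfolding tendsto_Lp_norm_iff[OF p_pos] by simp
qed

end

theorem theorem6p7:
  fixes p :: real
    and D :: "int \<Rightarrow> (real ^ 'd) set set"
    and \<mu> :: "(real ^ 'd) measure"
    and b :: "real ^ 'd \<Rightarrow> 'c::{real_normed_field, euclidean_space}"
  assumes "1 < p"
    and "dyadic_system D"
    and "sets \<mu> = sets borel"
    and "locally_finite_measure \<mu>"
    and "b \<in> VMO \<mu> p (\<Union>k. D k)"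
  shows "paraproduct_compact \<mu> p (\<Union>k. D k) b"
proof -
  interpret dyadic_VMO D \<mu> p b
    by unfold_locales (fact assms)+
  show ?thesis by (rule paraproduct_compact_VMO)
qed

end
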